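(* Every continuous action by isometries of $\mathrm{Sp}_4(\mathbb{R})=\{g\in\mathrm{GL}_4(\mathbb{R}) : g^TJg=J\}$, where $J=\begin{pmatrix}0&I_2\\-I_2&0\end{pmatrix}$, on a uniformly convex Banach space has a fixed point.
   Context: A Banach space $E$ (over $\mathbb{R}$) is uniformly convex if for every $\varepsilon\in(0,2]$ there is $\delta>0$ such that for all unit vectors $\xi,\eta$ with $\|\xi-\eta\|\ge\varepsilon$ one has $\|(\xi+\eta)/2\|\le 1-\delta$. *)

theory Defs
  imports "HOL-Analysis.Analysis"
begin

definition symplJ :: "real^4^4" where
  "symplJ = (\<chi> i j. if (i = 1 \<and> j = 3) \<or> (i = 2 \<and> j = 4) then 1
                     else if (i = 3 \<and> j = 1) \<or> (i = 4 \<and> j = 2) then -1 else 0)"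

definition Sp4 :: "(real^4^4) set" where
  "Sp4 = {g. invertible g \<and> transpose g ** symplJ ** g = symplJ}"

definition uniformly_convex :: "'a::real_normed_vector itself \<Rightarrow> bool" where
  "uniformly_convex TYPE('a) \<longleftrightarrow>
     (\<forall>\<epsilon>. 0 < \<epsilon> \<and> \<epsilon> \<le> 2 \<longrightarrow>
        (\<exists>\<delta>>0. \<forall>\<xi> \<eta> :: 'a. norm \<xi> = 1 \<and> norm \<eta> = 1 \<and> norm (\<xi> - \<eta>) \<ge> \<epsilon>
                  \<longrightarrow> norm ((1/2) *\<^sub>R (\<xi> + \<eta>)) \<le> 1 - \<delta>))"

definition continuous_isometric_action_Sp4 :: "(real^4^4 \<Rightarrow> 'a::metric_space \<Rightarrow> 'a) \<Rightarrow> bool" where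
  "continuous_isometric_action_Sp4 \<alpha> \<longleftrightarrow>
     (\<forall>x. \<alpha> (mat 1) x = x) \<and>
     (\<forall>g\<in>Sp4. \<forall>h\<in>Sp4. \<forall>x. \<alpha> (g ** h) x = \<alpha> g (\<alpha> h x)) \<and>
     (\<forall>g\<in>Sp4. \<forall>x y. dist (\<alpha> g x) (\<alpha> g y) = dist x y) \<and>
     continuous_on (Sp4 \<times> UNIV) (\<lambda>(g, x). \<alpha> g x)"

end

theory Submission
  imports Defs
begin

text \<open>An isometric action on a strictly convex space is affine. Suppose that a vector \<open>v\<close> is moved by at most \<open>e\<close>
  by the unipotents \<open>u\<^sub>\<alpha> t\<close> with \<open>\<bar>t\<bar> \<le> 1\<close>, for three roots \<open>\<alpha>\<close> that positively span the root plane. Conjugation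
  by the torus shows that displacements of \<open>v\<close> grow only logarithmically along every root subgroup. Averaging
  \<open>v\<close> successively over long segments of the three root subgroups therefore moves it by at most a constant times \<open>e\<close>, and it
  produces a point that is moved by at most \<open>e / 2\<close>; iterating, a Cauchy sequence converges to a fixed point.

  The gain comes from the nilpotent groups generated by two of the roots: averages over segments of the
  two flows \<open>x\<close> and \<open>y\<close> almost commute, up to an error that is
  exponentially small in the logarithm of their lengths and thus beats the logarithmic growth. For
  linear actions of Heisenberg groups this follows from uniform convexity, since a vector that is almost
  negated by the central commutator \<open>c (a * b)\<close> cannot be almost fixed by both \<open>x a\<close> and \<open>y b\<close>; the gain is
  multiplied over independent dyadic scales \<open>a / \<mu> ^ i\<close>, \<open>b * \<mu> ^ i\<close> with the same product.\<close>

section \<open>Averages along flows of affine isometries\<close>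

text \<open>One parameter \<open>k\<close> governs all sizes: with \<open>\<kappa> = 2 ^ k\<close>
  and \<open>\<Lambda> = \<kappa> ^ (6 * k)\<close>, the segments of the word have powers of
  \<Lambda> as lengths. A change of frequency scale by \<kappa> costs \<open>\<theta> k r\<close>
  times the displacement, which decays exponentially in \<open>k\<close>. At these lengths
  displacements are of order \<open>k ^ 2 * e\<close>, and the number \<open>P\<close> of scales is
  linear in \<open>k\<close>; an error of order \<open>k ^ 4 * \<theta> k r * e\<close> is small for
  large \<open>k\<close>.

  Two obstacles shape the argument. The descent through the scales must end, but a vector may have
  arbitrarily high frequencies. So \<open>smoothing\<close> first finds a nearby vector whose
  displacement under small group elements is linear in their size, and the descent stops there with
  an error \<eta>. Secondly, a short and a long root produce a second root subgroup
  \<open>d\<close>, against which \<open>c\<close> is not central; \<open>c\<close> and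
  \<open>d\<close> have to be removed in turn. That one word is almost fixed by all three root
  subgroups relies on widely separated lengths of its averages.\<close>

definition nonexp :: "('a::real_normed_vector \<Rightarrow> 'a) \<Rightarrow> bool" where
  "nonexp f \<longleftrightarrow> linear (\<lambda>v. f v - f 0) \<and> (\<forall>u v. norm (f u - f v) \<le> norm (u - v))"

text \<open>Nonexpansiveness of both \<open>h t\<close> and its inverse \<open>h (- t)\<close> makes
  every \<open>h t\<close> an isometry, see \<open>isom_flow_isom\<close>.\<close>

definition isom_flow :: "(real \<Rightarrow> 'a::real_normed_vector \<Rightarrow> 'a) \<Rightarrow> bool" where
  "isom_flow h \<longleftrightarrow> (\<forall>t. nonexp (h t)) \<and> (\<forall>v. h 0 v = v) \<and> (\<forall>s t v. h (s + t) v = h s (h t v))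
     \<and> (\<forall>v. continuous_on UNIV (\<lambda>t. h t v))"

text \<open>The segment is rescaled to the unit interval so that negative \<open>A\<close> makes
  sense; such lengths occur in \<open>scale_bound\<close>. An average of isometries need not be
  isometric, but it remains affine and 1-Lipschitz, which is why \<open>nonexp\<close> is the class
  of maps used throughout.\<close>

definition avg :: "(real \<Rightarrow> 'a::banach \<Rightarrow> 'a) \<Rightarrow> real \<Rightarrow> 'a \<Rightarrow> 'a" where
  "avg h A v = integral {0..1} (\<lambda>t. h (A * t) v)"

definition linear_part :: "('a::real_normed_vector \<Rightarrow> 'a) \<Rightarrow> 'a \<Rightarrow> 'a" where
  "linear_part f v = f v - f 0"

definition commuting :: "(real \<Rightarrow> 'a \<Rightarrow> 'a) \<Rightarrow> (real \<Rightarrow> 'a \<Rightarrow> 'a) \<Rightarrow> bool" where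
  "commuting g h \<longleftrightarrow> (\<forall>s t v. g s (h t v) = h t (g s v))"

lemma nonexp_norm: "nonexp f \<Longrightarrow> norm (f u - f v) \<le> norm (u - v)"
  by (simp add: nonexp_def)

lemma nonexp_diff: "nonexp f \<Longrightarrow> f u - f v = linear_part f (u - v)"
  using linear_diff[of "\<lambda>v. f v - f 0" u v] by (simp add: nonexp_def linear_part_def)

lemma linear_part_linear: "nonexp f \<Longrightarrow> linear (linear_part f)"
  by (simp add: nonexp_def linear_part_def[abs_def])

lemma linear_part_norm: "nonexp f \<Longrightarrow> norm (linear_part f v) \<le> norm v"
  by (metis diff_zero linear_part_def nonexp_norm)

lemma nonexp_linear_part: "nonexp f \<Longrightarrow> nonexp (linear_part f)"
  unfolding nonexp_def by (simp add: linear_part_def[abs_def])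

lemma linear_part_0 [simp]: "linear_part f 0 = 0"
  by (simp add: linear_part_def)

lemma nonexp_linear_iff: "f 0 = 0 \<Longrightarrow> nonexp f \<longleftrightarrow> linear f \<and> (\<forall>v. norm (f v) \<le> norm v)"
  unfolding nonexp_def by (metis (no_types, lifting) diff_zero eq_id_iff ext linear_diff)

lemma linear_part_bounded_linear: "nonexp f \<Longrightarrow> bounded_linear (linear_part f)"
  by (intro bounded_linear_intro[where K = 1])
    (auto simp: linear_part_norm linear_add[OF linear_part_linear] linear_scale[OF linear_part_linear])

lemma nonexp_cont: assumes "nonexp f" shows "continuous_on S f"
proof -
  have "f = (\<lambda>v. linear_part f v + f 0)"
    by (simp add: linear_part_def fun_eq_iff)
  moreover have "continuous_on S (\<lambda>v. linear_part f v + f 0)"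
    using linear_part_bounded_linear[OF assms]
    by (intro continuous_intros linear_continuous_on)
  ultimately show ?thesis by metis
qed

text \<open>The linear part passes through the integral by continuity, and the constant term is
  unchanged because the interval has length 1.\<close>

lemma nonexp_integral:
  fixes f :: "'a::banach \<Rightarrow> 'a"
  assumes "nonexp f" and c: "continuous_on {0..1} g"
  shows "f (integral {0..1::real} g) = integral {0..1} (\<lambda>t. f (g t))"
proof -
  have i: "g integrable_on {0..1}"
    using c by (rule integrable_continuous_real)
  have b: "bounded_linear (linear_part f)"
    using assms linear_part_bounded_linear by blast
  have "integral {0..1} (\<lambda>t. f (g t)) = integral {0..1} (\<lambda>t. linear_part f (g t) + f 0)"
    by (simp add: linear_part_def)
  also have "\<dots> = integral {0..1} (\<lambda>t. linear_part f (g t)) + integral {0..1::real} (\<lambda>t. f 0)"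
    by (intro Henstock_Kurzweil_Integration.integral_add integrable_continuous_real continuous_intros
        bounded_linear.continuous_on[OF b] c)
  also have "\<dots> = linear_part f (integral {0..1} g) + f 0"
    using integral_linear[OF i b] by (simp add: o_def)
  finally show ?thesis by (simp add: linear_part_def)
qed

lemma nonexp_compose: "nonexp f \<Longrightarrow> nonexp g \<Longrightarrow> nonexp (\<lambda>v. f (g v))"
proof -
  assume f: "nonexp f" and g: "nonexp g"
  have "(\<lambda>v. f (g v) - f (g 0)) = linear_part f \<circ> linear_part g"
    by (simp add: fun_eq_iff nonexp_diff[OF f] nonexp_diff[OF g])
  moreover have "linear (linear_part f \<circ> linear_part g)"
    using f g by (intro linear_compose linear_part_linear)
  ultimately show "nonexp (\<lambda>v. f (g v))"
    unfolding nonexp_def using nonexp_norm[OF f] nonexp_norm[OF g] order_trans by fastforce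
qed

lemma linear_part_compose: "nonexp f \<Longrightarrow> nonexp g \<Longrightarrow> linear_part (\<lambda>v. f (g v)) = (\<lambda>v. linear_part f (linear_part g v))"
  by (metis (no_types, lifting) ext diff_zero linear_part_def nonexp_diff)

lemma nonexp_id: "nonexp (\<lambda>v. v)"
  by (simp add: nonexp_def linear_iff)

lemma norm_integral_le:
  fixes g :: "real \<Rightarrow> 'a::banach"
  assumes "continuous_on {0..1} g" and "\<And>t. 0 \<le> t \<Longrightarrow> t \<le> 1 \<Longrightarrow> norm (g t) \<le> e"
  shows "norm (integral {0..1} g) \<le> e"
  using integral_bound[of 0 1 g e] assms by simp

lemma isom_flowD:
  assumes "isom_flow h"
  shows "nonexp (h t)" "h 0 v = v" "h (s + t) v = h s (h t v)" "continuous_on S (\<lambda>t. h t v)"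
  using assms continuous_on_subset[of UNIV _ S] unfolding isom_flow_def by blast+

lemma isom_flow_cont:
  assumes "isom_flow h" "continuous_on S f"
  shows "continuous_on S (\<lambda>t. h (f t) v)"
  using continuous_on_compose2[OF isom_flowD(4)[OF assms(1)] assms(2) subset_UNIV] .

lemma isom_flow_inv: "isom_flow h \<Longrightarrow> h (- t) (h t v) = v" "isom_flow h \<Longrightarrow> h t (h (- t) v) = v"
  using isom_flowD(3)[of h "-t" t v] isom_flowD(3)[of h t "-t" v] by (simp_all add: isom_flowD(2))

lemma isom_flow_isom: assumes "isom_flow h" shows "norm (h t u - h t v) = norm (u - v)"
  using nonexp_norm[OF isom_flowD(1)[OF assms], of t u v]
    nonexp_norm[OF isom_flowD(1)[OF assms], of "-t" "h t u" "h t v"]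
  by (simp add: isom_flow_inv[OF assms])

lemma isom_flow_disp_diff: assumes "isom_flow h" shows "norm (h s v - h t v) = norm (h (s - t) v - v)"
  using isom_flow_isom[OF assms, of t "h (s - t) v" v] isom_flowD(3)[OF assms, of t "s - t"] by simp

lemma isom_flow_linear_part: assumes "isom_flow h" shows "isom_flow (\<lambda>t. linear_part (h t))"
  unfolding isom_flow_def
proof safe
  fix s t v
  show "nonexp (linear_part (h t))" using assms by (simp add: nonexp_linear_part isom_flowD)
  show "linear_part (h 0) v = v" using assms by (simp add: linear_part_def isom_flowD)
  show "linear_part (h (s + t)) v = linear_part (h s) (linear_part (h t) v)"
    using nonexp_diff[OF isom_flowD(1)[OF assms], of s "h t v" "h t 0"]
    by (simp add: linear_part_def[of "h t"] linear_part_def[of "h (s+t)"] isom_flowD(3)[OF assms])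
  show "continuous_on UNIV (\<lambda>t. linear_part (h t) v)"
    unfolding linear_part_def by (intro continuous_on_diff isom_flowD(4)[OF assms])
qed

lemma isom_flow_scale: assumes "isom_flow h" shows "isom_flow (\<lambda>t. h (q * t))"
  unfolding isom_flow_def
  by (intro conjI allI isom_flowD(1)[OF assms] isom_flow_cont[OF assms] continuous_intros)
    (simp_all add: isom_flowD(2,3)[OF assms] distrib_left)

lemma isom_flow_id: "isom_flow (\<lambda>t v. v)"
  by (simp add: isom_flow_def nonexp_id)

lemma avg_cont: "isom_flow h \<Longrightarrow> continuous_on S (\<lambda>t. h (A * t) v)"
  by (rule isom_flow_cont) (auto intro!: continuous_intros)

lemma avg_integrable: "isom_flow h \<Longrightarrow> (\<lambda>t. h (A * t) (v::'a::banach)) integrable_on {0..1}"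
  by (intro integrable_continuous_real avg_cont)

lemma avg_diff: assumes "isom_flow h" shows "avg h A u - avg h A v = avg (\<lambda>t. linear_part (h t)) A (u - v)"
  unfolding avg_def
  by (subst Henstock_Kurzweil_Integration.integral_diff[symmetric])
    (auto intro!: avg_integrable assms simp: nonexp_diff[OF isom_flowD(1)[OF assms]])

lemma avg_near:
  assumes "isom_flow h" "\<And>t. 0 \<le> t \<Longrightarrow> t \<le> 1 \<Longrightarrow> norm (h (A * t) v - w) \<le> e"
  shows "norm (avg h A v - w) \<le> e"
proof -
  have "avg h A v - w = integral {0..1} (\<lambda>t. h (A * t) v - w)"
    unfolding avg_def using avg_integrable[OF assms(1)]
    by (subst Henstock_Kurzweil_Integration.integral_diff) auto
  also have "norm \<dots> \<le> e"
    by (intro norm_integral_le continuous_intros avg_cont assms)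
  finally show ?thesis .
qed

text \<open>Turns almost commutation of flows, checked point by point along a segment, into almost
  commutation of averages.\<close>

lemma avg_near2:
  assumes "isom_flow h" "nonexp f" "nonexp g"
    "\<And>t. 0 \<le> t \<Longrightarrow> t \<le> 1 \<Longrightarrow> norm (f (h (A * t) v) - g (h (B * t) w)) \<le> e"
  shows "norm (f (avg h A v) - g (avg h B w)) \<le> e"
proof -
  have c: "continuous_on {0..1} (\<lambda>t. f (h (A * t) v))" "continuous_on {0..1} (\<lambda>t. g (h (B * t) w))"
    by (rule continuous_on_compose2[OF nonexp_cont[OF assms(2)] avg_cont[OF assms(1)] subset_UNIV],
        rule continuous_on_compose2[OF nonexp_cont[OF assms(3)] avg_cont[OF assms(1)] subset_UNIV])
  have "f (avg h A v) - g (avg h B w)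
      = integral {0..1} (\<lambda>t. f (h (A * t) v) - g (h (B * t) w))"
    unfolding avg_def nonexp_integral[OF assms(2) avg_cont[OF assms(1)]]
      nonexp_integral[OF assms(3) avg_cont[OF assms(1)]]
    by (rule Henstock_Kurzweil_Integration.integral_diff[symmetric])
      (intro integrable_continuous_real c)+
  also have "norm \<dots> \<le> e"
    by (intro norm_integral_le continuous_intros c assms)
  finally show ?thesis .
qed

lemma nonexp_avg: assumes "isom_flow h" shows "nonexp (avg h A)"
proof -
  let ?k = "\<lambda>t. linear_part (h t)"
  have k: "isom_flow ?k" by (rule isom_flow_linear_part[OF assms])
  have l: "linear (avg ?k A)"
  proof (rule linearI)
    show "avg ?k A (u + v) = avg ?k A u + avg ?k A v" for u v
      unfolding avg_def linear_add[OF linear_part_linear[OF isom_flowD(1)[OF assms]]]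
      by (intro Henstock_Kurzweil_Integration.integral_add avg_integrable[OF k])
    show "avg ?k A (r *\<^sub>R v) = r *\<^sub>R avg ?k A v" for r v
      unfolding avg_def linear_scale[OF linear_part_linear[OF isom_flowD(1)[OF assms]]] by simp
  qed
  have "norm (avg ?k A v) \<le> norm v" for v
    using avg_near[OF k, of A v 0 "norm v"] by (simp add: linear_part_norm isom_flowD[OF assms])
  with l show ?thesis
    unfolding nonexp_def avg_diff[OF assms] by simp
qed

lemma avg_commute:
  assumes "isom_flow h" "nonexp f" "\<And>t v. f (h t v) = h t (f v)"
  shows "f (avg h A v) = avg h A (f v)"
  unfolding avg_def nonexp_integral[OF assms(2) avg_cont[OF assms(1)]] assms(3) ..

lemma commuting_avg:
  assumes "isom_flow g" "isom_flow h" "commuting g h"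
  shows "g s (avg h A v) = avg h A (g s v)" "h s (avg g A v) = avg g A (h s v)"
    "avg g A (avg h B v) = avg h B (avg g A v)"
proof -
  show "g s (avg h A v) = avg h A (g s v)" for s A v
    using assms by (intro avg_commute) (auto simp: commuting_def isom_flowD)
  show *: "h s (avg g A v) = avg g A (h s v)" for s A v
    using assms by (intro avg_commute) (auto simp: commuting_def isom_flowD)
  show "avg g A (avg h B v) = avg h B (avg g A v)"
    using assms * by (intro avg_commute) (auto simp: nonexp_avg)
qed

lemma commuting_refl: "isom_flow h \<Longrightarrow> commuting h h"
  unfolding commuting_def by (metis add.commute isom_flowD(3))

text \<open>Shifting a segment of length \<open>A\<close> only exchanges short pieces at its two
  ends. As a function of the shift \<open>r\<close> the average has velocity
  \<open>(1/A) *\<^sub>R (h (A + r) v - h r v)\<close>, whose norm does not depend on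
  \<open>r\<close>. Every gain of the form "short over long" below comes from here.\<close>

lemma avg_shift:
  assumes h: "isom_flow h" and A: "A \<noteq> 0"
  shows "norm (avg h A (h s v) - avg h A v) \<le> \<bar>s\<bar> / \<bar>A\<bar> * norm (h A v - v)"
proof -
  \<comment> \<open>The margin 1 keeps all points that occur in the interior of the interval, where
    the antiderivative has a two-sided derivative.\<close>
  define M where "M = \<bar>A\<bar> + \<bar>s\<bar> + 1"
  have "continuous_on {-M..M} (\<lambda>t. h t v)" using h by (rule isom_flowD)
  then obtain P where P: "\<And>x. x \<in> {-M..M} \<Longrightarrow> (P has_vector_derivative h x v) (at x within {-M..M})"
    using antiderivative_continuous by blast
  have P': "(P has_vector_derivative h x v) (at x)" if "\<bar>x\<bar> < M" for x
  proof -
    have "x \<in> interior {-M..M}" using that by auto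
    then have "at x within {-M..M} = at x" by (rule at_within_interior)
    moreover have "x \<in> {-M..M}" using that by auto
    ultimately show ?thesis using P[of x] by metis
  qed
  define G where "G r = (1/A) *\<^sub>R (P (A + r) - P r)" for r
  have G: "G r = avg h A (h r v)" if r: "\<bar>r\<bar> \<le> \<bar>s\<bar>" for r
  proof -
    have "((\<lambda>t. h (A * t + r) v) has_integral ((1/A) *\<^sub>R P (A * 1 + r) - (1/A) *\<^sub>R P (A * 0 + r))) {0..1}"
    proof (rule fundamental_theorem_of_calculus)
      fix t :: real assume t: "t \<in> {0..1}"
      then have "\<bar>A * t\<bar> \<le> \<bar>A\<bar>"
        by (simp add: abs_mult mult_left_le)
      with r have "\<bar>A * t + r\<bar> < M" unfolding M_def by linarith
      note d = P'[OF this]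
      have "((\<lambda>t. A * t + r) has_vector_derivative A) (at t within {0..1})"
        by (auto intro!: derivative_eq_intros simp: has_real_derivative_iff_has_vector_derivative[symmetric])
      from vector_diff_chain_within[OF this has_vector_derivative_at_within[OF d]]
      have "((\<lambda>t. P (A * t + r)) has_vector_derivative A *\<^sub>R h (A * t + r) v) (at t within {0..1})"
        by (simp add: o_def)
      from bounded_linear.has_vector_derivative[OF bounded_linear_scaleR_right this, of "1/A"]
      show "((\<lambda>t. (1/A) *\<^sub>R P (A * t + r)) has_vector_derivative h (A * t + r) v) (at t within {0..1})"
        using A by simp
    qed simp
    then have "integral {0..1} (\<lambda>t. h (A * t + r) v) = G r"
      by (simp add: G_def scaleR_diff_right integral_unique)
    then show ?thesis
      by (simp add: avg_def isom_flowD(3)[OF h])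
  qed
  have "norm (G s - G 0) \<le> norm (h A v - v) / \<bar>A\<bar> * norm (s - 0)"
  proof (rule differentiable_bound[where S = "{-\<bar>s\<bar>..\<bar>s\<bar>}" and f' = "\<lambda>r z. z *\<^sub>R ((1/A) *\<^sub>R (h (A + r) v - h r v))"])
    fix r :: real assume "r \<in> {-\<bar>s\<bar>..\<bar>s\<bar>}"
    then have r: "\<bar>r\<bar> < M" "\<bar>A + r\<bar> < M" unfolding M_def by auto
    have 1: "((\<lambda>r. P (A + r)) has_vector_derivative h (A + r) v) (at r within {-\<bar>s\<bar>..\<bar>s\<bar>})"
    proof -
      have "((\<lambda>r. A + r) has_vector_derivative 1) (at r within {-\<bar>s\<bar>..\<bar>s\<bar>})"
        by (auto intro!: derivative_eq_intros simp: has_real_derivative_iff_has_vector_derivative[symmetric])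
      from vector_diff_chain_within[OF this has_vector_derivative_at_within[OF P'[OF r(2)]]]
      show ?thesis by (simp add: o_def)
    qed
    have "(G has_vector_derivative (1/A) *\<^sub>R (h (A + r) v - h r v)) (at r within {-\<bar>s\<bar>..\<bar>s\<bar>})"
      unfolding G_def
      by (intro bounded_linear.has_vector_derivative[OF bounded_linear_scaleR_right]
          has_vector_derivative_diff 1 has_vector_derivative_at_within[OF P'[OF r(1)]])
    then show "(G has_derivative (\<lambda>z. z *\<^sub>R ((1/A) *\<^sub>R (h (A + r) v - h r v)))) (at r within {-\<bar>s\<bar>..\<bar>s\<bar>})"
      by (simp add: has_vector_derivative_def)
    have "norm (h (A + r) v - h r v) = norm (h A v - v)"
      using isom_flow_disp_diff[OF h] by simp
    then show "onorm (\<lambda>z. z *\<^sub>R ((1/A) *\<^sub>R (h (A + r) v - h r v))) \<le> norm (h A v - v) / \<bar>A\<bar>"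
      by (intro onorm_le) (simp add: divide_simps)
  qed auto
  then show ?thesis
    using G[of s] G[of 0] by (simp add: isom_flowD(2)[OF h] mult.commute)
qed

lemma avg_shift_left:
  assumes "isom_flow h" "A \<noteq> 0"
  shows "norm (h s (avg h A v) - avg h A v) \<le> \<bar>s\<bar> / \<bar>A\<bar> * norm (h A v - v)"
  using avg_shift[OF assms] commuting_avg(1)[OF assms(1,1) commuting_refl] assms by metis

section \<open>Uniform convexity and the Heisenberg relation\<close>

text \<open>Passes from unit vectors to a ball: if the midpoint is almost as long as possible, both
  vectors are, and normalising them changes little.\<close>

lemma uniformly_convex_ball:
  assumes uc: "uniformly_convex TYPE('a::real_normed_vector)" and e: "\<epsilon> > 0"
  obtains r where "1/2 \<le> r" "r < 1"
    "\<And>(u::'a) v n. norm u \<le> n \<Longrightarrow> norm v \<le> n \<Longrightarrow> r * n \<le> norm ((1/2) *\<^sub>R (u + v)) \<Longrightarrow> norm (u - v) \<le> \<epsilon> * n"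
proof -
  define \<epsilon>' where "\<epsilon>' = min (\<epsilon>/2) 2"
  have "0 < \<epsilon>'" "\<epsilon>' \<le> 2" using e by (auto simp: \<epsilon>'_def)
  then have "\<exists>\<delta>>0. \<forall>\<xi> \<eta>::'a. norm \<xi> = 1 \<and> norm \<eta> = 1 \<and> norm (\<xi> - \<eta>) \<ge> \<epsilon>'
      \<longrightarrow> norm ((1/2) *\<^sub>R (\<xi> + \<eta>)) \<le> 1 - \<delta>"
    using uc unfolding uniformly_convex_def by simp
  then obtain \<delta> where \<delta>: "\<delta> > 0" and uc': "\<And>\<xi> \<eta>::'a. norm \<xi> = 1 \<Longrightarrow> norm \<eta> = 1 \<Longrightarrow> norm (\<xi> - \<eta>) \<ge> \<epsilon>'
      \<Longrightarrow> norm ((1/2) *\<^sub>R (\<xi> + \<eta>)) \<le> 1 - \<delta>"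
    by blast
  \<comment> \<open>Normalising moves each vector by at most 2t. The bound \<delta>/6 gives 3t <
    \<delta>, which contradicts the midpoint estimate; \<epsilon>/8 leaves room for two such errors
    next to \<epsilon>/2; 1/4 keeps both norms at least 1/2.\<close>
  define t where "t = min (min (\<delta>/6) (\<epsilon>/8)) (1/4)"
  have t: "0 < t" "t \<le> \<delta>/6" "t \<le> \<epsilon>/8" "t \<le> 1/4" using \<delta> e by (auto simp: t_def)
  have unit: "norm (u - v) \<le> \<epsilon>" if u: "norm u \<le> 1" and v: "norm v \<le> 1"
    and m: "1 - t \<le> norm ((1/2) *\<^sub>R (u + v))" for u v :: 'a
  proof -
    have "norm ((1/2) *\<^sub>R (u + v)) \<le> (norm u + norm v) / 2"
      using norm_triangle_ineq[of u v] by simp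
    moreover have "1 - 2*t \<le> a \<and> 1 - 2*t \<le> b" if "N \<le> (a + b) / 2" "a \<le> 1" "b \<le> 1" "1 - t \<le> N"
      for N a b :: real using that by argo
    ultimately have nu: "norm u \<ge> 1 - 2*t" "norm v \<ge> 1 - 2*t" using u v m by blast+
    then have nz: "norm u > 0" "norm v > 0" using t by - linarith+
    define u' v' where "u' = u /\<^sub>R norm u" and "v' = v /\<^sub>R norm v"
    have "u - u' = (1 - 1 / norm u) *\<^sub>R u" "v - v' = (1 - 1 / norm v) *\<^sub>R v"
      by (simp_all add: u'_def v'_def scaleR_diff_left divide_inverse)
    then have "norm (u - u') = \<bar>1 - 1 / norm u\<bar> * norm u" "norm (v - v') = \<bar>1 - 1 / norm v\<bar> * norm v"
      by simp_all
    then have "norm (u - u') = \<bar>norm u - 1\<bar>" "norm (v - v') = \<bar>norm v - 1\<bar>"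
      using nz by (simp_all add: abs_if divide_simps split: if_splits)
    then have d: "norm (u - u') \<le> 2*t" "norm (v - v') \<le> 2*t" using nu u v by - linarith+
    have one: "norm u' = 1" "norm v' = 1" using nz by (simp_all add: u'_def v'_def)
    have "norm (u' - v') < \<epsilon>'"
    proof (rule ccontr)
      assume "\<not> norm (u' - v') < \<epsilon>'"
      then have "norm ((1/2) *\<^sub>R (u' + v')) \<le> 1 - \<delta>" using uc' one by auto
      moreover have "norm ((1/2) *\<^sub>R (u + v) - (1/2) *\<^sub>R (u' + v')) \<le> 2*t"
      proof -
        have "(1/2) *\<^sub>R (u + v) - (1/2) *\<^sub>R (u' + v') = (1/2) *\<^sub>R ((u - u') + (v - v'))"
          by (simp add: algebra_simps)
        then show ?thesis using norm_triangle_ineq[of "u-u'" "v-v'"] d by simp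
      qed
      moreover have "1 - t \<le> 1 - \<delta> + 2*t" if "1 - t \<le> a" "b \<le> 1 - \<delta>" "a - b \<le> c" "c \<le> 2*t"
        for a b c :: real using that by linarith
      ultimately have "1 - t \<le> 1 - \<delta> + 2*t"
        using m norm_triangle_ineq2[of "(1/2) *\<^sub>R (u + v)" "(1/2) *\<^sub>R (u' + v')"] by blast
      then show False using t \<delta> by linarith
    qed
    then have "norm (u' - v') < \<epsilon>/2" by (simp add: \<epsilon>'_def)
    moreover have "u - v = (u - u') + (u' - v') - (v - v')" by simp
    ultimately show ?thesis
      using d t norm_triangle_ineq4[of "(u - u') + (u' - v')" "v - v'"] norm_triangle_ineq[of "u - u'" "u' - v'"]
      by simp
  qed
  show thesis
  proof (rule that[of "1 - t"])
    fix u v :: 'a and n :: real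
    assume u: "norm u \<le> n" and v: "norm v \<le> n" and m: "(1 - t) * n \<le> norm ((1/2) *\<^sub>R (u + v))"
    show "norm (u - v) \<le> \<epsilon> * n"
    proof (cases "n > 0")
      case True
      have "norm ((1/n) *\<^sub>R u - (1/n) *\<^sub>R v) \<le> \<epsilon>"
      proof (rule unit)
        have "(1/2) *\<^sub>R ((1/n) *\<^sub>R u + (1/n) *\<^sub>R v) = (1/n) *\<^sub>R ((1/2) *\<^sub>R (u + v))"
          by (simp add: algebra_simps)
        then have *: "norm ((1/2) *\<^sub>R ((1/n) *\<^sub>R u + (1/n) *\<^sub>R v)) = norm ((1/2) *\<^sub>R (u + v)) / n"
          using True by (simp only: norm_scaleR) simp
        then show "1 - t \<le> norm ((1/2) *\<^sub>R ((1/n) *\<^sub>R u + (1/n) *\<^sub>R v))"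
          using m True unfolding * by (simp only: pos_le_divide_eq)
      qed (use u v True in \<open>auto simp: divide_simps\<close>)
      moreover have "norm ((1/n) *\<^sub>R u - (1/n) *\<^sub>R v) = norm (u - v) / n"
        using True by (simp flip: scaleR_diff_right add: divide_simps)
      ultimately show ?thesis using True by (simp add: divide_simps)
    next
      case False
      then have "norm u = 0" "norm v = 0" "n = 0"
        using u v norm_ge_zero[of u] norm_ge_zero[of v] by - linarith+
      then show ?thesis by simp
    qed
  qed (use t in auto)
qed

text \<open>With \<open>d = (\<lambda>t v. v)\<close> these are the relations of the Heisenberg group; the general case
  describes a short simple root \<open>x\<close> and a long simple root \<open>y\<close> of type \<open>C\<^sub>2\<close>.\<close>

locale heis =
  fixes x y c d :: "real \<Rightarrow> 'a::banach \<Rightarrow> 'a" and q :: real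
  assumes isom_flow: "isom_flow x" "isom_flow y" "isom_flow c" "isom_flow d"
    and q: "\<bar>q\<bar> \<le> 1"
    and xy: "x a (y b v) = y b (x a (c (a * b) (d (q * a\<^sup>2 * b) v)))"
    and xc: "x a (c e v) = c e (x a (d (a * e) v))"
    and comm: "commuting y c" "commuting y d" "commuting c d" "commuting x d"

locale lheis = heis +
  assumes zero: "x t 0 = 0" "y t 0 = 0" "c t 0 = 0" "d t 0 = 0"

lemma commuting_linear_part:
  assumes "isom_flow g" "isom_flow h" "commuting g h"
  shows "commuting (\<lambda>t. linear_part (g t)) (\<lambda>t. linear_part (h t))"
proof -
  have "linear_part (g s) (linear_part (h t) v) = linear_part (\<lambda>v. g s (h t v)) v" for s t v
    using linear_part_compose[OF isom_flowD(1)[OF assms(1)] isom_flowD(1)[OF assms(2)]] by simp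
  moreover have "linear_part (h t) (linear_part (g s) v) = linear_part (\<lambda>v. h t (g s v)) v" for s t v
    using linear_part_compose[OF isom_flowD(1)[OF assms(2)] isom_flowD(1)[OF assms(1)]] by simp
  ultimately show ?thesis
    using assms(3) by (simp add: commuting_def)
qed

text \<open>The relations are identities between affine maps, hence hold for the linear parts.
  Differences of averages are then governed by linear isometric flows, to which the convexity
  estimates apply.\<close>

lemma (in heis) lheis_linear_part:
  "lheis (\<lambda>t. linear_part (x t)) (\<lambda>t. linear_part (y t)) (\<lambda>t. linear_part (c t)) (\<lambda>t. linear_part (d t)) q"
proof unfold_locales
  note n = isom_flowD(1)[OF isom_flow(1)] isom_flowD(1)[OF isom_flow(2)] isom_flowD(1)[OF isom_flow(3)] isom_flowD(1)[OF isom_flow(4)]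
  note L = n[THEN nonexp_diff, symmetric]
  fix a b e v
  show "linear_part (x a) (linear_part (y b) v) = linear_part (y b) (linear_part (x a) (linear_part (c (a * b)) (linear_part (d (q * a\<^sup>2 * b)) v)))"
    unfolding linear_part_def[of "y b" v] linear_part_def[of "d (q * a\<^sup>2 * b)" v] L xy ..
  show "linear_part (x a) (linear_part (c e) v) = linear_part (c e) (linear_part (x a) (linear_part (d (a * e)) v))"
    unfolding linear_part_def[of "c e" v] linear_part_def[of "d (a * e)" v] L xc ..
qed (use isom_flow q comm in \<open>auto simp: isom_flow_linear_part commuting_linear_part linear_part_0\<close>)

definition half_sum :: "(real \<Rightarrow> 'a::real_normed_vector \<Rightarrow> 'a) \<Rightarrow> real \<Rightarrow> 'a \<Rightarrow> 'a" where
  "half_sum h a v = (1/2) *\<^sub>R (v + h a v)"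

definition half_diff :: "(real \<Rightarrow> 'a::real_normed_vector \<Rightarrow> 'a) \<Rightarrow> real \<Rightarrow> 'a \<Rightarrow> 'a" where
  "half_diff h a v = (1/2) *\<^sub>R (v - h a v)"

lemma isom_flow_linear: "isom_flow h \<Longrightarrow> h t 0 = 0 \<Longrightarrow> linear (h t)"
  using nonexp_linear_iff isom_flowD(1) by blast

lemma isom_flow_norm: "isom_flow h \<Longrightarrow> h t 0 = 0 \<Longrightarrow> norm (h t v) = norm v"
  using isom_flow_isom[of h t v 0] by simp

lemma nonexp_half_sum: assumes "isom_flow h" "h a 0 = 0" shows "nonexp (half_sum h a)" "nonexp (half_diff h a)"
proof -
  have l: "linear (h a)" using isom_flow_linear assms by blast
  have b: "norm (half_sum h a v) \<le> norm v" "norm (half_diff h a v) \<le> norm v" for v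
    unfolding half_sum_def half_diff_def
    using norm_triangle_ineq[of v "h a v"] norm_triangle_ineq4[of v "h a v"] isom_flow_norm[OF assms, of v] by simp_all
  have "linear (half_sum h a)" "linear (half_diff h a)"
    unfolding half_sum_def half_diff_def
    by (simp_all add: linear_iff linear_add[OF l] linear_scale[OF l] algebra_simps)
  with b show "nonexp (half_sum h a)" "nonexp (half_diff h a)"
    by (subst nonexp_linear_iff; simp add: half_sum_def half_diff_def assms)+
qed

text \<open>If the left hand side were almost as long as \<open>n\<close>, then \<open>v\<close> would be almost
  invariant under \<open>x a\<close> and \<open>y b\<close>, hence under their commutator \<open>c (a * b)\<close>, although
  \<open>c (a * b)\<close> almost negates it.\<close>

lemma commutator_gain:
  assumes uc: "uniformly_convex TYPE('a::banach)"
  obtains r where "1/2 \<le> r" "r < 1"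
    "\<And>x y c d q a b (v::'a) n. lheis x y c d q \<Longrightarrow> norm v \<le> n \<Longrightarrow>
      norm (d (q * a\<^sup>2 * b) v - v) \<le> n / 20 \<Longrightarrow>
      norm (half_sum x a (half_sum y b (half_diff c (a * b) v))) \<le> r * n"
proof -
  obtain r where r: "1/2 \<le> r" "r < 1"
    "\<And>(u::'a) v n. norm u \<le> n \<Longrightarrow> norm v \<le> n \<Longrightarrow> r * n \<le> norm ((1/2) *\<^sub>R (u + v)) \<Longrightarrow> norm (u - v) \<le> (1/20) * n"
    using uniformly_convex_ball[OF uc, of "1/20"] by (metis zero_less_divide_1_iff zero_less_numeral)
  show thesis
  proof (rule that[OF r(1,2)])
    fix x y c d :: "real \<Rightarrow> 'a \<Rightarrow> 'a" and q a b and v :: 'a and n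
    assume "lheis x y c d q" and v: "norm v \<le> n" and dv: "norm (d (q * a\<^sup>2 * b) v - v) \<le> n / 20"
    then interpret lheis x y c d q by simp
    note no = isom_flow_norm[OF isom_flow(1) zero(1)] isom_flow_norm[OF isom_flow(2) zero(2)] isom_flow_norm[OF isom_flow(3) zero(3)] isom_flow_norm[OF isom_flow(4) zero(4)]
    note iso = isom_flow_isom[OF isom_flow(1)] isom_flow_isom[OF isom_flow(2)] isom_flow_isom[OF isom_flow(3)] isom_flow_isom[OF isom_flow(4)]
    note nonexp = nonexp_half_sum[OF isom_flow(1) zero(1)] nonexp_half_sum[OF isom_flow(2) zero(2)] nonexp_half_sum[OF isom_flow(3) zero(3)]
    let ?C = "c (a * b)"
    define \<eta> where "\<eta> = half_diff c (a * b) v"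
    define \<zeta> where "\<zeta> = half_sum y b \<eta>"
    have n0: "0 \<le> n" using v norm_ge_zero[of v] by linarith
    have nn: "norm \<eta> \<le> n" "norm \<zeta> \<le> norm \<eta>" "norm (half_sum x a \<zeta>) \<le> norm \<zeta>"
      using nonexp_norm[OF nonexp(6), of "a*b" v 0] v nonexp_norm[OF nonexp(3), of b \<eta> 0] nonexp_norm[OF nonexp(1), of a \<zeta> 0]
      by (auto simp: \<eta>_def \<zeta>_def half_sum_def half_diff_def zero)
    show "norm (half_sum x a (half_sum y b (half_diff c (a * b) v))) \<le> r * n"
    proof (rule ccontr)
      assume "\<not> ?thesis"
      then have big: "r * n < norm (half_sum x a \<zeta>)" by (simp add: \<zeta>_def \<eta>_def)
      have 1: "norm (v - - ?C v) \<le> (1/20) * n"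
        using v big nn by (intro r(3)) (auto simp: no \<eta>_def half_diff_def)
      have 2: "norm (\<eta> - y b \<eta>) \<le> (1/20) * n"
        using big nn by (intro r(3)) (auto simp: no \<zeta>_def half_sum_def)
      have 3: "norm (\<zeta> - x a \<zeta>) \<le> (1/20) * n"
        using big nn by (intro r(3)) (auto simp: no half_sum_def)
      have ev: "norm (\<eta> - v) \<le> n/40"
      proof -
        have "\<eta> - v = - ((1/2) *\<^sub>R (v - - ?C v))" by (simp add: \<eta>_def half_diff_def algebra_simps flip: scaleR_add_left)
        then show ?thesis using 1 by simp
      qed
      have ze: "norm (\<zeta> - \<eta>) \<le> n/40"
      proof -
        have "\<zeta> - \<eta> = - ((1/2) *\<^sub>R (\<eta> - y b \<eta>))" by (simp add: \<zeta>_def half_sum_def algebra_simps flip: scaleR_add_left)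
        then show ?thesis using 2 by simp
      qed
      have yv: "norm (y b v - v) \<le> n/10"
      proof -
        have "y b v - v = (y b v - y b \<eta>) + (y b \<eta> - \<eta>) + (\<eta> - v)" by simp
        also have "norm \<dots> \<le> n/40 + n/20 + n/40"
          using ev 2 iso(2)[of b v \<eta>] by (intro norm_triangle_le add_mono) (auto simp: norm_minus_commute)
        finally show ?thesis by simp
      qed
      have zv: "norm (\<zeta> - v) \<le> n/20"
        using norm_triangle_ineq[of "\<zeta> - \<eta>" "\<eta> - v"] ev ze by simp
      have xv: "norm (x a v - v) \<le> 3*n/20"
      proof -
        have "x a v - v = (x a v - x a \<zeta>) + (x a \<zeta> - \<zeta>) + (\<zeta> - v)" by simp
        also have "norm \<dots> \<le> n/20 + n/20 + n/20"
          using zv 3 iso(1)[of a v \<zeta>] by (intro norm_triangle_le add_mono) (auto simp: norm_minus_commute)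
        finally show ?thesis by simp
      qed
      have xyv: "norm (x a (y b v) - v) \<le> 5*n/20"
        using norm_triangle_ineq[of "x a (y b v) - x a v" "x a v - v"] iso(1)[of a "y b v" v] xv yv by simp
      have yxv: "norm (y b (x a v) - v) \<le> 5*n/20"
        using norm_triangle_ineq[of "y b (x a v) - y b v" "y b v - v"] iso(2)[of b "x a v" v] xv yv by simp
      have neg: "y b (x a (- v)) = - y b (x a v)"
        using isom_flow_linear[OF isom_flow(1) zero(1)] isom_flow_linear[OF isom_flow(2) zero(2)] by (simp add: linear_neg)
      have 4: "norm (x a (y b v) - y b (x a (?C v))) \<le> n/20"
        using dv by (simp add: xy iso)
      have 5: "norm (y b (x a (?C v)) + y b (x a v)) \<le> n/20"
      proof -
        have "norm (y b (x a (?C v)) - y b (x a (- v))) = norm (v - - ?C v)"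
          by (simp add: iso add.commute)
        then show ?thesis using 1 by (simp add: neg)
      qed
      \<comment> \<open>If \<open>c (a * b)\<close> were exactly -1 on \<open>v\<close> and
        \<open>x a\<close>, \<open>y b\<close> fixed it, this would read 2v = 0. The errors sum to
        12n/20, while \<open>norm v\<close> exceeds n/2 - n/40; the constant 1/20 is small enough
        for this contradiction.\<close>
      have "v + v = (v - x a (y b v)) + (x a (y b v) - y b (x a (?C v))) + (y b (x a (?C v)) + y b (x a v)) + (v - y b (x a v))"
        by simp
      also have "norm \<dots> \<le> 5*n/20 + n/20 + n/20 + 5*n/20"
        using xyv yxv by (intro norm_add_rule_thm 4 5) (simp_all only: norm_minus_commute)
      finally have "2 * norm v \<le> 12*n/20"
        by (simp flip: scaleR_2)
      moreover have "r * n < norm v + n/40"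
        using big nn norm_triangle_ineq2[of \<eta> v] ev by linarith
      moreover have "n/2 \<le> r * n" using mult_right_mono[OF r(1) n0] by simp
      ultimately have "n < 0" by linarith
      then show False using n0 by simp
    qed
  qed
qed

section \<open>Products of commutator gains over many scales\<close>

fun chain :: "(nat \<Rightarrow> 'a \<Rightarrow> 'a) \<Rightarrow> nat \<Rightarrow> 'a \<Rightarrow> 'a" where
  "chain f 0 v = v"
| "chain f (Suc n) v = chain f n (f n v)"

lemma nonexp_chain: "(\<And>i. nonexp (f i)) \<Longrightarrow> nonexp (chain f n)"
proof (induction n)
  case 0 then show ?case using nonexp_id by simp
next
  case (Suc n)
  then show ?case using nonexp_compose[of "chain f n" "f n"] by simp
qed

lemma chain_commute: "(\<And>i v. g (f i v) = f i (g v)) \<Longrightarrow> g (chain f n v) = chain f n (g v)"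
  by (induction n arbitrary: v) simp_all

lemma nonexp_funpow: "nonexp f \<Longrightarrow> nonexp (f ^^ n)"
proof (induction n)
  case 0 then show ?case using nonexp_id by (simp add: id_def)
next
  case (Suc n)
  then show ?case using nonexp_compose[of f "f ^^ n"] by (simp add: o_def)
qed

lemma funpow_commute: "(\<And>v. g (f v) = f (g v)) \<Longrightarrow> g ((f ^^ n) v) = (f ^^ n) (g v)"
  by (induction n arbitrary: v) simp_all

lemma le_half: "0 \<le> e \<Longrightarrow> a \<le> e / 2 \<Longrightarrow> a \<le> (e::real)"
  by simp

lemma norm_chain3: "norm (a - b) \<le> s \<Longrightarrow> norm (b - c) \<le> t \<Longrightarrow> norm (a - c) \<le> s + (t::real)"
  using norm_triangle_ineq[of "a - b" "b - c"] by simp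

lemma half_sum_near:
  assumes "linear f" "norm (f (h a u) - h a (f u)) \<le> e"
  shows "norm (f (half_sum h a u) - half_sum h a (f u)) \<le> e / 2"
proof -
  have "f (half_sum h a u) - half_sum h a (f u) = (1/2) *\<^sub>R (f (h a u) - h a (f u))"
    by (simp add: half_sum_def linear_scale[OF assms(1)] linear_add[OF assms(1)] algebra_simps)
  then show ?thesis using assms(2) by simp
qed

lemma half_diff_near:
  assumes "linear f" "norm (f (h a u) - h a (f u)) \<le> e"
  shows "norm (f (half_diff h a u) - half_diff h a (f u)) \<le> e / 2"
proof -
  have "f (half_diff h a u) - half_diff h a (f u) = - ((1/2) *\<^sub>R (f (h a u) - h a (f u)))"
    by (simp add: half_diff_def linear_scale[OF assms(1)] linear_diff[OF assms(1)] algebra_simps)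
  then show ?thesis using assms(2) by simp
qed

lemma half_sum_commute:
  assumes "linear f" "\<And>v. f (h a v) = h a (f v)"
  shows "f (half_sum h a v) = half_sum h a (f v)" "f (half_diff h a v) = half_diff h a (f v)"
  by (simp_all add: half_sum_def half_diff_def linear_scale[OF assms(1)] linear_diff[OF assms(1)] linear_add[OF assms(1)] assms(2))

text \<open>\<open>n\<close> bounds the norm instead of being the norm, so that the property
  survives nonexpansive maps commuting with \<open>h\<close>. The factor 2 is the trivial bound on
  \<open>norm (h \<rho> v - v)\<close>, so that averages over length \<rho> qualify.\<close>

definition smooth :: "(real \<Rightarrow> 'a::real_normed_vector \<Rightarrow> 'a) \<Rightarrow> real \<Rightarrow> real \<Rightarrow> 'a \<Rightarrow> bool" where
  "smooth h \<rho> n v \<longleftrightarrow> norm v \<le> n \<and> (\<forall>t. norm (h t v - v) \<le> 2 * \<bar>t\<bar> / \<rho> * n)"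

lemma smooth_avg:
  assumes "isom_flow h" "\<And>t. h t 0 = 0" "\<rho> > 0" "norm v \<le> n" 
  shows "smooth h \<rho> n (avg h \<rho> v)"
  unfolding smooth_def
proof (intro conjI allI)
  show "norm (avg h \<rho> v) \<le> n"
    using avg_near[OF assms(1), of \<rho> v 0 n] isom_flow_norm[OF assms(1,2)] assms(4) by simp
  fix t
  have "norm (h \<rho> v - v) \<le> 2 * n"
    using norm_triangle_ineq4[of "h \<rho> v" v] isom_flow_norm[OF assms(1,2)] assms(4) by simp
  then have "\<bar>t\<bar> / \<bar>\<rho>\<bar> * norm (h \<rho> v - v) \<le> \<bar>t\<bar> / \<bar>\<rho>\<bar> * (2 * n)"
    by (intro mult_left_mono) auto
  then show "norm (h t (avg h \<rho> v) - avg h \<rho> v) \<le> 2 * \<bar>t\<bar> / \<rho> * n"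
    using order_trans[OF avg_shift_left[OF assms(1), of \<rho> t v]] assms(3) by (simp add: mult_ac)
qed

lemma smooth_map:
  assumes "smooth h \<rho> n v" "\<rho> > 0" "nonexp f" "f 0 = 0" "\<And>t v. f (h t v) = h t (f v)"
  shows "smooth h \<rho> n (f v)"
  unfolding smooth_def
proof (intro conjI allI)
  show "norm (f v) \<le> n"
    using assms(1) nonexp_norm[OF assms(3), of v 0] by (simp add: smooth_def assms(4))
  show "norm (h t (f v) - f v) \<le> 2 * \<bar>t\<bar> / \<rho> * n" for t
    using order_trans[OF nonexp_norm[OF assms(3), of "h t v" v]] assms(1) by (simp add: smooth_def assms(5))
qed

context lheis
begin

lemma nonexp: "nonexp (x t)" "nonexp (y t)" "nonexp (c t)" "nonexp (d t)"
  using isom_flowD(1) isom_flow by auto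

lemma linear: "linear (x t)" "linear (y t)" "linear (c t)" "linear (d t)"
  by (auto intro: isom_flow_linear isom_flow zero)

lemma isom: "norm (x t v) = norm v" "norm (y t v) = norm v" "norm (c t v) = norm v" "norm (d t v) = norm v"
  by (simp_all add: isom_flow_norm isom_flow zero)

lemma nonexp_avgs: "nonexp (avg x A)" "nonexp (avg y A)" "nonexp (avg c A)" "nonexp (avg d A)"
  using nonexp_avg isom_flow by auto

lemma avgs_0: "avg x A 0 = 0" "avg y A 0 = 0" "avg c A 0 = 0" "avg d A 0 = 0"
  by (simp_all add: avg_def zero)

lemma cm: "x s (d t v) = d t (x s v)" "y s (c t v) = c t (y s v)" "y s (d t v) = d t (y s v)" "c s (d t v) = d t (c s v)"
  using comm by (auto simp: commuting_def)

text \<open>The commutator of \<open>x a\<close> and \<open>y b\<close> consists of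
  \<open>c (a * b)\<close> and \<open>d (q * a\<^sup>2 * b)\<close>, and these barely move a vector
  that is smooth for \<open>c\<close> and \<open>d\<close>.\<close>

lemma xy_near:
  assumes "smooth c \<rho> n u" "smooth d R n u" "\<rho> > 0" "R > 0"
  shows "norm (x a (y b u) - y b (x a u)) \<le> (2 * \<bar>a * b\<bar> / \<rho> + 2 * (a\<^sup>2 * \<bar>b\<bar>) / R) * n"
proof -
  let ?d = "d (q * a\<^sup>2 * b) u"
  have n: "n \<ge> 0" using assms(1) norm_ge_zero order_trans unfolding smooth_def by blast
  have "norm (x a (y b u) - y b (x a u)) = norm (c (a * b) ?d - u)"
    unfolding xy using isom_flow_isom[OF isom_flow(1)] isom_flow_isom[OF isom_flow(2)] by simp
  also have "\<dots> \<le> norm (c (a * b) ?d - c (a * b) u) + norm (c (a * b) u - u)"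
    by (metis norm_triangle_ineq diff_add_cancel add_diff_eq)
  also have "\<dots> \<le> 2 * \<bar>q * a\<^sup>2 * b\<bar> / R * n + 2 * \<bar>a * b\<bar> / \<rho> * n"
    using assms(1,2) isom_flow_isom[OF isom_flow(3)] unfolding smooth_def by (intro add_mono) auto
  also have "\<bar>q * a\<^sup>2 * b\<bar> \<le> a\<^sup>2 * \<bar>b\<bar>"
    using q by (simp add: abs_mult mult_left_le_one_le mult.assoc)
  then have "2 * \<bar>q * a\<^sup>2 * b\<bar> / R * n \<le> 2 * (a\<^sup>2 * \<bar>b\<bar>) / R * n"
    using n assms by (intro mult_right_mono divide_right_mono) auto
  finally show ?thesis by (simp add: algebra_simps)
qed

lemma xc_near:
  assumes "smooth d R n u" "R > 0"
  shows "norm (x a (c e u) - c e (x a u)) \<le> 2 * \<bar>a * e\<bar> / R * n"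
  using assms isom_flow_isom[OF isom_flow(1)] isom_flow_isom[OF isom_flow(3)] unfolding smooth_def xc by simp

text \<open>A low-pass filter in the directions \<open>c\<close> and \<open>d\<close>; it commutes
  with \<open>y\<close>, \<open>c\<close> and \<open>d\<close>, but with \<open>x\<close> only
  approximately.\<close>

definition S where "S \<rho> R v = avg c \<rho> (avg d R v)"

text \<open>One high-pass factor (1 - c m)/2, preceded by the filter \<open>S\<close> so that each
  block brings along the smoothness that its swaps require.\<close>

definition K where "K m \<rho> R v = half_diff c m (S \<rho> R v)"

lemma nonexp_S: "nonexp (S \<rho> R)" "S \<rho> R 0 = 0" "linear (S \<rho> R)"
proof -
  show 1: "nonexp (S \<rho> R)" unfolding S_def[abs_def] by (rule nonexp_compose[OF nonexp_avgs(3) nonexp_avgs(4)])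
  show 2: "S \<rho> R 0 = 0" by (simp add: S_def avgs_0)
  show "linear (S \<rho> R)" using nonexp_linear_iff[of "S \<rho> R"] 1 2 by simp
qed

lemma nonexp_K: "nonexp (K m \<rho> R)" "K m \<rho> R 0 = 0" "linear (K m \<rho> R)"
proof -
  show 1: "nonexp (K m \<rho> R)" unfolding K_def[abs_def] by (rule nonexp_compose[OF nonexp_half_sum(2)[OF isom_flow(3) zero(3)] nonexp_S(1)])
  show 2: "K m \<rho> R 0 = 0" by (simp add: K_def nonexp_S half_diff_def zero)
  show "linear (K m \<rho> R)" using nonexp_linear_iff[of "K m \<rho> R"] 1 2 by simp
qed

lemma S_commute: "S \<rho> R (y t v) = y t (S \<rho> R v)" "S \<rho> R (c t v) = c t (S \<rho> R v)" "S \<rho> R (d t v) = d t (S \<rho> R v)"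
  unfolding S_def
  by (simp_all only: commuting_avg(1)[OF isom_flow(2) isom_flow(3) comm(1)] commuting_avg(1)[OF isom_flow(2) isom_flow(4) comm(2)]
      commuting_avg(1)[OF isom_flow(3) isom_flow(4) comm(3)] commuting_avg(2)[OF isom_flow(3) isom_flow(4) comm(3)]
      commuting_avg(1)[OF isom_flow(3) isom_flow(3) commuting_refl[OF isom_flow(3)]] commuting_avg(1)[OF isom_flow(4) isom_flow(4) commuting_refl[OF isom_flow(4)]])

lemma K_commute: "K m \<rho> R (y t v) = y t (K m \<rho> R v)" "K m \<rho> R (d t v) = d t (K m \<rho> R v)" "K m \<rho> R (c t v) = c t (K m \<rho> R v)"
proof -
  have cc: "c s (c t v) = c t (c s v)" for s t v
    using commuting_refl[OF isom_flow(3)] by (simp add: commuting_def)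
  show "K m \<rho> R (y t v) = y t (K m \<rho> R v)"
    unfolding K_def S_commute by (rule half_sum_commute(2)[where f = "y t" and h = c, OF linear(2) cm(2), symmetric])
  show "K m \<rho> R (d t v) = d t (K m \<rho> R v)"
    unfolding K_def S_commute by (rule half_sum_commute(2)[where f = "d t" and h = c, OF linear(4) cm(4)[symmetric], symmetric])
  show "K m \<rho> R (c t v) = c t (K m \<rho> R v)"
    unfolding K_def S_commute by (rule half_sum_commute(2)[where f = "c t" and h = c, OF linear(3) cc, symmetric])
qed

lemma S_smooth:
  assumes "\<rho> > 0" "R > 0" "norm v \<le> n"
  shows "smooth c \<rho> n (S \<rho> R v)" "smooth d R n (S \<rho> R v)"
proof -
  have "norm (avg d R v) \<le> n"
    using nonexp_norm[OF nonexp_avgs(4), of R v 0] assms(3) by (simp add: avgs_0)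
  then show "smooth c \<rho> n (S \<rho> R v)"
    unfolding S_def using assms by (intro smooth_avg isom_flow zero)
  have "smooth d R n (avg d R v)"
    using assms by (intro smooth_avg isom_flow zero)
  then show "smooth d R n (S \<rho> R v)"
    unfolding S_def by (rule smooth_map) (use assms in \<open>auto simp: nonexp_avgs avgs_0 commuting_avg(2)[OF isom_flow(3) isom_flow(4) comm(3)]\<close>)
qed

text \<open>Commuting \<open>x a\<close> past the \<open>c\<close>-elements in \<open>K\<close>
  creates \<open>d\<close>-elements with parameters at most \<open>a * m\<close> and
  \<open>a * \<rho>\<close>, which hardly move a \<open>d\<close>-smooth vector.\<close>

lemma xK_near:
  assumes u: "smooth d R n u" and p: "R > 0" "\<rho> > 0" "m > 0" "a > 0"
  shows "norm (half_sum x a (K m \<rho> R u) - K m \<rho> R (half_sum x a u)) \<le> a * (m + 2 * \<rho>) / R * n"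
proof -
  have n: "n \<ge> 0" using u norm_ge_zero order_trans unfolding smooth_def by blast
  let ?w1 = "avg d R u" let ?w2 = "avg c \<rho> ?w1"
  have w1: "smooth d R n ?w1"
    by (rule smooth_map[OF u p(1)]) (auto simp: nonexp_avgs avgs_0 commuting_avg(2)[OF isom_flow(4) isom_flow(4) commuting_refl[OF isom_flow(4)]])
  have w2: "smooth d R n ?w2"
    by (rule smooth_map[OF w1 p(1)]) (auto simp: nonexp_avgs avgs_0 commuting_avg(2)[OF isom_flow(3) isom_flow(4) comm(3)])
  have 1: "norm (x a ?w2 - avg c \<rho> (x a ?w1)) \<le> 2 * (a * \<rho>) / R * n"
  proof (rule avg_near2[OF isom_flow(3) nonexp(1) nonexp_id])
    fix t :: real assume t: "0 \<le> t" "t \<le> 1"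
    have "norm (x a (c (\<rho> * t) ?w1) - c (\<rho> * t) (x a ?w1)) \<le> 2 * \<bar>a * (\<rho> * t)\<bar> / R * n"
      by (rule xc_near[OF w1 p(1)])
    also have "\<bar>a * (\<rho> * t)\<bar> \<le> a * \<rho>" using t p by (simp add: abs_mult mult_left_le)
    then have "2 * \<bar>a * (\<rho> * t)\<bar> / R * n \<le> 2 * (a * \<rho>) / R * n"
      using n p by (intro mult_right_mono divide_right_mono) auto
    finally show "norm (x a (c (\<rho> * t) ?w1) - c (\<rho> * t) (x a ?w1)) \<le> 2 * (a * \<rho>) / R * n" .
  qed
  have 2: "x a ?w1 = avg d R (x a u)"
    by (rule commuting_avg(1)[OF isom_flow(1) isom_flow(4) comm(4)])
  have 3: "norm (x a ?w2 - S \<rho> R (x a u)) \<le> 2 * (a * \<rho>) / R * n"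
    using 1 by (simp add: 2 S_def)
  have "norm (x a (half_diff c m ?w2) - half_diff c m (x a ?w2)) \<le> (2 * \<bar>a * m\<bar> / R * n) / 2"
    by (rule half_diff_near[OF linear(1) xc_near[OF w2 p(1)]])
  moreover have "norm (half_diff c m (x a ?w2) - half_diff c m (S \<rho> R (x a u))) \<le> 2 * (a * \<rho>) / R * n"
    using 3 nonexp_norm[OF nonexp_half_sum(2)[OF isom_flow(3) zero(3)], of m] order_trans by blast
  ultimately have "norm (x a (K m \<rho> R u) - K m \<rho> R (x a u)) \<le> (2 * \<bar>a * m\<bar> / R * n) / 2 + 2 * (a * \<rho>) / R * n"
    unfolding K_def S_def[of \<rho> R u] by (rule norm_chain3)
  also have "\<dots> = a * (m + 2 * \<rho>) / R * n"
    using p by (simp add: field_simps)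
  finally have x: "norm (K m \<rho> R (x a u) - x a (K m \<rho> R u)) \<le> a * (m + 2 * \<rho>) / R * n"
    by (simp add: norm_minus_commute)
  have "0 \<le> a * (m + 2 * \<rho>) / R * n" using n p by auto
  moreover have "norm (half_sum x a (K m \<rho> R u) - K m \<rho> R (half_sum x a u)) \<le> (a * (m + 2 * \<rho>) / R * n) / 2"
    using half_sum_near[where f = "K m \<rho> R" and h = x and a = a and u = u, OF nonexp_K(3) x]
    by (simp only: norm_minus_commute)
  ultimately show ?thesis by (rule le_half)
qed

lemma xKn_near:
  assumes u: "smooth d R n u" and p: "R > 0" "\<rho> > 0" "m > 0" "a > 0"
  shows "norm (half_sum x a ((K m \<rho> R ^^ j) u) - (K m \<rho> R ^^ j) (half_sum x a u)) \<le> real j * (a * (m + 2 * \<rho>) / R * n)"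
  using u
proof (induction j arbitrary: u)
  case (Suc j)
  let ?K = "K m \<rho> R"
  have Ku: "smooth d R n (?K u)"
    by (rule smooth_map[OF Suc.prems p(1)]) (auto simp: nonexp_K K_commute)
  have "norm ((?K ^^ j) (half_sum x a (?K u)) - (?K ^^ j) (?K (half_sum x a u))) \<le> a * (m + 2 * \<rho>) / R * n"
    using nonexp_norm[OF nonexp_funpow[OF nonexp_K(1)]] xK_near[OF Suc.prems p] order_trans by blast
  from norm_chain3[OF Suc.IH[OF Ku] this] show ?case
    by (simp only: funpow.simps o_apply funpow_swap1 of_nat_Suc distrib_right mult_1 add.commute)
qed simp

end

lemma nonexp_norm0: "nonexp f \<Longrightarrow> f 0 = 0 \<Longrightarrow> norm (f v) \<le> norm v"
  using nonexp_norm[of f v 0] by simp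

lemma nonexp_le: "nonexp f \<Longrightarrow> norm (u - v) \<le> e \<Longrightarrow> norm (f u - f v) \<le> e"
  using nonexp_norm order_trans by blast

lemma smooth_nonneg: "smooth h \<rho> n v \<Longrightarrow> 0 \<le> n"
  using norm_ge_zero order_trans unfolding smooth_def by blast

lemma chain_0: "(\<And>i. f i 0 = 0) \<Longrightarrow> chain f n 0 = 0"
  by (induction n) simp_all

lemma funpow_0_fix: fixes f :: "'a::zero \<Rightarrow> 'a" shows "f 0 = 0 \<Longrightarrow> (f ^^ n) 0 = 0"
  by (induction n) simp_all

text \<open>An average over a segment much longer than \<open>a\<close> does not notice a shift by
  \<open>a\<close>; so the half sums of a block can be inserted below long averages at almost no
  cost.\<close>

lemma avg_half_sum_near:
  assumes "isom_flow h" "\<And>t. h t 0 = 0" "A > 0" "a \<ge> 0"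
  shows "norm (avg h A (half_sum h a v) - avg h A v) \<le> a / A * norm v"
proof -
  have l: "linear (avg h A)"
    using nonexp_linear_iff[of "avg h A"] nonexp_avg[OF assms(1)] by (simp add: avg_def assms(2))
  have "norm (avg h A (h a v) - avg h A v) \<le> a / A * norm (h A v - v)"
    using avg_shift[OF assms(1), of A a v] assms by simp
  also have "norm (h A v - v) \<le> 2 * norm v"
    using norm_triangle_ineq4[of "h A v" v] isom_flow_norm[OF assms(1,2)] by simp
  then have "a / A * norm (h A v - v) \<le> a / A * (2 * norm v)"
    using assms by (intro mult_left_mono) auto
  finally have *: "norm (avg h A (h a v) - avg h A v) \<le> 2 * (a / A * norm v)" by (simp add: mult_ac)
  have "avg h A (half_sum h a v) - avg h A v = (1/2) *\<^sub>R (avg h A (h a v) - avg h A v)"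
    by (simp add: half_sum_def linear_scale[OF l] linear_add[OF l] algebra_simps flip: scaleR_add_left)
  then show ?thesis using * by (simp add: mult_ac)
qed

lemma avg_chain_near:
  assumes h: "isom_flow h" "\<And>t. h t 0 = 0" and A: "A > 0" and f: "\<And>i. i < n \<Longrightarrow> 0 \<le> f i \<and> f i \<le> B" and B: "0 \<le> B"
  shows "norm (avg h A (chain (\<lambda>i. half_sum h (f i)) n v) - avg h A v) \<le> real n * (B / A) * norm v"
  using f
proof (induction n arbitrary: v)
  case (Suc n)
  have "norm (avg h A (half_sum h (f n) v) - avg h A v) \<le> f n / A * norm v"
    using Suc.prems by (intro avg_half_sum_near h A) auto
  also have "\<dots> \<le> B / A * norm v"
    using Suc.prems[of n] A by (intro mult_right_mono divide_right_mono) auto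
  finally have 1: "norm (avg h A (half_sum h (f n) v) - avg h A v) \<le> B / A * norm v" .
  have "norm (half_sum h (f n) v) \<le> norm v"
    by (rule nonexp_norm0[OF nonexp_half_sum(1)[OF h]]) (simp add: half_sum_def h)
  then have "real n * (B / A) * norm (half_sum h (f n) v) \<le> real n * (B / A) * norm v"
    using A B by (intro mult_left_mono) auto
  moreover have "norm (avg h A (chain (\<lambda>i. half_sum h (f i)) n (half_sum h (f n) v)) - avg h A (half_sum h (f n) v)) \<le> real n * (B / A) * norm (half_sum h (f n) v)"
    using Suc.prems by (intro Suc.IH) auto
  ultimately have "norm (avg h A (chain (\<lambda>i. half_sum h (f i)) n (half_sum h (f n) v)) - avg h A (half_sum h (f n) v)) \<le> real n * (B / A) * norm v"
    by linarith
  from norm_chain3[OF this 1] show ?case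
    by (simp only: chain.simps of_nat_Suc distrib_right mult_1 add.commute)
qed simp

text \<open>The numbers \<open>a i\<close> decrease and the numbers \<open>b i\<close> increase, so that \<open>a j * b i\<close> is much smaller
  than \<open>m = a i * b i\<close> for \<open>i < j\<close>: the blocks can be disentangled on \<open>c\<close>-smooth vectors.\<close>

locale block = lheis +
  fixes a0 b0 \<mu> \<rho> R r :: real and k :: nat
  assumes pos: "0 < a0" "0 < b0" "1 \<le> \<mu>" "0 < \<rho>" "0 < R"
    and r: "0 \<le> r" "r \<le> 1"
    and gain: "\<And>a b v n. norm v \<le> n \<Longrightarrow> norm (d (q * a\<^sup>2 * b) v - v) \<le> n / 20 \<Longrightarrow>
        norm (half_sum x a (half_sum y b (half_diff c (a * b) v))) \<le> r * n"
    and small: "2 * a0 * (a0 * b0) / R \<le> 1 / 20"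
begin

definition "m = a0 * b0"
definition "a i = a0 / \<mu> ^ i"
definition "b i = b0 * \<mu> ^ i"
definition "X = (\<lambda>i. half_sum x (a i))"
definition "Y = (\<lambda>i. half_sum y (b i))"
text \<open>\<open>k\<close> times the cost of one swap: the first two summands are the error of
  \<open>XY_swap\<close>, the third is that of \<open>xK_near\<close>.\<close>

definition "E = real k * (2 * (m / \<mu>) / \<rho> + 2 * (a0 * m) / R + a0 * (m + 2 * \<rho>) / R)"

lemma mpos: "m > 0" using pos by (simp add: m_def)

lemma ab: "a i * b i = m" "0 < a i" "0 < b i" "a i \<le> a0"
proof -
  have "1 \<le> \<mu> ^ i" using pos by simp
  then show "a i \<le> a0" using pos by (simp add: a_def divide_le_eq_1 mult_le_cancel_left1 divide_le_eq)
qed (use pos in \<open>auto simp: a_def b_def m_def\<close>)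

lemma ab_less: assumes "i < j" shows "a j * b i \<le> m / \<mu>"
proof -
  obtain l where l: "j = Suc (i + l)" using less_imp_Suc_add[OF assms] by auto
  have "a j * b i = (m / \<mu>) / \<mu> ^ l"
    using pos by (simp add: a_def b_def m_def l power_add field_simps)
  also have "\<dots> \<le> m / \<mu>"
    using pos mpos one_le_power[of \<mu> l] by (simp add: divide_le_eq mult_le_cancel_left1)
  finally show ?thesis .
qed

lemma nonexp_XY: "nonexp (X i)" "nonexp (Y i)" "X i 0 = 0" "Y i 0 = 0"
  unfolding X_def Y_def by (auto simp: half_sum_def zero intro!: nonexp_half_sum(1) isom_flow)

lemma K_Y: "K m \<rho> R (Y i v) = Y i (K m \<rho> R v)"
  unfolding Y_def by (rule half_sum_commute(1)[where f = "K m \<rho> R" and h = y, OF nonexp_K(3) K_commute(1)])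

lemma dY: "d t (Y i v) = Y i (d t v)"
  unfolding Y_def by (rule half_sum_commute(1)[where f = "d t" and h = y, OF linear(4) cm(3)[symmetric]])

lemma cY: "c t (Y i v) = Y i (c t v)"
  unfolding Y_def by (rule half_sum_commute(1)[where f = "c t" and h = y, OF linear(3) cm(2)[symmetric]])

lemma smooth_Y: "smooth c \<rho> n v \<Longrightarrow> smooth c \<rho> n (Y i v)" "smooth d R n v \<Longrightarrow> smooth d R n (Y i v)"
  by (rule smooth_map; use pos nonexp_XY cY dY in simp)+

lemma XY_swap:
  assumes u: "smooth c \<rho> n u" "smooth d R n u" and ij: "i < j"
  shows "norm (X j (Y i u) - Y i (X j u)) \<le> (2 * (m / \<mu>) / \<rho> + 2 * (a0 * m) / R) * n"
proof -
  let ?e = "(2 * (m / \<mu>) / \<rho> + 2 * (a0 * m) / R) * n"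
  have n: "n \<ge> 0" using u smooth_nonneg by blast
  have ab1: "a j * b i \<le> m / \<mu>" "0 < a j" "0 < b i" "a j \<le> a0" using ab ab_less ij by auto
  have "m / \<mu> \<le> m" using pos mpos by (simp add: divide_le_eq mult_le_cancel_left1)
  then have "(a j)\<^sup>2 * b i \<le> a0 * m"
    using mult_mono[of "a j" a0 "a j * b i" m] ab1 pos by (simp add: power2_eq_square mult.assoc)
  then have "2 * \<bar>a j * b i\<bar> / \<rho> + 2 * ((a j)\<^sup>2 * \<bar>b i\<bar>) / R \<le> 2 * (m / \<mu>) / \<rho> + 2 * (a0 * m) / R"
    using ab1 pos by (intro add_mono divide_right_mono mult_left_mono) auto
  then have "(2 * \<bar>a j * b i\<bar> / \<rho> + 2 * ((a j)\<^sup>2 * \<bar>b i\<bar>) / R) * n \<le> ?e"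
    using n by (rule mult_right_mono)
  then have 1: "norm (x (a j) (y (b i) u) - y (b i) (x (a j) u)) \<le> ?e"
    using xy_near[OF u pos(4,5), of "a j" "b i"] by linarith
  have e0: "0 \<le> ?e" using n pos mpos by auto
  have "norm (x (a j) (Y i u) - Y i (x (a j) u)) \<le> ?e / 2"
    unfolding Y_def by (rule half_sum_near[where f = "x (a j)" and h = y, OF linear(1) 1])
  then have 2: "norm (Y i (x (a j) u) - x (a j) (Y i u)) \<le> ?e"
    using le_half[OF e0] by (simp only: norm_minus_commute)
  have "linear (Y i)" using nonexp_linear_iff[of "Y i"] nonexp_XY by simp
  from half_sum_near[where f = "Y i" and h = x and a = "a j" and u = u, OF this 2]
  have "norm (Y i (X j u) - X j (Y i u)) \<le> ?e / 2" by (simp add: X_def)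
  then show ?thesis
    using le_half[OF e0] by (simp only: norm_minus_commute)
qed

lemma X_chain_swap:
  assumes "smooth c \<rho> n u" "smooth d R n u" "l \<le> j"
  shows "norm (X j (chain Y l u) - chain Y l (X j u)) \<le> real l * ((2 * (m / \<mu>) / \<rho> + 2 * (a0 * m) / R) * n)"
  using assms
proof (induction l arbitrary: u)
  case (Suc l)
  have 1: "norm (X j (chain Y l (Y l u)) - chain Y l (X j (Y l u))) \<le> real l * ((2 * (m / \<mu>) / \<rho> + 2 * (a0 * m) / R) * n)"
    using Suc.prems by (intro Suc.IH smooth_Y) auto
  have 2: "norm (chain Y l (X j (Y l u)) - chain Y l (Y l (X j u))) \<le> (2 * (m / \<mu>) / \<rho> + 2 * (a0 * m) / R) * n"
    using Suc.prems by (intro nonexp_le[OF nonexp_chain[of Y]] XY_swap nonexp_XY) auto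
  from norm_chain3[OF 1 2] show ?case
    by (simp only: chain.simps of_nat_Suc distrib_right[of 1 "real l"] mult_1 add.commute)
qed simp

text \<open>In \<open>chain\<close> the last index acts first, so the induction peels off
  \<open>X n\<close>, \<open>Y n\<close> and one \<open>K\<close> next to the vector.
  \<open>Y n\<close> commutes with \<open>K\<close>; \<open>X n\<close> is moved inward past the
  \<open>Y i\<close> with \<open>i < n\<close>, where the scales are separated, and past the other
  copies of \<open>K\<close>. The three factors then meet as in \<open>gain\<close> and contribute
  \<open>r\<close>. Each peeling adds at most \<open>E\<close>.\<close>

theorem block_bound:
  assumes "n \<le> k"
  shows "norm (chain X n (chain Y n ((K m \<rho> R ^^ n) v))) \<le> (r ^ n + real n * E) * norm v"
  using assms
proof (induction n arbitrary: v)
  case (Suc n)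
  let ?K = "K m \<rho> R"
  let ?e1 = "2 * (m / \<mu>) / \<rho> + 2 * (a0 * m) / R" and ?e2 = "a0 * (m + 2 * \<rho>) / R"
  have e: "0 \<le> ?e1" "0 \<le> ?e2" using pos mpos by auto
  \<comment> \<open>The copy of \<open>K\<close> set apart here contains the filter
    \<open>S\<close>; this makes \<open>w\<close>, and with it \<open>u\<close>, smooth at the
    scales \<rho> and \<open>R\<close>.\<close>
  define w where "w = ?K (Y n v)"
  define u where "u = (?K ^^ n) w"
  have nv: "norm (half_diff c m (Y n v)) \<le> norm v"
    using nonexp_norm0[OF nonexp_half_sum(2)[OF isom_flow(3) zero(3)], of m "Y n v"] nonexp_norm0[OF nonexp_XY(2) nonexp_XY(4), of n v]
    by (simp add: half_diff_def zero)
  have wS: "w = S \<rho> R (half_diff c m (Y n v))"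
    unfolding w_def K_def
    by (rule half_sum_commute(2)[where f = "S \<rho> R" and h = c, OF nonexp_S(3) S_commute(2), symmetric])
  have w: "smooth c \<rho> (norm v) w" "smooth d R (norm v) w"
    unfolding wS using pos nv by (auto intro!: S_smooth)
  have Kn: "nonexp (?K ^^ n)" "(?K ^^ n) 0 = 0" by (simp_all add: nonexp_funpow nonexp_K funpow_0_fix)
  have u: "smooth c \<rho> (norm v) u" "smooth d R (norm v) u"
    unfolding u_def
    by (rule smooth_map[OF w(1) pos(4) Kn]; rule funpow_commute[symmetric]; rule K_commute[symmetric])
      (rule smooth_map[OF w(2) pos(5) Kn]; rule funpow_commute[symmetric]; rule K_commute[symmetric])
  have start: "chain X (Suc n) (chain Y (Suc n) ((?K ^^ Suc n) v)) = chain X n (X n (chain Y n u))"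
  proof -
    have "Y n ((?K ^^ Suc n) v) = u"
      unfolding u_def w_def K_Y[symmetric] funpow_Suc_right o_apply
      by (simp only: funpow_commute[where g = "Y n" and f = ?K, OF K_Y[symmetric]] K_Y)
    then show ?thesis by simp
  qed
  have nX: "nonexp (chain X n)" "nonexp (chain Y n)" using nonexp_chain nonexp_XY by blast+
  have "norm (chain X n (X n (chain Y n u)) - chain X n (chain Y n (X n u))) \<le> real n * (?e1 * norm v)"
    by (rule nonexp_le[OF nX(1)], rule X_chain_swap[OF u]) simp
  moreover have "norm (chain X n (chain Y n (X n u)) - chain X n (chain Y n ((?K ^^ n) (X n w)))) \<le> real n * (?e2 * norm v)"
  proof (rule nonexp_le[OF nX(1)], rule nonexp_le[OF nX(2)])
    have "norm (X n u - (?K ^^ n) (X n w)) \<le> real n * (a n * (m + 2 * \<rho>) / R * norm v)"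
      unfolding u_def X_def by (rule xKn_near[OF w(2) pos(5) pos(4) mpos ab(2)])
    also have "\<dots> \<le> real n * (?e2 * norm v)"
      using ab(4)[of n] pos mpos by (intro mult_left_mono mult_right_mono divide_right_mono) auto
    finally show "norm (X n u - (?K ^^ n) (X n w)) \<le> real n * (?e2 * norm v)" .
  qed
  ultimately have 1: "norm (chain X n (X n (chain Y n u)) - chain X n (chain Y n ((?K ^^ n) (X n w))))
      \<le> real n * (?e1 * norm v) + real n * (?e2 * norm v)"
    by (rule norm_chain3)
  \<comment> \<open>Here the gain is taken: on \<open>S \<rho> R v\<close> the
    \<open>d\<close>-displacement is small enough for \<open>gain\<close>, thanks to the assumption
    \<open>small\<close>.\<close>
  have Xw: "norm (X n w) \<le> r * norm v"
  proof -
    have Sv: "norm (S \<rho> R v) \<le> norm v" "smooth d R (norm v) (S \<rho> R v)"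
      using nonexp_norm0[OF nonexp_S(1,2)] S_smooth(2)[OF pos(4,5)] by auto
    have "norm (d (q * (a n)\<^sup>2 * b n) (S \<rho> R v) - S \<rho> R v) \<le> 2 * \<bar>q * (a n)\<^sup>2 * b n\<bar> / R * norm v"
      using Sv(2) by (simp add: smooth_def)
    also have "\<dots> \<le> 1/20 * norm v"
    proof (rule mult_right_mono)
      have "\<bar>q * (a n)\<^sup>2 * b n\<bar> = \<bar>q\<bar> * (a n * m)"
        using ab[of n] mpos by (simp add: abs_mult power2_eq_square)
      also have "\<dots> \<le> 1 * (a0 * m)"
        using q ab[of n] mpos by (intro mult_mono mult_right_mono) auto
      finally have "2 * \<bar>q * (a n)\<^sup>2 * b n\<bar> / R \<le> 2 * (a0 * m) / R"
        using pos by (intro divide_right_mono) auto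
      then show "2 * \<bar>q * (a n)\<^sup>2 * b n\<bar> / R \<le> 1 / 20"
        using small by (simp add: m_def mult.assoc)
    qed simp
    finally have "norm (half_sum x (a n) (half_sum y (b n) (half_diff c (a n * b n) (S \<rho> R v)))) \<le> r * norm v"
      using Sv(1) by (intro gain) auto
    moreover have "w = Y n (half_diff c m (S \<rho> R v))"
      unfolding w_def K_Y by (simp add: K_def)
    ultimately show ?thesis by (simp add: X_def Y_def ab)
  qed
  have "norm (chain X n (chain Y n ((?K ^^ n) (X n w)))) \<le> (r ^ n + real n * E) * norm (X n w)"
    using Suc by (intro Suc.IH) auto
  also have "\<dots> \<le> (r ^ n + real n * E) * (r * norm v)"
    using Xw r e by (intro mult_left_mono) (auto simp: E_def intro!: add_nonneg_nonneg)
  also have "\<dots> \<le> (r ^ Suc n + real n * E) * norm v"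
  proof -
    have "0 \<le> real n * E" using e by (simp add: E_def)
    then have "real n * E * r \<le> real n * E" using r by (simp add: mult_left_le)
    then have "(r ^ n + real n * E) * r \<le> r ^ Suc n + real n * E" by (simp add: algebra_simps)
    then show ?thesis unfolding mult.assoc[symmetric] by (intro mult_right_mono) auto
  qed
  finally have 2: "norm (chain X n (chain Y n ((?K ^^ n) (X n w)))) \<le> (r ^ Suc n + real n * E) * norm v" .
  have "real n * (?e1 * norm v) + real n * (?e2 * norm v) = real n * (?e1 + ?e2) * norm v"
    by (simp only: distrib_left distrib_right mult.assoc)
  also have "\<dots> \<le> real k * (?e1 + ?e2) * norm v"
    using Suc.prems e by (intro mult_right_mono) auto
  also have "\<dots> = E * norm v" by (simp add: E_def)
  finally have 3: "real n * (?e1 * norm v) + real n * (?e2 * norm v) \<le> E * norm v" .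
  have "norm (chain X n (X n (chain Y n u))) \<le> (r ^ Suc n + real n * E) * norm v + E * norm v"
    using 1 2 3 norm_triangle_ineq2[of "chain X n (X n (chain Y n u))" "chain X n (chain Y n ((?K ^^ n) (X n w)))"]
    by linarith
  also have "\<dots> = (r ^ Suc n + real (Suc n) * E) * norm v"
    by (simp only: of_nat_Suc distrib_right mult_1 add.assoc add.commute add.left_commute)
  finally show ?case unfolding start .
qed simp

end

section \<open>Exponential decay of central oscillations\<close>

text \<open>Names the constant of \<open>commutator_gain\<close>. It depends on the Banach space
  only and is uniform over all systems of flows and all scales, so that gains at different scales
  multiply.\<close>

definition gain_const :: "'a::banach itself \<Rightarrow> real \<Rightarrow> bool" where
  "gain_const TYPE('a) r \<longleftrightarrow> 1/2 \<le> r \<and> r < 1 \<and>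
    (\<forall>x y c d q a b (v::'a) n. lheis x y c d q \<longrightarrow> norm v \<le> n \<longrightarrow>
      norm (d (q * a\<^sup>2 * b) v - v) \<le> n / 20 \<longrightarrow> norm (half_sum x a (half_sum y b (half_diff c (a * b) v))) \<le> r * n)"

lemma gain_const_exists:
  "uniformly_convex TYPE('a::banach) \<Longrightarrow> \<exists>r. gain_const TYPE('a) r"
  using commutator_gain unfolding gain_const_def by metis

lemma avg_near1:
  assumes "isom_flow h" "nonexp f" "\<And>t. 0 \<le> t \<Longrightarrow> t \<le> 1 \<Longrightarrow> norm (f (h (A * t) v) - w) \<le> e"
  shows "norm (f (avg h A v) - w) \<le> e"
proof -
  have c: "continuous_on {0..1} (\<lambda>t. f (h (A * t) v))"
    by (rule continuous_on_compose2[OF nonexp_cont[OF assms(2)] avg_cont[OF assms(1)] subset_UNIV])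
  have "f (avg h A v) - w = integral {0..1} (\<lambda>t. f (h (A * t) v) - w)"
    unfolding avg_def nonexp_integral[OF assms(2) avg_cont[OF assms(1)]]
    using integrable_continuous_real[OF c]
    by (subst Henstock_Kurzweil_Integration.integral_diff) auto
  also have "norm \<dots> \<le> e"
    by (intro norm_integral_le continuous_intros c assms)
  finally show ?thesis .
qed

text \<open>The half sums are absorbed by the averages, so the gain of the block becomes a bound for
  the averages themselves. The last two summands compare the largest scales of the block,
  \<open>a0\<close> and \<open>b0 * \<mu> ^ k\<close>, with the lengths \<open>A\<close> and
  \<open>B\<close>.\<close>

lemma (in block) avg_block_bound:
  assumes A: "A > 0" and B: "B > 0"
  shows "norm (avg x A (avg y B ((K m \<rho> R ^^ k) v)))
    \<le> (r ^ k + real k * E + real k * (a0 / A) + real k * (b0 * \<mu> ^ k / B)) * norm v"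
proof -
  let ?K = "K m \<rho> R"
  define z where "z = (?K ^^ k) v"
  define u where "u = avg y B z"
  have nY: "nonexp (chain Y k)" "chain Y k 0 = 0" "nonexp (chain X k)" "chain X k 0 = 0"
    by (simp_all add: nonexp_chain nonexp_XY chain_0)
  have nz: "norm z \<le> norm v"
    unfolding z_def by (rule nonexp_norm0[OF nonexp_funpow[OF nonexp_K(1)] funpow_0_fix[where f = "K m \<rho> R", OF nonexp_K(2)]])
  have nu: "norm u \<le> norm v"
    unfolding u_def using nonexp_norm0[OF nonexp_avgs(2) avgs_0(2), of B z] nz by linarith
  have uK: "u = (?K ^^ k) (avg y B v)"
    unfolding u_def z_def
    by (rule funpow_commute[where g = "avg y B" and f = ?K])
      (rule avg_commute[where f = ?K and h = y, OF isom_flow(2) nonexp_K(1) K_commute(1), symmetric])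
  have c1: "chain Y k u = avg y B (chain Y k z)"
    unfolding u_def
  proof (rule chain_commute[where g = "avg y B" and f = Y, symmetric])
    fix i v
    have "Y i (y t v) = y t (Y i v)" for t v
    proof -
      have "y t (y s w) = y s (y t w)" for s w
        using commuting_refl[OF isom_flow(2)] by (simp add: commuting_def)
      then show ?thesis
        unfolding Y_def by (rule half_sum_commute(1)[where f = "y t" and h = y, OF linear(2), symmetric])
    qed
    then show "avg y B (Y i v) = Y i (avg y B v)"
      by (rule avg_commute[where f = "Y i" and h = y, OF isom_flow(2) nonexp_XY(2), symmetric])
  qed
  have "norm (avg y B (chain Y k z) - avg y B z) \<le> real k * (b0 * \<mu> ^ k / B) * norm z"
    unfolding Y_def
  proof (rule avg_chain_near[OF isom_flow(2) zero(2) B])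
    fix i assume "i < k"
    then have "\<mu> ^ i \<le> \<mu> ^ k" using pos by (intro power_increasing) auto
    then show "0 \<le> b i \<and> b i \<le> b0 * \<mu> ^ k" using pos by (auto simp: b_def)
  qed (use pos in auto)
  also have "\<dots> \<le> real k * (b0 * \<mu> ^ k / B) * norm v"
    using pos B by (intro mult_left_mono nz mult_nonneg_nonneg divide_nonneg_pos zero_le_power) auto
  finally have 0: "norm (chain Y k u - u) \<le> real k * (b0 * \<mu> ^ k / B) * norm v"
    unfolding c1 unfolding u_def .
  have 1: "norm (avg x A (chain Y k u) - avg x A u) \<le> real k * (b0 * \<mu> ^ k / B) * norm v"
    by (rule nonexp_le[OF nonexp_avgs(1) 0])
  have "norm (avg x A (chain X k (chain Y k u)) - avg x A (chain Y k u)) \<le> real k * (a0 / A) * norm (chain Y k u)"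
    unfolding X_def
    by (rule avg_chain_near[OF isom_flow(1) zero(1) A]) (use ab pos in \<open>auto simp: less_imp_le\<close>)
  also have "\<dots> \<le> real k * (a0 / A) * norm v"
    using nonexp_norm0[OF nY(1,2), of u] nu pos A by (intro mult_left_mono) auto
  finally have 2: "norm (avg x A (chain X k (chain Y k u)) - avg x A (chain Y k u)) \<le> real k * (a0 / A) * norm v" .
  have "norm (avg x A (chain X k (chain Y k u))) \<le> norm (chain X k (chain Y k u))"
    by (rule nonexp_norm0[OF nonexp_avgs(1) avgs_0(1)])
  also have "\<dots> \<le> (r ^ k + real k * E) * norm (avg y B v)"
    unfolding uK by (rule block_bound) simp
  also have "\<dots> \<le> (r ^ k + real k * E) * norm v"
    using nonexp_norm0[OF nonexp_avgs(2) avgs_0(2), of B v] r pos mpos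
    by (intro mult_left_mono) (auto simp: E_def intro!: add_nonneg_nonneg mult_nonneg_nonneg divide_nonneg_pos)
  finally have 3: "norm (avg x A (chain X k (chain Y k u))) \<le> (r ^ k + real k * E) * norm v" .
  have "norm (avg x A u) \<le> norm (avg x A (chain X k (chain Y k u)))
      + norm (avg x A (chain X k (chain Y k u)) - avg x A (chain Y k u)) + norm (avg x A (chain Y k u) - avg x A u)"
    using norm_triangle_sub[of "avg x A u" "avg x A (chain Y k u)"]
      norm_triangle_sub[of "avg x A (chain Y k u)" "avg x A (chain X k (chain Y k u))"]
    by (simp only: norm_minus_commute)
  also have "\<dots> \<le> (r ^ k + real k * E) * norm v + real k * (a0 / A) * norm v + real k * (b0 * \<mu> ^ k / B) * norm v"
    using 1 2 3 by (intro add_mono)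
  finally show ?thesis
    unfolding u_def z_def by (simp only: distrib_right)
qed

context lheis
begin

text \<open>Filtering at scales far below those at which a vector is already smooth changes it
  little; this is how powers of \<open>S\<close> are inserted in \<open>osc_bound\<close>.\<close>

lemma S_funpow_near:
  assumes u: "smooth c \<rho>' n u" "smooth d R' n u" and p: "\<rho>' > 0" "R' > 0" "\<rho> > 0" "R > 0"
  shows "norm ((S \<rho> R ^^ k) u - u) \<le> real k * ((2 * \<rho> / \<rho>' + 2 * R / R') * n)"
  using u
proof (induction k arbitrary: u)
  case (Suc k)
  have n: "0 \<le> n" using Suc.prems smooth_nonneg by blast
  have "norm (avg d R u - u) \<le> 2 * R / R' * n"
  proof (rule avg_near[OF isom_flow(4)])
    fix t :: real assume t: "0 \<le> t" "t \<le> 1"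
    have "norm (d (R * t) u - u) \<le> 2 * \<bar>R * t\<bar> / R' * n"
      using Suc.prems by (simp add: smooth_def)
    also have "\<dots> \<le> 2 * R / R' * n"
      using t p n by (intro mult_right_mono divide_right_mono) (auto simp: abs_mult mult_left_le)
    finally show "norm (d (R * t) u - u) \<le> 2 * R / R' * n" .
  qed
  then have 1: "norm (S \<rho> R u - avg c \<rho> u) \<le> 2 * R / R' * n"
    unfolding S_def by (rule nonexp_le[OF nonexp_avgs(3)])
  have 2: "norm (avg c \<rho> u - u) \<le> 2 * \<rho> / \<rho>' * n"
  proof (rule avg_near[OF isom_flow(3)])
    fix t :: real assume t: "0 \<le> t" "t \<le> 1"
    have "norm (c (\<rho> * t) u - u) \<le> 2 * \<bar>\<rho> * t\<bar> / \<rho>' * n"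
      using Suc.prems by (simp add: smooth_def)
    also have "\<dots> \<le> 2 * \<rho> / \<rho>' * n"
      using t p n by (intro mult_right_mono divide_right_mono) (auto simp: abs_mult mult_left_le)
    finally show "norm (c (\<rho> * t) u - u) \<le> 2 * \<rho> / \<rho>' * n" .
  qed
  have 3: "norm (S \<rho> R u - u) \<le> (2 * \<rho> / \<rho>' + 2 * R / R') * n"
    using norm_chain3[OF 1 2] by (simp only: distrib_right add.commute)
  have "norm ((S \<rho> R ^^ k) (S \<rho> R u) - S \<rho> R u) \<le> real k * ((2 * \<rho> / \<rho>' + 2 * R / R') * n)"
    by (rule Suc.IH; rule smooth_map[where f = "S \<rho> R"])
      (use Suc.prems p in \<open>simp_all add: nonexp_S S_commute\<close>)
  from norm_chain3[OF this 3] show ?case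
    by (simp only: funpow.simps o_apply funpow_swap1 of_nat_Suc distrib_right[of 1 "real k"] mult_1 add.commute)
qed simp

lemma nonexp_half_diff: "nonexp (half_diff c m)" "half_diff c m 0 = 0" "linear (half_diff c m)"
  using nonexp_half_sum(2)[OF isom_flow(3) zero(3), of m] nonexp_linear_iff[of "half_diff c m"] by (auto simp: half_diff_def zero)

lemma K_funpow: "(K m \<rho> R ^^ k) v = (half_diff c m ^^ k) ((S \<rho> R ^^ k) v)"
proof (induction k arbitrary: v)
  case (Suc k)
  have "S \<rho> R (half_diff c m v) = half_diff c m (S \<rho> R v)" for v
    by (rule half_sum_commute(2)[where f = "S \<rho> R" and h = c, OF nonexp_S(3) S_commute(2)])
  then have "(S \<rho> R ^^ k) (half_diff c m v) = half_diff c m ((S \<rho> R ^^ k) v)" for v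
    using funpow_commute[where g = "half_diff c m" and f = "S \<rho> R"] by metis
  then have "(S \<rho> R ^^ k) (K m \<rho> R v) = half_diff c m ((S \<rho> R ^^ k) (S \<rho> R v))"
    by (simp add: K_def)
  then show ?case
    by (simp add: funpow_Suc_right Suc del: funpow.simps)
qed simp

lemma half_diff_funpow:
  "(half_diff c m ^^ n) v = (1 / 2 ^ n) *\<^sub>R (\<Sum>j\<le>n. ((-1) ^ j * real (n choose j)) *\<^sub>R c (real j * m) v)"
proof (induction n)
  case 0 then show ?case by (simp add: isom_flowD(2)[OF isom_flow(3)])
next
  case (Suc n)
  let ?f = "\<lambda>j. c (real j * m) v"
  let ?k = "\<lambda>n j. (-1) ^ j * real (n choose j)"
  have cs: "c m (?f j) = ?f (Suc j)" for j
    using isom_flowD(3)[OF isom_flow(3), of m "real j * m" v] by (simp add: distrib_right)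
  have 1: "(\<Sum>j\<le>Suc n. ?k (Suc n) j *\<^sub>R ?f j) = (\<Sum>j\<le>n. ?k n j *\<^sub>R ?f j) - (\<Sum>j\<le>n. ?k n j *\<^sub>R ?f (Suc j))"
  proof -
    have "(\<Sum>j\<le>Suc n. ?k (Suc n) j *\<^sub>R ?f j) = ?f 0 + (\<Sum>j\<le>n. ?k (Suc n) (Suc j) *\<^sub>R ?f (Suc j))"
      by (subst sum.atMost_Suc_shift) simp
    also have "(\<Sum>j\<le>n. ?k (Suc n) (Suc j) *\<^sub>R ?f (Suc j))
        = (\<Sum>j\<le>n. ?k n (Suc j) *\<^sub>R ?f (Suc j)) - (\<Sum>j\<le>n. ?k n j *\<^sub>R ?f (Suc j))"
      unfolding sum_subtractf[symmetric] by (rule sum.cong) (simp_all add: algebra_simps)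
    also have "?f 0 + \<dots> = (\<Sum>j\<le>Suc n. ?k n j *\<^sub>R ?f j) - (\<Sum>j\<le>n. ?k n j *\<^sub>R ?f (Suc j))"
      by (subst sum.atMost_Suc_shift) simp
    finally show ?thesis by simp
  qed
  have "(half_diff c m ^^ Suc n) v = half_diff c m ((1 / 2 ^ n) *\<^sub>R (\<Sum>j\<le>n. ?k n j *\<^sub>R ?f j))"
    by (simp add: Suc)
  also have "\<dots> = (1 / 2 ^ Suc n) *\<^sub>R ((\<Sum>j\<le>n. ?k n j *\<^sub>R ?f j) - (\<Sum>j\<le>n. ?k n j *\<^sub>R ?f (Suc j)))"
    by (simp add: half_diff_def linear_scale[OF linear(3)] linear_sum[OF linear(3)] cs scaleR_diff_right)
  finally show ?case unfolding 1 .
qed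

text \<open>Of the \<open>2 * k\<close> half differences, \<open>k\<close> become factors
  \<open>K\<close> of a block once powers of \<open>S\<close> are inserted, which is cheap because
  of the averages over \<open>c\<close> and \<open>d\<close>; the other \<open>k\<close> are bounded
  by nonexpansiveness. The even number gives the binomial expansion in \<open>scale_bound\<close> a
  middle term.\<close>

lemma osc_bound:
  assumes g: "gain_const TYPE('a) r" and k: "k \<ge> 7" and l: "\<kappa> = 2 ^ k"
    and p: "A > 0" "B > 0" "R > 0" "\<rho> > 0"
    and c1: "A * \<rho> * \<kappa>\<^sup>2 \<le> R" and c2: "\<rho> * \<kappa> ^ (5 * k + 6) \<le> A * B"
    and m: "0 < m" "m \<le> 2 * \<kappa> * \<rho>"
  shows "norm (avg x A (avg y B (avg c (\<rho> / \<kappa>) (avg d R ((half_diff c m ^^ (2 * k)) z)))))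
    \<le> (r ^ k + 19 * (real k)\<^sup>2 / \<kappa>) * norm z"
proof -
  have l1: "\<kappa> \<ge> 128" using power_increasing[OF k, of "2::real"] l by simp
  have kl: "real k \<le> \<kappa>" using l less_exp[of k] by (metis of_nat_less_iff less_imp_le of_nat_power of_nat_numeral)
  have k1: "real k \<ge> 1" using k by simp
  \<comment> \<open>Safety factors are powers of \<kappa>: the filters work a factor
    \<open>\<kappa>\<^sup>2\<close> below \<rho> and \<open>R\<close>, and the largest
    \<open>x\<close>-scale lies as far below \<open>A\<close>.\<close>
  define \<rho>2 R2 where "\<rho>2 = \<rho> / \<kappa>\<^sup>2" and "R2 = R / \<kappa>\<^sup>2"
  define a0 b0 where "a0 = A / \<kappa>\<^sup>2" and "b0 = m / a0"
  have ps: "0 < \<rho>2" "0 < R2" "0 < a0" "0 < b0" using p m l1 by (auto simp: \<rho>2_def R2_def a0_def b0_def)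
  have ab: "a0 * b0 = m" using ps by (simp add: b0_def)
  have AR: "A * \<rho> * \<kappa> / R \<le> 1 / \<kappa>"
    using c1 p l1 by (simp add: field_simps power2_eq_square)
  have am: "a0 * m / R2 \<le> 2 / \<kappa>"
  proof -
    have "a0 * m / R2 = A * m / R" using l1 by (simp add: a0_def R2_def)
    also have "\<dots> \<le> A * (2 * \<kappa> * \<rho>) / R" using m p by (intro divide_right_mono mult_left_mono) auto
    also have "\<dots> = 2 * (A * \<rho> * \<kappa> / R)" by simp
    finally show ?thesis using AR by simp
  qed
  \<comment> \<open>The ratio \<open>\<kappa> ^ 5\<close> of consecutive scales outweighs
    \<open>m / \<rho>2\<close>, which is at most \<open>2 * \<kappa> ^ 3\<close>. The bound
    \<open>k \<ge> 7\<close> gives \<open>\<kappa> \<ge> 128\<close>, enough for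
    \<open>4 / \<kappa> \<le> 1 / 20\<close>.\<close>
  interpret L: block x y c d q a0 b0 "\<kappa> ^ 5" \<rho>2 R2 r k
  proof
    show "norm (half_sum x a (half_sum y b (half_diff c (a * b) v))) \<le> r * n"
      if "norm v \<le> n" "norm (d (q * a\<^sup>2 * b) v - v) \<le> n / 20" for a b v n
      using g lheis_axioms that unfolding gain_const_def by blast
    have "2 * a0 * (a0 * b0) / R2 = 2 * (a0 * m / R2)" by (simp add: ab)
    also have "\<dots> \<le> 2 * (2 / \<kappa>)" using am by simp
    also have "\<dots> \<le> 1/20" using l1 by (simp add: field_simps)
    finally show "2 * a0 * (a0 * b0) / R2 \<le> 1 / 20" .
  qed (use ps l1 g in \<open>auto simp: gain_const_def\<close>)
  have mm: "L.m = m" by (simp add: L.m_def ab)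
  have E: "L.E \<le> 12 * real k / \<kappa>"
  proof -
    have "2 * (m / \<kappa> ^ 5) / \<rho>2 \<le> 4 / \<kappa>"
    proof -
      have "2 * (m / \<kappa> ^ 5) / \<rho>2 \<le> 2 * ((2 * \<kappa> * \<rho>) / \<kappa> ^ 5) / \<rho>2"
        using m ps l1 by (intro divide_right_mono mult_left_mono) auto
      also have "\<dots> = 4 / \<kappa> ^ 2"
        using p l1 by (simp add: \<rho>2_def field_simps eval_nat_numeral)
      also have "\<dots> \<le> 4 / \<kappa>"
        using l1 by (simp add: field_simps power2_eq_square)
      finally show ?thesis .
    qed
    moreover have "a0 * (m + 2 * \<rho>2) / R2 \<le> 4 / \<kappa>"
    proof -
      have "2 * \<rho>2 \<le> 2 * \<kappa> * \<rho>"
      proof -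
        have "\<rho>2 \<le> \<rho>" using p l1 by (simp add: \<rho>2_def divide_le_eq mult_le_cancel_left1)
        also have "\<rho> \<le> \<kappa> * \<rho>" using p l1 by simp
        finally show ?thesis by simp
      qed
      then have "a0 * (m + 2 * \<rho>2) / R2 \<le> a0 * (4 * \<kappa> * \<rho>) / R2"
        using m ps by (intro divide_right_mono mult_left_mono) auto
      also have "\<dots> = 4 * (A * \<rho> * \<kappa> / R)" using l1 by (simp add: a0_def R2_def)
      finally show ?thesis using AR by simp
    qed
    ultimately have "2 * (m / \<kappa> ^ 5) / \<rho>2 + 2 * (a0 * m) / R2 + a0 * (m + 2 * \<rho>2) / R2 \<le> 12 / \<kappa>"
      using am by simp
    then have "real k * (2 * (m / \<kappa> ^ 5) / \<rho>2 + 2 * (a0 * m) / R2 + a0 * (m + 2 * \<rho>2) / R2) \<le> real k * (12 / \<kappa>)"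
      by (rule mult_left_mono) simp
    then show ?thesis unfolding L.E_def mm by (simp add: mult.commute)
  qed
  have kk: "real k / \<kappa> \<le> (real k)\<^sup>2 / \<kappa>"
    using k1 l1 by (intro divide_right_mono) (auto simp: power2_eq_square)
  have "real k * L.E \<le> real k * (12 * real k / \<kappa>)" using E by (intro mult_left_mono) auto
  then have e1: "real k * L.E \<le> 12 * ((real k)\<^sup>2 / \<kappa>)" by (simp add: power2_eq_square mult_ac)
  have e2: "real k * (a0 / A) \<le> (real k)\<^sup>2 / \<kappa>"
  proof -
    have "a0 / A \<le> 1 / \<kappa>" using p l1 by (simp add: a0_def field_simps power2_eq_square)
    then have "real k * (a0 / A) \<le> real k * (1 / \<kappa>)" by (intro mult_left_mono) auto
    then show ?thesis using kk by simp
  qed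
  \<comment> \<open>The largest \<open>y\<close>-scale is at most
    \<open>2 * \<rho> * \<kappa> ^ (5 * k + 3) / A\<close>; the exponent \<open>5 * k + 6\<close> in
    the hypothesis keeps it a factor of order \<open>\<kappa> ^ 3\<close> below
    \<open>B\<close>.\<close>
  have e3: "real k * (b0 * (\<kappa> ^ 5) ^ k / B) \<le> 2 * ((real k)\<^sup>2 / \<kappa>)"
  proof -
    have "b0 * (\<kappa> ^ 5) ^ k / B = m * \<kappa> ^ (5 * k + 2) / (A * B)"
      using p l1 by (simp add: b0_def a0_def power_mult[symmetric] power_add power2_eq_square field_simps)
    also have "\<dots> \<le> 2 * \<kappa> * \<rho> * \<kappa> ^ (5 * k + 2) / (A * B)"
      using m p l1 by (intro divide_right_mono mult_right_mono) auto
    also have "\<dots> = 2 * (\<rho> * \<kappa> ^ (5 * k + 3)) / (A * B)"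
      by (simp add: power_add eval_nat_numeral)
    also have "\<dots> \<le> 2 * (A * B / \<kappa> ^ 3) / (A * B)"
    proof (intro divide_right_mono mult_left_mono)
      have eq: "\<rho> * \<kappa> ^ (5 * k + 3) * \<kappa> ^ 3 = \<rho> * \<kappa> ^ (5 * k + 6)"
        by (simp add: power_add eval_nat_numeral)
      have "\<rho> * \<kappa> ^ (5 * k + 3) * \<kappa> ^ 3 \<le> A * B"
        unfolding eq by (rule c2)
      then show "\<rho> * \<kappa> ^ (5 * k + 3) \<le> A * B / \<kappa> ^ 3"
        using l1 by (simp add: pos_le_divide_eq)
    qed (use p in auto)
    also have "\<dots> = 2 / \<kappa> ^ 3" using p by simp
    also have "\<dots> \<le> 2 / \<kappa>" using l1 power_increasing[of 1 3 \<kappa>] by (intro divide_left_mono) auto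
    finally have "real k * (b0 * (\<kappa> ^ 5) ^ k / B) \<le> real k * (2 / \<kappa>)" by (intro mult_left_mono) auto
    also have "\<dots> = 2 * (real k / \<kappa>)" by simp
    also have "\<dots> \<le> 2 * ((real k)\<^sup>2 / \<kappa>)" using kk by (rule mult_left_mono) simp
    finally show ?thesis .
  qed
  define u where "u = (half_diff c m ^^ k) z"
  define w where "w = avg c (\<rho> / \<kappa>) (avg d R u)"
  have nD: "nonexp (half_diff c m ^^ k)" "(half_diff c m ^^ k) 0 = 0"
    using nonexp_funpow[OF nonexp_half_diff(1)] funpow_0_fix[where f = "half_diff c m", OF nonexp_half_diff(2)] by auto
  have nu: "norm u \<le> norm z" unfolding u_def by (rule nonexp_norm0[OF nD])
  have nw: "norm w \<le> norm z"
    unfolding w_def using nonexp_norm0[OF nonexp_avgs(3) avgs_0(3), of "\<rho>/\<kappa>" "avg d R u"]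
      nonexp_norm0[OF nonexp_avgs(4) avgs_0(4), of R u] nu by linarith
  have sm: "smooth c (\<rho> / \<kappa>) (norm z) w" "smooth d R (norm z) w"
    using S_smooth[of "\<rho> / \<kappa>" R u "norm z"] p l1 nu unfolding w_def S_def by auto
  have com: "(half_diff c m ^^ k) (avg c (\<rho> / \<kappa>) (avg d R v)) = avg c (\<rho> / \<kappa>) (avg d R ((half_diff c m ^^ k) v))" for v
  proof -
    have "S (\<rho> / \<kappa>) R (half_diff c m v) = half_diff c m (S (\<rho> / \<kappa>) R v)" for v
      by (rule half_sum_commute(2)[where f = "S (\<rho> / \<kappa>) R" and h = c, OF nonexp_S(3) S_commute(2)])
    from funpow_commute[where g = "S (\<rho> / \<kappa>) R" and f = "half_diff c m", OF this]
    show ?thesis unfolding S_def by metis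
  qed
  have start: "avg c (\<rho> / \<kappa>) (avg d R ((half_diff c m ^^ (2 * k)) z)) = (half_diff c m ^^ k) w"
    unfolding w_def com u_def by (simp add: mult_2 funpow_add)
  have e4: "norm ((S \<rho>2 R2 ^^ k) w - w) \<le> 4 * ((real k)\<^sup>2 / \<kappa>) * norm z"
  proof -
    have "norm ((S \<rho>2 R2 ^^ k) w - w) \<le> real k * ((2 * \<rho>2 / (\<rho> / \<kappa>) + 2 * R2 / R) * norm z)"
      using p l1 ps by (intro S_funpow_near sm) auto
    also have "2 * \<rho>2 / (\<rho> / \<kappa>) + 2 * R2 / R = 2 / \<kappa> + 2 / \<kappa>\<^sup>2"
      using p l1 by (simp add: \<rho>2_def R2_def power2_eq_square)
    also have "real k * ((2 / \<kappa> + 2 / \<kappa>\<^sup>2) * norm z) \<le> real k * ((4 / \<kappa>) * norm z)"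
      using l1 by (intro mult_left_mono mult_right_mono) (auto simp: field_simps power2_eq_square)
    also have "\<dots> = 4 * (real k / \<kappa>) * norm z" by simp
    also have "\<dots> \<le> 4 * ((real k)\<^sup>2 / \<kappa>) * norm z"
      using kk by (intro mult_right_mono mult_left_mono) auto
    finally show ?thesis .
  qed
  have "norm (avg x A (avg y B ((half_diff c m ^^ k) ((S \<rho>2 R2 ^^ k) w))) - avg x A (avg y B ((half_diff c m ^^ k) w))) \<le> 4 * ((real k)\<^sup>2 / \<kappa>) * norm z"
    by (intro nonexp_le[OF nonexp_avgs(1)] nonexp_le[OF nonexp_avgs(2)] nonexp_le[OF nD(1)] e4)
  moreover have "norm (avg x A (avg y B ((half_diff c m ^^ k) ((S \<rho>2 R2 ^^ k) w)))) \<le> (r ^ k + 15 * ((real k)\<^sup>2 / \<kappa>)) * norm z"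
  proof -
    have "norm (avg x A (avg y B ((K m \<rho>2 R2 ^^ k) w)))
        \<le> (r ^ k + real k * L.E + real k * (a0 / A) + real k * (b0 * (\<kappa> ^ 5) ^ k / B)) * norm w"
      using L.avg_block_bound[OF p(1,2), of w] unfolding mm .
    also have "\<dots> \<le> (r ^ k + 15 * ((real k)\<^sup>2 / \<kappa>)) * norm w"
      using e1 e2 e3 by (intro mult_right_mono) auto
    also have "\<dots> \<le> (r ^ k + 15 * ((real k)\<^sup>2 / \<kappa>)) * norm z"
      using nw L.r l1 by (intro mult_left_mono) auto
    finally show ?thesis unfolding K_funpow .
  qed
  ultimately have "norm (avg x A (avg y B ((half_diff c m ^^ k) w))) \<le> (r ^ k + 15 * ((real k)\<^sup>2 / \<kappa>)) * norm z + 4 * ((real k)\<^sup>2 / \<kappa>) * norm z"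
    using norm_triangle_ineq2[of "avg x A (avg y B ((half_diff c m ^^ k) w))" "avg x A (avg y B ((half_diff c m ^^ k) ((S \<rho>2 R2 ^^ k) w)))"]
    by (simp add: norm_minus_commute)
  \<comment> \<open>19 = 12 + 1 + 2 + 4: the swaps, the absorption of the half sums along
    \<open>x\<close> and along \<open>y\<close>, and the insertion of \<open>S\<close>.\<close>
  also have "\<dots> = (r ^ k + 19 * (real k)\<^sup>2 / \<kappa>) * norm z"
    by (simp add: algebra_simps)
  finally show ?thesis unfolding start .
qed

end

text \<open>The cost of one scale step. \<open>2 * k\<close> inverts the central binomial weight,
  \<open>r ^ k\<close> is the gain of a block, and 21 = 19 + 1 + 1 adds to the error of
  \<open>osc_bound\<close> those of the off-centre terms and of comparing two consecutive
  averages.\<close>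

definition \<theta> :: "nat \<Rightarrow> real \<Rightarrow> real" where
  "\<theta> k r = 2 * real k * (r ^ k + 21 * (real k)\<^sup>2 / 2 ^ k)"

context heis
begin

abbreviation (input) "xl \<equiv> \<lambda>t. linear_part (x t)"
abbreviation (input) "yl \<equiv> \<lambda>t. linear_part (y t)"
abbreviation (input) "cl \<equiv> \<lambda>t. linear_part (c t)"
abbreviation (input) "dl \<equiv> \<lambda>t. linear_part (d t)"

text \<open>The binomial expansion of \<open>((1 - c m) / 2) ^ (2 * k)\<close> has central coefficient at least \<open>1 / (2 * k)\<close>;
  averaging over \<open>m\<close> makes all its other terms negligible on the vectors \<open>w - avg c \<rho> w\<close>.\<close>

lemma scale_bound:
  fixes w0 :: 'a
  assumes g: "gain_const TYPE('a) r" and k: "k \<ge> 7" and l: "\<kappa> = 2 ^ k"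
    and p: "A > 0" "B > 0" "R > 0" "\<rho> > 0"
    and c1: "A * \<rho> * \<kappa>\<^sup>2 \<le> R" and c2: "\<rho> * \<kappa> ^ (5 * k + 6) \<le> A * B"
    and D: "\<And>t. \<bar>t\<bar> \<le> \<kappa> ^ 3 * \<rho> \<Longrightarrow> norm (c t w0 - w0) \<le> D"
  shows "norm (avg x A (avg y B (avg c (\<rho> / \<kappa>) (avg d R w0))) - avg x A (avg y B (avg c (\<rho> / \<kappa>) (avg d R (avg c \<rho> w0)))))
    \<le> 2 * real k * (r ^ k + 20 * (real k)\<^sup>2 / \<kappa>) * D"
proof -
  interpret L: lheis xl yl cl dl q by (rule lheis_linear_part)
  have l1: "\<kappa> \<ge> 128" using power_increasing[OF k, of "2::real"] l by simp
  have kl: "real k \<le> \<kappa>" using l less_exp[of k] by (metis of_nat_less_iff less_imp_le of_nat_power of_nat_numeral)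
  have D0: "0 \<le> D" using D[of 0] p l1 order_trans[OF norm_ge_zero] by fastforce
  have r0: "0 \<le> r" using g by (simp add: gain_const_def)
  define v0 where "v0 = w0 - avg c \<rho> w0"
  define Op where "Op v = avg xl A (avg yl B (avg cl (\<rho> / \<kappa>) (avg dl R v)))" for v
  \<comment> \<open>The steps \<open>m t\<close> run through the interval from \<open>S\<close> to
    \<open>2 * S\<close>. Averaging over them turns each non-central term of the expansion into an
    average over a segment at least \<kappa> times longer than \<rho>.\<close>
  define S where "S = \<kappa> * \<rho>"
  define m where "m t = S * (1 + t)" for t :: real
  have S: "S > 0" using p l1 by (simp add: S_def)
  have nOp: "nonexp Op"
    unfolding Op_def[abs_def]
    by (rule nonexp_compose[OF L.nonexp_avgs(1) nonexp_compose[OF L.nonexp_avgs(2) nonexp_compose[OF L.nonexp_avgs(3) L.nonexp_avgs(4)]]])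
  have Op0: "Op 0 = 0" by (simp add: Op_def L.avgs_0)
  have lOp: "linear Op" using nonexp_linear_iff[of Op] nOp Op0 by simp
  have lhs: "avg x A (avg y B (avg c (\<rho> / \<kappa>) (avg d R w0))) - avg x A (avg y B (avg c (\<rho> / \<kappa>) (avg d R (avg c \<rho> w0)))) = Op v0"
    by (simp add: avg_diff[OF isom_flow(1)] avg_diff[OF isom_flow(2)] avg_diff[OF isom_flow(3)] avg_diff[OF isom_flow(4)] Op_def v0_def)
  have v0: "norm v0 \<le> D"
  proof -
    have "norm (avg c \<rho> w0 - w0) \<le> D"
    proof (rule avg_near[OF isom_flow(3)])
      fix t :: real assume t: "0 \<le> t" "t \<le> 1"
      have "\<bar>\<rho> * t\<bar> \<le> \<rho>" using t p by (simp add: abs_mult mult_left_le)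
      also have "\<rho> \<le> \<kappa> ^ 3 * \<rho>" using l1 p by simp
      finally show "norm (c (\<rho> * t) w0 - w0) \<le> D" by (rule D)
    qed
    then show ?thesis by (simp add: v0_def norm_minus_commute)
  qed
  define co where "co j = (-1) ^ j * real ((2 * k) choose j) / 2 ^ (2 * k)" for j
  \<comment> \<open>Starting the expansion at this translate makes its middle term \<open>v0\<close>
    itself.\<close>
  define z where "z t = cl (- (real k * m t)) v0" for t
  define G where "G t = Op ((half_diff cl (m t) ^^ (2 * k)) (z t))" for t
  have Gsum: "G t = (\<Sum>j\<le>2*k. co j *\<^sub>R Op (cl ((real j - real k) * m t) v0))" for t
  proof -
    have "cl (real j * m t) (z t) = cl ((real j - real k) * m t) v0" for j
      unfolding z_def using isom_flowD(3)[OF L.isom_flow(3), of "real j * m t" "- (real k * m t)" v0]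
      by (simp add: left_diff_distrib)
    then show ?thesis
      unfolding G_def L.half_diff_funpow
      by (simp add: linear_scale[OF lOp] linear_sum[OF lOp] co_def scaleR_sum_right)
  qed
  have Geq: "G = (\<lambda>t. \<Sum>j\<le>2*k. co j *\<^sub>R Op (cl ((real j - real k) * m t) v0))"
    by (rule ext) (rule Gsum)
  have Gb: "norm (G t) \<le> (r ^ k + 19 * (real k)\<^sup>2 / \<kappa>) * D" if t: "0 \<le> t" "t \<le> 1" for t
  proof -
    have "norm (G t) \<le> (r ^ k + 19 * (real k)\<^sup>2 / \<kappa>) * norm (z t)"
      unfolding G_def Op_def
    proof (rule L.osc_bound[OF g k l p c1 c2])
      show "0 < m t" using S t by (simp add: m_def)
      have "m t \<le> S * 2" using S t by (simp add: m_def)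
      then show "m t \<le> 2 * \<kappa> * \<rho>" by (simp add: S_def)
    qed
    also have "norm (z t) \<le> D" unfolding z_def L.isom by (rule v0)
    then have "(r ^ k + 19 * (real k)\<^sup>2 / \<kappa>) * norm (z t) \<le> (r ^ k + 19 * (real k)\<^sup>2 / \<kappa>) * D"
      using r0 l1 by (intro mult_left_mono) auto
    finally show ?thesis .
  qed
  have cont: "continuous_on {0..1} (\<lambda>t. cl ((real j - real k) * m t) v0)" for j
    unfolding m_def by (intro isom_flow_cont[OF L.isom_flow(3)] continuous_intros)
  have contO: "continuous_on {0..1} (\<lambda>t. Op (cl ((real j - real k) * m t) v0))" for j
    by (rule continuous_on_compose2[OF nonexp_cont[OF nOp] cont subset_UNIV])
  define I where "I j = integral {0..1} (\<lambda>t. Op (cl ((real j - real k) * m t) v0))" for j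
  have int: "integral {0..1} G = (\<Sum>j\<le>2*k. co j *\<^sub>R I j)"
  proof -
    have "integral {0..1} G = integral {0..1} (\<lambda>t. \<Sum>j\<le>2*k. co j *\<^sub>R Op (cl ((real j - real k) * m t) v0))"
      unfolding Geq ..
    also have "\<dots> = (\<Sum>j\<le>2*k. integral {0..1} (\<lambda>t. co j *\<^sub>R Op (cl ((real j - real k) * m t) v0)))"
      by (intro Henstock_Kurzweil_Integration.integral_sum integrable_continuous_real continuous_intros contO) simp
    finally show ?thesis by (simp add: I_def)
  qed
  have Ik: "I k = Op v0"
    by (simp add: I_def isom_flowD(2)[OF L.isom_flow(3)])
  \<comment> \<open>An average over length at least \<open>\<kappa> * \<rho>\<close> can hardly tell
    \<open>w0\<close> from its average over length \<rho>; by \<open>avg_shift\<close> the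
    difference is at most \<open>D / \<kappa>\<close>.\<close>
  have Ij: "norm (I j) \<le> D / \<kappa>" if j: "j \<le> 2 * k" "j \<noteq> k" for j
  proof -
    define i where "i = real j - real k"
    have i: "1 \<le> \<bar>i\<bar>" "\<bar>i\<bar> \<le> \<kappa>" using j kl by (auto simp: i_def)
    have iS: "i * S \<noteq> 0" using i S by auto
    have "I j = Op (integral {0..1} (\<lambda>t. cl (i * m t) v0))"
      unfolding I_def i_def by (rule nonexp_integral[OF nOp cont, symmetric])
    also have "integral {0..1} (\<lambda>t. cl (i * m t) v0) = integral {0..1} (\<lambda>t. cl (i * S) (cl (i * S * t) v0))"
      by (simp add: m_def distrib_left mult.assoc isom_flowD(3)[OF L.isom_flow(3)])
    also have "\<dots> = cl (i * S) (avg cl (i * S) v0)"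
      unfolding avg_def by (rule nonexp_integral[OF L.nonexp(3) avg_cont[OF L.isom_flow(3)], symmetric])
    finally have "norm (I j) \<le> norm (avg cl (i * S) v0)"
      using nonexp_norm0[OF nOp Op0] L.isom(3) by metis
    also have "avg cl (i * S) v0 = avg c (i * S) w0 - avg c (i * S) (avg c \<rho> w0)"
      unfolding v0_def by (rule avg_diff[OF isom_flow(3), symmetric])
    also have "norm (avg c (i * S) w0 - avg c (i * S) (avg c \<rho> w0)) = norm (avg c (i * S) (avg c \<rho> w0) - avg c (i * S) w0)"
      by (rule norm_minus_commute)
    also have "\<dots> \<le> D / \<kappa>"
    proof (rule avg_near1[where f = "avg c (i * S)", OF isom_flow(3) nonexp_avg[OF isom_flow(3)]])
      fix t :: real assume t: "0 \<le> t" "t \<le> 1"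
      have "norm (avg c (i * S) (c (\<rho> * t) w0) - avg c (i * S) w0) \<le> \<bar>\<rho> * t\<bar> / \<bar>i * S\<bar> * norm (c (i * S) w0 - w0)"
        by (rule avg_shift[OF isom_flow(3) iS])
      also have "\<dots> \<le> (1 / \<kappa>) * D"
      proof (rule mult_mono)
        have "\<bar>\<rho> * t\<bar> / \<bar>i * S\<bar> \<le> \<rho> / (1 * S)"
          using t p i S by (intro frac_le) (auto simp: abs_mult mult_left_le intro!: mult_right_mono)
        also have "\<dots> = 1 / \<kappa>" using p by (simp add: S_def)
        finally show "\<bar>\<rho> * t\<bar> / \<bar>i * S\<bar> \<le> 1 / \<kappa>" .
        have "\<bar>i * S\<bar> \<le> \<kappa> * S" using i S by (simp add: abs_mult)
        also have "\<dots> \<le> \<kappa> ^ 3 * \<rho>"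
          using l1 p by (simp add: S_def eval_nat_numeral mult.assoc)
        finally show "norm (c (i * S) w0 - w0) \<le> D" by (rule D)
      qed (use l1 in auto)
      finally show "norm (avg c (i * S) (c (\<rho> * t) w0) - avg c (i * S) w0) \<le> D / \<kappa>" by simp
    qed
    finally show ?thesis .
  qed
  have sumco: "(\<Sum>j\<le>2*k. \<bar>co j\<bar>) = 1"
  proof -
    have "(\<Sum>j\<le>2*k. \<bar>co j\<bar>) = real (\<Sum>j\<le>2*k. (2*k) choose j) / 2 ^ (2 * k)"
      by (simp add: co_def abs_mult sum_divide_distrib)
    then show ?thesis unfolding choose_row_sum by simp
  qed
  have cok: "1 / (2 * real k) \<le> \<bar>co k\<bar>"
  proof -
    have "4 ^ k / (2 * real k) \<le> real ((2 * k) choose k)"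
      using central_binomial_lower_bound[of k] k by simp
    then have "4 ^ k / (2 * real k) / 4 ^ k \<le> real ((2 * k) choose k) / 4 ^ k"
      by (intro divide_right_mono) auto
    then show ?thesis by (simp add: co_def abs_mult power_mult)
  qed
  have "co k *\<^sub>R Op v0 = integral {0..1} G - (\<Sum>j\<in>{..2*k} - {k}. co j *\<^sub>R I j)"
    unfolding int using sum.remove[of "{..2*k}" k "\<lambda>j. co j *\<^sub>R I j"] by (simp add: Ik)
  then have "\<bar>co k\<bar> * norm (Op v0) = norm (integral {0..1} G - (\<Sum>j\<in>{..2*k} - {k}. co j *\<^sub>R I j))"
    by (metis norm_scaleR)
  also have "\<dots> \<le> (r ^ k + 19 * (real k)\<^sup>2 / \<kappa>) * D + D / \<kappa>"
  proof (rule norm_triangle_le_diff, rule add_mono)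
    show "norm (integral {0..1} G) \<le> (r ^ k + 19 * (real k)\<^sup>2 / \<kappa>) * D"
    proof (rule norm_integral_le[OF _ Gb])
      show "continuous_on {0..1} G"
        unfolding Geq by (intro continuous_intros contO)
    qed
    have "norm (\<Sum>j\<in>{..2*k} - {k}. co j *\<^sub>R I j) \<le> (\<Sum>j\<in>{..2*k} - {k}. \<bar>co j\<bar> * (D / \<kappa>))"
    proof (rule sum_norm_le)
      fix j assume "j \<in> {..2*k} - {k}"
      then have "\<bar>co j\<bar> * norm (I j) \<le> \<bar>co j\<bar> * (D / \<kappa>)"
        by (intro mult_left_mono Ij) auto
      then show "norm (co j *\<^sub>R I j) \<le> \<bar>co j\<bar> * (D / \<kappa>)" by simp
    qed
    also have "\<dots> \<le> (\<Sum>j\<le>2*k. \<bar>co j\<bar> * (D / \<kappa>))"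
      using D0 l1 by (intro sum_mono2) auto
    also have "\<dots> = D / \<kappa>" unfolding sum_distrib_right[symmetric] sumco by simp
    finally show "norm (\<Sum>j\<in>{..2*k} - {k}. co j *\<^sub>R I j) \<le> D / \<kappa>" .
  qed
  also have "\<dots> = (r ^ k + 19 * (real k)\<^sup>2 / \<kappa> + 1 / \<kappa>) * D"
    by (simp add: distrib_right)
  also have "\<dots> \<le> (r ^ k + 20 * (real k)\<^sup>2 / \<kappa>) * D"
  proof (rule mult_right_mono[OF _ D0])
    have "1 / \<kappa> \<le> (real k)\<^sup>2 / \<kappa>" using k l1 by (intro divide_right_mono) (auto simp: one_le_power)
    then show "r ^ k + 19 * (real k)\<^sup>2 / \<kappa> + 1 / \<kappa> \<le> r ^ k + 20 * (real k)\<^sup>2 / \<kappa>" by simp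
  qed
  finally have fin: "\<bar>co k\<bar> * norm (Op v0) \<le> (r ^ k + 20 * (real k)\<^sup>2 / \<kappa>) * D" .
  have "1 / (2 * real k) * norm (Op v0) \<le> (r ^ k + 20 * (real k)\<^sup>2 / \<kappa>) * D"
    using mult_right_mono[OF cok norm_ge_zero[of "Op v0"]] fin by linarith
  then have "norm (Op v0) \<le> 2 * real k * ((r ^ k + 20 * (real k)\<^sup>2 / \<kappa>) * D)"
    using k by (simp add: field_simps)
  then show ?thesis unfolding lhs by (simp add: mult.assoc)
qed

text \<open>Telescoping over the scales \<rho>, \<rho>/\<kappa>, and so on: each of the
  \<open>P\<close> steps costs \<open>\<theta> k r * D\<close>, and at the finest scale averaging
  over \<open>c\<close> moves the vector by at most \<eta>.\<close>

lemma heis_bound: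
  fixes w0 :: 'a
  assumes g: "gain_const TYPE('a) r" and k: "k \<ge> 7" and l: "\<kappa> = 2 ^ k"
    and p: "A > 0" "B > 0" "R > 0" "\<rho> > 0"
    and c1: "A * \<rho> * \<kappa>\<^sup>2 \<le> R" and c2: "\<rho> * \<kappa> ^ (5 * k + 6) \<le> A * B"
    and D: "\<And>t. \<bar>t\<bar> \<le> \<kappa> ^ 3 * \<rho> \<Longrightarrow> norm (c t w0 - w0) \<le> D"
    and \<eta>: "\<And>t. \<bar>t\<bar> \<le> \<rho> / \<kappa> ^ P \<Longrightarrow> norm (c t w0 - w0) \<le> \<eta>"
  shows "norm (avg x A (avg y B (avg d R w0)) - avg x A (avg y B (avg c \<rho> (avg d R w0)))) \<le> real P * (\<theta> k r * D) + \<eta>"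
  using p(4) c1 c2 D \<eta>
proof (induction P arbitrary: \<rho>)
  case 0
  have "norm (avg c \<rho> (avg d R w0) - avg d R w0) \<le> \<eta>"
  proof (rule avg_near[OF isom_flow(3)])
    fix t :: real assume t: "0 \<le> t" "t \<le> 1"
    have "c (\<rho> * t) (avg d R w0) - avg d R w0 = avg d R (c (\<rho> * t) w0) - avg d R w0"
      by (simp add: commuting_avg(1)[OF isom_flow(3,4) comm(3)])
    also have "norm \<dots> \<le> \<eta>"
      using t 0 by (intro nonexp_le[OF nonexp_avg[OF isom_flow(4)]] 0(5)) (auto simp: abs_mult mult_left_le)
    finally show "norm (c (\<rho> * t) (avg d R w0) - avg d R w0) \<le> \<eta>" .
  qed
  then have "norm (avg x A (avg y B (avg c \<rho> (avg d R w0))) - avg x A (avg y B (avg d R w0))) \<le> \<eta>"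
    by (intro nonexp_le[OF nonexp_avg[OF isom_flow(1)]] nonexp_le[OF nonexp_avg[OF isom_flow(2)]])
  then show ?case by (simp add: norm_minus_commute)
next
  case (Suc P)
  have l1: "\<kappa> \<ge> 128" using power_increasing[OF k, of "2::real"] l by simp
  have D0: "0 \<le> D" using Suc.prems(4)[of 0] Suc.prems(1) l1 order_trans[OF norm_ge_zero] by fastforce
  let ?\<rho> = "\<rho> / \<kappa>"
  let ?F = "\<lambda>w. avg x A (avg y B w)"
  have le: "?\<rho> \<le> \<rho>" using Suc.prems(1) l1 by (simp add: divide_le_eq)
  have 3: "norm (?F (avg d R w0) - ?F (avg c ?\<rho> (avg d R w0))) \<le> real P * (\<theta> k r * D) + \<eta>"
  proof (rule Suc.IH)
    have "A * ?\<rho> * \<kappa>\<^sup>2 \<le> A * \<rho> * \<kappa>\<^sup>2"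
      using le p by (intro mult_right_mono mult_left_mono) auto
    then show "A * ?\<rho> * \<kappa>\<^sup>2 \<le> R" using Suc.prems by linarith
    have "?\<rho> * \<kappa> ^ (5 * k + 6) \<le> \<rho> * \<kappa> ^ (5 * k + 6)"
      using le l1 by (intro mult_right_mono) auto
    then show "?\<rho> * \<kappa> ^ (5 * k + 6) \<le> A * B" using Suc.prems by linarith
    have "\<kappa> ^ 3 * ?\<rho> \<le> \<kappa> ^ 3 * \<rho>" using le l1 by (intro mult_left_mono) auto
    then show "norm (c t w0 - w0) \<le> D" if "\<bar>t\<bar> \<le> \<kappa> ^ 3 * ?\<rho>" for t
      using Suc.prems(4) that by force
    show "norm (c t w0 - w0) \<le> \<eta>" if "\<bar>t\<bar> \<le> ?\<rho> / \<kappa> ^ P" for t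
      using Suc.prems(5)[of t] that by simp
  qed (use Suc.prems l1 in auto)
  have 4: "norm (?F (avg c ?\<rho> (avg d R w0)) - ?F (avg c \<rho> (avg d R w0))) \<le> \<theta> k r * D"
  proof -
    have sw: "avg d R (avg c \<rho> w0) = avg c \<rho> (avg d R w0)"
      by (rule commuting_avg(3)[OF isom_flow(3,4) comm(3), symmetric])
    \<comment> \<open>The average at the finer scale is almost absorbed by the one at the coarser
      scale. So the two are compared through their composition, which is what
      \<open>scale_bound\<close> controls.\<close>
    have "norm (avg c ?\<rho> (avg c \<rho> (avg d R w0)) - avg c \<rho> (avg d R w0)) \<le> D / \<kappa>"
    proof (rule avg_near[OF isom_flow(3)])
      fix t :: real assume t: "0 \<le> t" "t \<le> 1"
      have "norm (c (?\<rho> * t) (avg c \<rho> (avg d R w0)) - avg c \<rho> (avg d R w0)) = norm (avg d R (c (?\<rho> * t) (avg c \<rho> w0)) - avg d R (avg c \<rho> w0))"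
        by (simp only: commuting_avg(1)[OF isom_flow(3,4) comm(3), symmetric] sw)
      also have "\<dots> \<le> norm (c (?\<rho> * t) (avg c \<rho> w0) - avg c \<rho> w0)"
        by (rule nonexp_norm[OF nonexp_avg[OF isom_flow(4)]])
      also have "\<dots> \<le> \<bar>?\<rho> * t\<bar> / \<bar>\<rho>\<bar> * norm (c \<rho> w0 - w0)"
        using Suc.prems(1) by (intro avg_shift_left isom_flow) auto
      also have "\<dots> \<le> (1 / \<kappa>) * D"
      proof (rule mult_mono)
        show "\<bar>?\<rho> * t\<bar> / \<bar>\<rho>\<bar> \<le> 1 / \<kappa>"
          using t Suc.prems(1) l1 by (simp add: abs_mult divide_right_mono)
        show "norm (c \<rho> w0 - w0) \<le> D"
          using Suc.prems(1) l1 by (intro Suc.prems(4)) auto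
      qed (use l1 in auto)
      finally show "norm (c (?\<rho> * t) (avg c \<rho> (avg d R w0)) - avg c \<rho> (avg d R w0)) \<le> D / \<kappa>" by simp
    qed
    then have 1: "norm (?F (avg c ?\<rho> (avg c \<rho> (avg d R w0))) - ?F (avg c \<rho> (avg d R w0))) \<le> D / \<kappa>"
      by (intro nonexp_le[OF nonexp_avg[OF isom_flow(1)]] nonexp_le[OF nonexp_avg[OF isom_flow(2)]])
    have 2: "norm (?F (avg c ?\<rho> (avg d R w0)) - ?F (avg c ?\<rho> (avg c \<rho> (avg d R w0)))) \<le> 2 * real k * (r ^ k + 20 * (real k)\<^sup>2 / \<kappa>) * D"
      using scale_bound[OF g k l p(1-3) Suc.prems(1-4)] by (simp only: sw)
    have "2 * real k * (r ^ k + 20 * (real k)\<^sup>2 / \<kappa>) * D + D / \<kappa> \<le> \<theta> k r * D"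
    proof -
      have "1 / \<kappa> \<le> 2 * real k * ((real k)\<^sup>2 / \<kappa>)"
      proof -
        have "1 * 1 \<le> (2 * real k) * (real k)\<^sup>2" using k by (intro mult_mono) (auto simp: one_le_power)
        then have "1 / \<kappa> \<le> (2 * real k) * (real k)\<^sup>2 / \<kappa>" using l1 by (intro divide_right_mono) auto
        then show ?thesis by simp
      qed
      then have "2 * real k * (r ^ k + 20 * (real k)\<^sup>2 / \<kappa>) + 1 / \<kappa> \<le> \<theta> k r"
      proof -
        have "\<theta> k r = 2 * real k * (r ^ k + 20 * (real k)\<^sup>2 / \<kappa>) + 2 * real k * ((real k)\<^sup>2 / \<kappa>)"
          by (simp add: \<theta>_def l algebra_simps add_divide_distrib)
        then show ?thesis using \<open>1 / \<kappa> \<le> _\<close> by simp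
      qed
      from mult_right_mono[OF this D0] show ?thesis by (simp add: distrib_right)
    qed
    with norm_chain3[OF 2 1] show ?thesis by linarith
  qed
  from norm_chain3[OF 3 4] show ?case
    by (simp add: distrib_right)
qed

end

lemma avg_id: "avg (\<lambda>t v. v) A v = v"
  by (simp add: avg_def)

lemma avg_dist:
  assumes h: "isom_flow h" and D: "\<And>t. \<bar>t\<bar> \<le> M \<Longrightarrow> norm (h t w - w) \<le> D"
    and s: "\<bar>s\<bar> \<le> M" and v: "norm (v - w) \<le> n"
  shows "norm (avg h s v - w) \<le> n + D"
proof (rule avg_near[OF h])
  fix t :: real assume t: "0 \<le> t" "t \<le> 1"
  then have "\<bar>s * t\<bar> \<le> M" using s mult_left_le[of t "\<bar>s\<bar>"] by (simp add: abs_mult)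
  from norm_chain3[OF nonexp_le[OF isom_flowD(1)[OF h] v] D[OF this]]
  show "norm (h (s * t) v - w) \<le> n + D" .
qed

lemma disp_dist:
  assumes h: "isom_flow h" and "norm (h t w - w) \<le> D" and v: "norm (v - w) \<le> n"
  shows "norm (h t v - v) \<le> 2 * n + D"
proof -
  have "norm (h t v - w) \<le> n + D"
    by (rule norm_chain3[OF nonexp_le[OF isom_flowD(1)[OF h] v] assms(2)])
  moreover have "norm (w - v) \<le> n" using v by (simp add: norm_minus_commute)
  ultimately have "norm (h t v - v) \<le> n + D + n" by (rule norm_chain3)
  then show ?thesis by simp
qed

lemma commuting_disp:
  assumes "nonexp f" "f (h t v) = h t (f v)" "norm (h t v - v) \<le> D"
  shows "norm (h t (f v) - f v) \<le> D"
  using nonexp_le[OF assms(1,3)] by (simp add: assms(2))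

lemma avg_small_disp:
  assumes h: "isom_flow h" and D: "norm (h s v - v) \<le> D" and s: "s > 0" and t: "\<bar>t\<bar> \<le> \<epsilon> * s"
  shows "norm (h t (avg h s v) - avg h s v) \<le> \<epsilon> * D" "norm (avg h s (h t v) - avg h s v) \<le> \<epsilon> * D"
proof -
  have e: "\<bar>t\<bar> / \<bar>s\<bar> \<le> \<epsilon>" using s t by (simp add: pos_divide_le_eq)
  have "0 \<le> \<bar>t\<bar> / \<bar>s\<bar>" by simp
  with e have "0 \<le> \<epsilon>" by linarith
  then have "\<bar>t\<bar> / \<bar>s\<bar> * norm (h s v - v) \<le> \<epsilon> * D"
    using e D by (intro mult_mono) auto
  then show "norm (h t (avg h s v) - avg h s v) \<le> \<epsilon> * D" "norm (avg h s (h t v) - avg h s v) \<le> \<epsilon> * D"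
    using avg_shift_left[OF h, of s t v] avg_shift[OF h, of s t v] s by auto
qed

lemma avg_avg_near:
  assumes h: "isom_flow h" and D: "norm (h A v - v) \<le> D" and A: "A > 0" and a: "0 \<le> a" "a \<le> \<epsilon> * A"
  shows "norm (avg h A (avg h a v) - avg h A v) \<le> \<epsilon> * D"
proof (rule avg_near1[where f = "avg h A", OF h nonexp_avg[OF h]])
  fix t :: real assume t: "0 \<le> t" "t \<le> 1"
  have "a * t \<le> a" using t a by (simp add: mult_left_le)
  then show "norm (avg h A (h (a * t) v) - avg h A v) \<le> \<epsilon> * D"
    using a t by (intro avg_small_disp[OF h D A]) (simp add: abs_mult)
qed

lemma \<theta>_ge: "0 \<le> r \<Longrightarrow> 1 \<le> k \<Longrightarrow> 1 / 2 ^ k \<le> \<theta> k r"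
proof -
  assume r: "0 \<le> r" and k: "1 \<le> k"
  have "1 * 1 \<le> (42 * real k) * (real k)\<^sup>2" using k by (intro mult_mono) (auto simp: one_le_power)
  then have "1 / 2 ^ k \<le> (42 * real k) * (real k)\<^sup>2 / 2 ^ k" by (intro divide_right_mono) auto
  also have "\<dots> \<le> \<theta> k r" using r by (simp add: \<theta>_def algebra_simps)
  finally show ?thesis .
qed

section \<open>Commuting averages over long segments\<close>

text \<open>\<open>D\<close> controls displacements up to the large parameter \<open>M\<close>, and
  \<eta> those up to the small parameter \<tau>; \<open>P\<close> steps of ratio \<kappa> bridge the
  gap. A single factor \<Lambda> exceeds \<open>\<kappa> ^ (5 * k + 6)\<close> and thus separates
  lengths as much as \<open>heis_bound\<close> demands.\<close>

locale heis_scale = heis +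
  fixes r :: real and k P :: nat and \<kappa> \<Lambda> A B :: real and w :: 'a and D \<eta> M \<tau> :: real
  assumes g: "gain_const TYPE('a) r" and k: "k \<ge> 7" and \<kappa>: "\<kappa> = 2 ^ k" and \<Lambda>: "\<Lambda> = \<kappa> ^ (6 * k)"
    and AB: "A > 0" "B > 0" and P: "P \<ge> 1"
    and M: "A \<le> M" "B \<le> M" "A * B \<le> M" "A\<^sup>2 * B \<le> M"
    and \<tau>: "A * B \<le> \<tau> * \<kappa> ^ P" "A\<^sup>2 * B \<le> \<tau> * \<kappa> ^ P"
    and D: "\<And>t. \<bar>t\<bar> \<le> M \<Longrightarrow> norm (x t w - w) \<le> D" "\<And>t. \<bar>t\<bar> \<le> M \<Longrightarrow> norm (y t w - w) \<le> D"
      "\<And>t. \<bar>t\<bar> \<le> M \<Longrightarrow> norm (c t w - w) \<le> D" "\<And>t. \<bar>t\<bar> \<le> M \<Longrightarrow> norm (d t w - w) \<le> D"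
    and \<eta>: "\<And>t. \<bar>t\<bar> \<le> \<tau> \<Longrightarrow> norm (c t w - w) \<le> \<eta>" "\<And>t. \<bar>t\<bar> \<le> \<tau> \<Longrightarrow> norm (d t w - w) \<le> \<eta>"
begin

lemma \<kappa>_ge: "\<kappa> \<ge> 128"
  using power_increasing[OF k, of "2::real"] \<kappa> by simp

lemma \<Lambda>_ge: "\<kappa> ^ (5 * k + 6) \<le> \<Lambda>" "\<kappa> ^ 3 \<le> \<Lambda>" "1 \<le> \<Lambda>" "\<kappa> \<le> \<Lambda>" "\<Lambda> > 0"
proof -
  show "\<kappa> ^ (5 * k + 6) \<le> \<Lambda>" "\<kappa> ^ 3 \<le> \<Lambda>"
    unfolding \<Lambda> using \<kappa>_ge k by (auto intro!: power_increasing)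
  have "\<kappa> ^ 1 \<le> \<Lambda>" unfolding \<Lambda> using \<kappa>_ge k by (intro power_increasing) auto
  then show "\<kappa> \<le> \<Lambda>" "1 \<le> \<Lambda>" "\<Lambda> > 0" using \<kappa>_ge by auto
qed

lemma nonneg: "0 \<le> D" "0 \<le> \<eta>" "0 < M" "0 < \<tau>" "0 \<le> r" "0 \<le> \<theta> k r" "1 / \<kappa> \<le> \<theta> k r"
proof -
  show M0: "0 < M" using M AB by linarith
  show "0 \<le> D" using D(1)[of 0] M0 order_trans[OF norm_ge_zero] by auto
  have "0 < \<tau> * \<kappa> ^ P" using \<tau>(1) AB by (meson less_le_trans mult_pos_pos)
  then show t0: "0 < \<tau>" using \<kappa>_ge zero_less_mult_pos2[of \<tau> "\<kappa> ^ P"] by auto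
  show "0 \<le> \<eta>" using \<eta>(1)[of 0] t0 order_trans[OF norm_ge_zero] by auto
  show r0: "0 \<le> r" using g by (simp add: gain_const_def)
  show "1 / \<kappa> \<le> \<theta> k r" unfolding \<kappa> using k by (intro \<theta>_ge r0) auto
  moreover have "0 \<le> 1 / \<kappa>" using \<kappa>_ge by simp
  ultimately show "0 \<le> \<theta> k r" by linarith
qed

lemma near:
  assumes "norm (v - w) \<le> n" "0 \<le> s" "s \<le> M"
  shows "norm (avg x s v - w) \<le> n + D" "norm (avg y s v - w) \<le> n + D"
    "norm (avg c s v - w) \<le> n + D" "norm (avg d s v - w) \<le> n + D"
  using avg_dist[OF isom_flow(1), of M w D s v n] avg_dist[OF isom_flow(2), of M w D s v n]
    avg_dist[OF isom_flow(3), of M w D s v n] avg_dist[OF isom_flow(4), of M w D s v n] D assms by simp_all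

lemma nonexp': "nonexp (x t)" "nonexp (y t)" "nonexp (c t)" "nonexp (d t)" "nonexp (avg x t)" "nonexp (avg y t)" "nonexp (avg c t)" "nonexp (avg d t)"
  by (auto intro!: isom_flowD(1) nonexp_avg isom_flow)

lemmas avg_comm = commuting_avg[OF isom_flow(2,3) comm(1)] commuting_avg[OF isom_flow(2,4) comm(2)] commuting_avg[OF isom_flow(3,4) comm(3)]
  commuting_avg[OF isom_flow(1,4) comm(4)]

text \<open>\<open>heis_bound\<close> is applied with the short \<open>x\<close>-length
  \<open>A1\<close>, against which \<open>c\<close> is almost central. The extra average over
  \<open>A1\<close> is then absorbed by the one over \<open>A\<close>, on either side at the price
  of a displacement of at most \<open>9 * D\<close>, divided by \<kappa>.\<close>

lemma insert_c:
  assumes u: "norm (u - w) \<le> D" and cu: "\<And>t. norm (c t u - u) \<le> norm (c t w - w)"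
    and A1: "0 < A1" "A1 \<le> (1 / \<kappa>) * A" and R: "R > 0" "R \<le> M" and e: "0 < e" "e \<le> M" "e \<le> \<tau> * \<kappa> ^ P" "\<kappa> ^ 3 * e \<le> M"
    and c1: "A1 * e * \<kappa>\<^sup>2 \<le> R" and c2: "e * \<Lambda> \<le> A1 * B"
  shows "norm (avg x A (avg y B (avg d R u)) - avg x A (avg y B (avg c e (avg d R u)))) \<le> real P * (\<theta> k r * D) + \<eta> + 18 * (\<theta> k r * D)"
proof -
  let ?v = "avg y B (avg d R u)" and ?v' = "avg y B (avg c e (avg d R u))"
  have "norm (avg x A1 ?v - avg x A1 ?v') \<le> real P * (\<theta> k r * D) + \<eta>"
  proof (rule heis_bound[OF g k \<kappa> A1(1) AB(2) R(1) e(1) c1])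
    have "e * \<kappa> ^ (5 * k + 6) \<le> e * \<Lambda>" using e \<Lambda>_ge by (intro mult_left_mono) auto
    with c2 show "e * \<kappa> ^ (5 * k + 6) \<le> A1 * B" by linarith
    show "norm (c t u - u) \<le> D" if "\<bar>t\<bar> \<le> \<kappa> ^ 3 * e" for t
      using cu[of t] D(3)[of t] that e by linarith
    show "norm (c t u - u) \<le> \<eta>" if "\<bar>t\<bar> \<le> e / \<kappa> ^ P" for t
    proof -
      have "e / \<kappa> ^ P \<le> \<tau>" using e \<kappa>_ge by (simp add: divide_le_eq)
      then show ?thesis using cu[of t] \<eta>(1)[of t] that by linarith
    qed
  qed
  then have 1: "norm (avg x A (avg x A1 ?v) - avg x A (avg x A1 ?v')) \<le> real P * (\<theta> k r * D) + \<eta>"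
    by (rule nonexp_le[OF nonexp'(5)])
  have M0: "A \<le> M" "0 \<le> A" "B \<le> M" "0 \<le> B" using M AB by auto
  have v: "norm (?v - w) \<le> 4 * D" "norm (?v' - w) \<le> 4 * D"
  proof -
    have a: "norm (avg d R u - w) \<le> D + D" using R by (intro near u) auto
    have b: "norm (avg c e (avg d R u) - w) \<le> D + D + D" using e by (intro near a) auto
    show "norm (?v - w) \<le> 4 * D" using near(2)[OF a M0(4,3)] nonneg(1) by simp
    show "norm (?v' - w) \<le> 4 * D" using near(2)[OF b M0(4,3)] by simp
  qed
  have dx: "norm (x A v - v) \<le> 9 * D" if "norm (v - w) \<le> 4 * D" for v
    using disp_dist[OF isom_flow(1) D(1)[of A] that] M0 by simp
  have e9: "1 / \<kappa> * (9 * D) \<le> 9 * (\<theta> k r * D)"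
    using mult_right_mono[OF nonneg(7), of "9 * D"] nonneg(1) by simp
  have 2: "norm (avg x A (avg x A1 ?v) - avg x A ?v) \<le> 9 * (\<theta> k r * D)"
    using avg_avg_near[OF isom_flow(1) dx[OF v(1)] AB(1) less_imp_le[OF A1(1)] A1(2)] e9 by linarith
  have 3: "norm (avg x A (avg x A1 ?v') - avg x A ?v') \<le> 9 * (\<theta> k r * D)"
    using avg_avg_near[OF isom_flow(1) dx[OF v(2)] AB(1) less_imp_le[OF A1(1)] A1(2)] e9 by linarith
  have "norm (avg x A ?v - avg x A ?v') \<le> 9 * (\<theta> k r * D) + (real P * (\<theta> k r * D) + \<eta>) + 9 * (\<theta> k r * D)"
    by (rule norm_chain3[OF norm_chain3[OF _ 1] 3]) (use 2 in \<open>simp add: norm_minus_commute\<close>)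
  then show ?thesis by (simp add: mult_ac)
qed

lemma avg_d_w: assumes "0 \<le> R" "R \<le> M"
  shows "norm (avg d R w - w) \<le> D" "norm (c t (avg d R w) - avg d R w) \<le> norm (c t w - w)"
    "norm (d t (avg d R w) - avg d R w) \<le> norm (d t w - w)"
proof -
  show "norm (avg d R w - w) \<le> D" using near(4)[of w 0 R] assms by simp
  show "norm (c t (avg d R w) - avg d R w) \<le> norm (c t w - w)"
    by (rule commuting_disp[OF nonexp'(8)]) (auto simp: avg_comm)
  have "d t (avg d R w) = avg d R (d t w)"
    by (rule commuting_avg(1)[OF isom_flow(4,4) commuting_refl[OF isom_flow(4)]])
  then show "norm (d t (avg d R w) - avg d R w) \<le> norm (d t w - w)"
    by (intro commuting_disp[OF nonexp'(8)]) auto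
qed

text \<open>Suppose the \<open>d\<close>-frequency of a vector is about \<open>1 / R\<close>. At the shorter \<open>x\<close>-scale \<open>A1\<close> the family
  \<open>c\<close> is almost central, so the pair \<open>x, y\<close> removes its \<open>c\<close>-frequencies above \<open>1 / e\<close>;
  afterwards the Heisenberg pair \<open>x, c\<close> at scales \<open>A, e\<close> removes the \<open>d\<close>-frequency.\<close>

lemma d_step:
  assumes R: "R > 0" "R * \<Lambda> ^ 4 \<le> A\<^sup>2 * B"
  shows "norm (avg x A (avg y B (avg d (R / \<kappa>) w)) - avg x A (avg y B (avg d R w))) \<le> 58 * (real P * (\<theta> k r * D)) + 3 * \<eta>"
proof -
  let ?R = "R / \<kappa>" and ?F = "\<lambda>w. avg x A (avg y B w)"
  let ?X = "real P * (\<theta> k r * D)" and ?T = "\<theta> k r * D"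
  \<comment> \<open>Determined by \<open>A1\<^sup>2 * B = R\<close>: up to the factor
    \<open>q\<close>, the commutators of \<open>x A1\<close> and \<open>y B\<close> have
    \<open>d\<close>-parameter \<open>R\<close>. Then \<open>e\<close> is their
    \<open>c\<close>-parameter with one safety factor \<Lambda>.\<close>
  define A1 where "A1 = sqrt (R / B)"
  define e where "e = A1 * B / \<Lambda>"
  have ps: "A1 > 0" "e > 0" using R AB \<Lambda>_ge by (auto simp: A1_def e_def)
  have A1sq: "A1\<^sup>2 * B = R" using R AB by (simp add: A1_def)
  have L4: "\<Lambda> ^ 4 \<ge> 1" "\<Lambda>\<^sup>2 \<ge> \<kappa>" 
    using \<Lambda>_ge one_le_power[of \<Lambda> 4] self_le_power[of \<Lambda> 2] by auto
  have "R * 1 \<le> R * \<Lambda> ^ 4" using R L4 by (intro mult_left_mono) auto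
  then have RAB: "R \<le> A\<^sup>2 * B" using R by linarith
  have RM: "0 \<le> R" "R \<le> M" "?R \<le> M" "0 < ?R" "?R \<le> R"
  proof -
    show "0 \<le> R" "R \<le> M" using R RAB M by auto
    show "?R \<le> R" using R \<kappa>_ge by (simp add: divide_le_eq)
    then show "?R \<le> M" using \<open>R \<le> M\<close> by simp
    show "0 < ?R" using R \<kappa>_ge by simp
  qed
  have A1A: "A1 * \<Lambda>\<^sup>2 \<le> A"
  proof (rule power2_le_imp_le)
    have "(A1 * \<Lambda>\<^sup>2)\<^sup>2 = R * \<Lambda> ^ 4 / B" using AB A1sq by (simp add: power_mult_distrib field_simps flip: power_mult)
    also have "\<dots> \<le> A\<^sup>2" using R AB by (simp add: divide_le_eq)
    finally show "(A1 * \<Lambda>\<^sup>2)\<^sup>2 \<le> A\<^sup>2" .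
  qed (use AB in auto)
  have A1k: "A1 \<le> (1 / \<kappa>) * A"
  proof -
    have "A1 * \<kappa> \<le> A1 * \<Lambda>\<^sup>2" using ps L4 by (intro mult_left_mono) auto
    then show ?thesis using A1A \<kappa>_ge by (simp add: pos_le_divide_eq)
  qed
  have A1le: "A1 \<le> A" using A1k mult_right_mono[of "1 / \<kappa>" 1 A] \<kappa>_ge AB by simp
  have e3: "\<kappa> ^ 3 * e \<le> A * B"
  proof -
    have "\<kappa> ^ 3 * e \<le> \<Lambda> * e" using \<Lambda>_ge ps by (intro mult_right_mono) auto
    also have "\<dots> = A1 * B" using \<Lambda>_ge by (simp add: e_def)
    also have "\<dots> \<le> A * B" using A1le AB by (intro mult_right_mono) auto
    finally show ?thesis .
  qed
  have k3: "1 \<le> \<kappa> ^ 3" using \<kappa>_ge by (intro one_le_power) auto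
  have eAB: "e \<le> A * B" 
  proof -
    have "1 * e \<le> \<kappa> ^ 3 * e" using k3 ps by (intro mult_right_mono) auto
    with e3 show ?thesis by linarith
  qed
  have ec1: "A1 * e * \<kappa>\<^sup>2 \<le> ?R"
  proof -
    have "A1 * e * \<kappa>\<^sup>2 * \<kappa> = (A1\<^sup>2 * B) * (\<kappa> ^ 3 / \<Lambda>)"
      by (simp add: e_def power2_eq_square power3_eq_cube)
    also have "\<dots> \<le> R * 1" unfolding A1sq using R \<Lambda>_ge by (intro mult_left_mono) auto
    finally show ?thesis using \<kappa>_ge by (simp add: pos_le_divide_eq)
  qed
  have ec2: "e * \<Lambda> \<le> A1 * B" using \<Lambda>_ge by (simp add: e_def)
  have em: "e \<le> M" "e \<le> \<tau> * \<kappa> ^ P" "\<kappa> ^ 3 * e \<le> M" using eAB e3 M \<tau> by linarith+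
  let ?w = "avg d R w"
  have 1: "norm (?F (avg d ?R w) - ?F (avg c e (avg d ?R w))) \<le> ?X + \<eta> + 18 * ?T"
    using nonneg(1) by (intro insert_c[OF _ _ ps(1) A1k RM(4,3) ps(2) em ec1 ec2]) auto
  have 2: "norm (?F (avg d ?R ?w) - ?F (avg c e (avg d ?R ?w))) \<le> ?X + \<eta> + 18 * ?T"
    by (intro insert_c[OF _ _ ps(1) A1k RM(4,3) ps(2) em ec1 ec2] avg_d_w RM)
  have 3: "norm (?F (avg c e (avg d ?R w)) - ?F (avg c e (avg d ?R ?w))) \<le> ?X + \<eta>"
  proof -
    \<comment> \<open>Since \<open>d\<close> is central against \<open>x\<close> and
      \<open>c\<close>, these two form an honest Heisenberg pair: \<open>c\<close> acts as the
      second flow, \<open>d\<close> as the commutator flow, and the fourth flow is trivial.\<close>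
    interpret H: heis x c d "\<lambda>t v. v" 0
      using comm by unfold_locales (auto simp: isom_flow isom_flow_id xc commuting_def)
    let ?w1 = "avg y B (avg d ?R w)"
    have a: "avg y B (avg c e (avg d ?R w)) = avg c e ?w1"
      by (simp add: avg_comm)
    have dd: "avg d s (avg d t v) = avg d t (avg d s v)" for s t v
      by (rule commuting_avg(3)[OF isom_flow(4,4) commuting_refl[OF isom_flow(4)]])
    have b: "avg y B (avg c e (avg d ?R ?w)) = avg c e (avg d R ?w1)"
      by (simp add: avg_comm(3) avg_comm(6)[symmetric] dd[of ?R R])
    have dw: "norm (d t ?w1 - ?w1) \<le> norm (d t w - w)" for t
    proof (rule commuting_disp[where f = "avg y B" and h = d, OF nonexp'(6)])
      show "avg y B (d t (avg d ?R w)) = d t (avg y B (avg d ?R w))"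
        by (rule commuting_avg(2)[OF isom_flow(2,4) comm(2), symmetric])
      show "norm (d t (avg d ?R w) - avg d ?R w) \<le> norm (d t w - w)"
        using RM by (intro avg_d_w(3)) auto
    qed
    \<comment> \<open>The length \<open>A * R * \<kappa>\<^sup>2\<close> of the trivial average is
      read off from the first scale condition of \<open>heis_bound\<close>; \<open>avg_id\<close>
      removes this average afterwards.\<close>
    have "norm (avg x A (avg c e (avg (\<lambda>t v. v) (A * R * \<kappa>\<^sup>2) ?w1))
        - avg x A (avg c e (avg d R (avg (\<lambda>t v. v) (A * R * \<kappa>\<^sup>2) ?w1)))) \<le> ?X + \<eta>"
    proof (rule H.heis_bound[OF g k \<kappa> AB(1) ps(2) _ R(1)])
      show "0 < A * R * \<kappa>\<^sup>2" using AB R \<kappa>_ge by auto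
      have "R * \<kappa> ^ (5 * k + 6) \<le> R * \<Lambda>" using R \<Lambda>_ge by (intro mult_left_mono) auto
      also have "R * \<Lambda> = A1 * \<Lambda>\<^sup>2 * e" using \<Lambda>_ge by (simp add: A1sq[symmetric] e_def power2_eq_square)
      also have "\<dots> \<le> A * e" using A1A ps by (intro mult_right_mono) auto
      finally show "R * \<kappa> ^ (5 * k + 6) \<le> A * e" .
      have "\<kappa> ^ 3 * R \<le> M"
      proof -
        have "\<kappa> ^ 3 \<le> \<Lambda> ^ 4" using \<Lambda>_ge power_increasing[of 1 4 \<Lambda>] by simp
        then have "\<kappa> ^ 3 * R \<le> R * \<Lambda> ^ 4" using R by (simp add: mult.commute mult_left_mono)
        then show ?thesis using R M by linarith
      qed
      then show "norm (d t ?w1 - ?w1) \<le> D" if "\<bar>t\<bar> \<le> \<kappa> ^ 3 * R" for t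
        using dw[of t] D(4)[of t] that by linarith
      have "R / \<kappa> ^ P \<le> \<tau>" using RAB \<tau> \<kappa>_ge by (simp add: divide_le_eq)
      then show "norm (d t ?w1 - ?w1) \<le> \<eta>" if "\<bar>t\<bar> \<le> R / \<kappa> ^ P" for t
        using dw[of t] \<eta>(2)[of t] that by linarith
    qed simp
    then show ?thesis unfolding a b avg_id .
  qed
  have 4: "norm (?F (avg d ?R ?w) - ?F ?w) \<le> ?T"
  proof (intro nonexp_le[OF nonexp'(5)] nonexp_le[OF nonexp'(6)])
    have "norm (avg d R (avg d ?R w) - avg d R w) \<le> (1 / \<kappa>) * D"
      using RM by (intro avg_avg_near[OF isom_flow(4) D(4)]) (use R in auto)
    also have "\<dots> \<le> ?T" by (rule mult_right_mono[OF nonneg(7,1)])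
    finally show "norm (avg d ?R ?w - ?w) \<le> ?T"
      using commuting_avg(3)[OF isom_flow(4,4) commuting_refl[OF isom_flow(4)]] by metis
  qed
  have 22: "norm (?F (avg c e (avg d ?R ?w)) - ?F (avg d ?R ?w)) \<le> ?X + \<eta> + 18 * ?T"
    using 2 by (simp only: norm_minus_commute)
  have "norm (?F (avg d ?R w) - ?F ?w) \<le> (?X + \<eta> + 18 * ?T) + (?X + \<eta>) + (?X + \<eta> + 18 * ?T) + ?T"
    by (rule norm_chain3[OF norm_chain3[OF norm_chain3[OF 1 3] 22] 4])
  moreover have "?T \<le> ?X"
    using P nonneg(1,6) mult_right_mono[of 1 "real P" ?T] by simp
  moreover have "0 \<le> ?X" using nonneg by simp
  ultimately show ?thesis by linarith
qed

text \<open>Descends by \<open>d_step\<close> through the scales \<open>R\<close>,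
  \<open>R / \<kappa>\<close>, and so on, until a scale below \<tau> is reached and \<eta> takes
  over.\<close>

lemma d_insert:
  assumes "R > 0" "R * \<Lambda> ^ 4 \<le> A\<^sup>2 * B" "R \<le> \<tau> * \<kappa> ^ n"
  shows "norm (avg x A (avg y B w) - avg x A (avg y B (avg d R w)))
    \<le> real n * (58 * (real P * (\<theta> k r * D)) + 3 * \<eta>) + \<eta>"
  using assms
proof (induction n arbitrary: R)
  case 0
  have "norm (avg d R w - w) \<le> \<eta>"
    using 0 by (intro avg_near[OF isom_flow(4)] \<eta>(2)) (auto simp: abs_mult intro: order_trans[OF mult_left_le])
  then have "norm (avg x A (avg y B (avg d R w)) - avg x A (avg y B w)) \<le> \<eta>"
    by (intro nonexp_le[OF nonexp'(5)] nonexp_le[OF nonexp'(6)])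
  then show ?case by (simp add: norm_minus_commute)
next
  case (Suc n)
  have "norm (avg x A (avg y B w) - avg x A (avg y B (avg d (R / \<kappa>) w)))
    \<le> real n * (58 * (real P * (\<theta> k r * D)) + 3 * \<eta>) + \<eta>"
  proof (rule Suc.IH)
    show "0 < R / \<kappa>" using Suc.prems \<kappa>_ge by simp
    have "R / \<kappa> \<le> R" using Suc.prems \<kappa>_ge by (simp add: divide_le_eq)
    then have "R / \<kappa> * \<Lambda> ^ 4 \<le> R * \<Lambda> ^ 4" using \<Lambda>_ge by (intro mult_right_mono) auto
    then show "R / \<kappa> * \<Lambda> ^ 4 \<le> A\<^sup>2 * B" using Suc.prems by linarith
    have "R \<le> (\<tau> * \<kappa> ^ n) * \<kappa>" using Suc.prems(3) by (simp add: mult_ac)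
    then show "R / \<kappa> \<le> \<tau> * \<kappa> ^ n" using \<kappa>_ge by (simp add: pos_divide_le_eq)
  qed
  from norm_chain3[OF this d_step[OF Suc.prems(1,2)]] show ?case
    by (simp only: of_nat_Suc distrib_right[of 1] distrib_right[of "real n"] mult_1 add_ac)
qed

text \<open>After inserting the averages over \<open>c\<close> and \<open>d\<close>, the word can be reordered.\<close>

lemma y_invariant:
  assumes t: "\<bar>t\<bar> \<le> B / \<Lambda> ^ 6"
  shows "norm (y t (avg x A (avg y B w)) - avg x A (avg y B w)) \<le> 161 * (real P)\<^sup>2 * (\<theta> k r * D) + 10 * real P * \<eta>"
proof -
  let ?T = "\<theta> k r * D"
  define R where "R = A\<^sup>2 * B / \<Lambda> ^ 4"
  define A' where "A' = A / \<Lambda>\<^sup>2"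
  define e where "e = A' * B / \<Lambda>"
  have L: "1 \<le> \<Lambda> ^ n" for n using \<Lambda>_ge one_le_power by auto
  have L2: "\<kappa> \<le> \<Lambda>\<^sup>2" "\<kappa> \<le> \<Lambda> ^ 3" "\<kappa> \<le> \<Lambda> ^ 6"
    using \<Lambda>_ge self_le_power[of \<Lambda> 2] self_le_power[of \<Lambda> 3] self_le_power[of \<Lambda> 6] by auto
  have ps: "0 < R" "0 < A'" "0 < e" using AB \<Lambda>_ge by (auto simp: R_def A'_def e_def)
  have RA: "R \<le> A\<^sup>2 * B" using AB L[of 4] mult_left_mono[of 1 "\<Lambda> ^ 4" "A\<^sup>2 * B"] \<Lambda>_ge by (simp add: R_def pos_divide_le_eq)
  have R4: "R * \<Lambda> ^ 4 \<le> A\<^sup>2 * B" using \<Lambda>_ge by (simp add: R_def)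
  have RM: "R \<le> M" "0 \<le> R" using RA M ps by auto
  have eq: "e = A * B / \<Lambda> ^ 3" by (simp add: e_def A'_def power2_eq_square power3_eq_cube)
  have e3: "\<kappa> ^ 3 * e \<le> A * B"
  proof -
    have "\<kappa> ^ 3 * e \<le> \<Lambda> * e" using \<Lambda>_ge ps by (intro mult_right_mono) auto
    also have "\<dots> = A' * B" using \<Lambda>_ge by (simp add: e_def)
    also have "\<dots> \<le> A * B"
      using AB L[of 2] \<Lambda>_ge mult_left_mono[of 1 "\<Lambda>\<^sup>2" A] by (intro mult_right_mono) (auto simp: A'_def pos_divide_le_eq)
    finally show ?thesis .
  qed
  have eAB: "e \<le> A * B"
  proof -
    have "1 * e \<le> \<kappa> ^ 3 * e" using \<kappa>_ge ps by (intro mult_right_mono one_le_power) auto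
    with e3 show ?thesis by linarith
  qed
  have em: "e \<le> M" "e \<le> \<tau> * \<kappa> ^ P" "\<kappa> ^ 3 * e \<le> M" using eAB e3 M \<tau> by linarith+
  have A'k: "A' \<le> (1 / \<kappa>) * A"
    using L2(1) AB \<kappa>_ge by (simp add: A'_def frac_le)
  have ec1: "A' * e * \<kappa>\<^sup>2 \<le> R"
  proof -
    have "A' * e * \<kappa>\<^sup>2 = R * (\<kappa>\<^sup>2 / \<Lambda>)"
      using \<Lambda>_ge by (simp add: A'_def eq R_def eval_nat_numeral)
    also have "\<kappa>\<^sup>2 \<le> \<Lambda>"
      by (rule order_trans[OF power_increasing[of 2 3 \<kappa>] \<Lambda>_ge(2)]) (use \<kappa>_ge in auto)
    then have "R * (\<kappa>\<^sup>2 / \<Lambda>) \<le> R * 1" using ps \<Lambda>_ge by (intro mult_left_mono) auto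
    finally show ?thesis by simp
  qed
  have ec2: "e * \<Lambda> \<le> A' * B" using \<Lambda>_ge by (simp add: e_def)
  define w' where "w' = avg d R w"
  define u where "u = avg c e w'"
  define v where "v = avg y B u"
  define \<epsilon> where "\<epsilon> = real P * (58 * (real P * ?T) + 3 * \<eta>) + \<eta> + (real P * ?T + \<eta> + 18 * ?T)"
  have 1: "norm (avg x A (avg y B w) - avg x A v) \<le> \<epsilon>"
  proof -
    have "R \<le> \<tau> * \<kappa> ^ P" using RA \<tau> by linarith
    note d_insert[OF ps(1) R4 this]
    moreover have "norm (avg x A (avg y B (avg d R w)) - avg x A (avg y B (avg c e (avg d R w)))) \<le> real P * ?T + \<eta> + 18 * ?T"
      using nonneg(1) by (intro insert_c[OF _ _ ps(2) A'k ps(1) RM(1) ps(3) em ec1 ec2]) auto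
    ultimately show ?thesis unfolding v_def u_def w'_def \<epsilon>_def by (rule norm_chain3)
  qed
  have 2: "norm (y t (avg x A (avg y B w)) - y t (avg x A v)) \<le> \<epsilon>"
    by (rule nonexp_le[OF nonexp'(2) 1])
  have k1: "0 \<le> 1 / \<kappa>" using \<kappa>_ge by simp
  have cv: "norm (c s v - v) \<le> (1 / \<kappa>) * D" if "\<bar>s\<bar> \<le> (1 / \<kappa>) * e" for s
  proof -
    have "norm (c e w' - w') \<le> D"
      unfolding w'_def using avg_d_w(2)[OF RM(2,1), of e] D(3)[of e] em ps by linarith
    then have "norm (c s u - u) \<le> (1 / \<kappa>) * D"
      unfolding u_def by (rule avg_small_disp(1)[OF isom_flow(3) _ ps(3) that])
    then show ?thesis
      unfolding v_def by (intro commuting_disp[where f = "avg y B", OF nonexp'(6)]) (auto simp: avg_comm)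
  qed
  have dv: "norm (d s v - v) \<le> (1 / \<kappa>) * D" if "\<bar>s\<bar> \<le> (1 / \<kappa>) * R" for s
  proof -
    have "norm (d R w - w) \<le> D" using D(4)[of R] RM by simp
    then have "norm (d s w' - w') \<le> (1 / \<kappa>) * D"
      unfolding w'_def by (rule avg_small_disp(1)[OF isom_flow(4) _ ps(1) that])
    then have "norm (d s u - u) \<le> (1 / \<kappa>) * D"
      unfolding u_def by (intro commuting_disp[where f = "avg c e", OF nonexp'(7)]) (auto simp: avg_comm)
    then show ?thesis
      unfolding v_def by (intro commuting_disp[where f = "avg y B", OF nonexp'(6)]) (auto simp: avg_comm)
  qed
  \<comment> \<open>\<open>v\<close> is almost fixed by the small elements of \<open>c\<close> and
    \<open>d\<close>, so \<open>y t\<close> passes through the average over \<open>x\<close>; in the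
    next step the average over \<open>y\<close> absorbs it.\<close>
  have 3: "norm (y t (avg x A v) - avg x A (y t v)) \<le> (1 / \<kappa>) * D + (1 / \<kappa>) * D"
  proof (rule avg_near2[where f = "y t" and g = "\<lambda>v. v", OF isom_flow(1) nonexp'(2) nonexp_id])
    fix s :: real assume s: "0 \<le> s" "s \<le> 1"
    define a where "a = A * s"
    have a: "0 \<le> a" "a \<le> A" using s AB by (auto simp: a_def mult_left_le)
    have "\<bar>a * t\<bar> = a * \<bar>t\<bar>" using a by (simp add: abs_mult)
    also have "\<dots> \<le> A * (B / \<Lambda> ^ 6)" using a t AB by (intro mult_mono) auto
    also have "\<dots> = e / \<Lambda> ^ 3" by (simp add: eq flip: power_add)
    also have "\<dots> \<le> (1 / \<kappa>) * e" using ps \<kappa>_ge L2 by (simp add: frac_le)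
    finally have at: "\<bar>a * t\<bar> \<le> (1 / \<kappa>) * e" .
    have "\<bar>q * a\<^sup>2 * t\<bar> = \<bar>q\<bar> * (a\<^sup>2 * \<bar>t\<bar>)" by (simp add: abs_mult)
    also have "\<dots> \<le> 1 * (A\<^sup>2 * (B / \<Lambda> ^ 6))" using a t AB q by (intro mult_mono power_mono) auto
    also have "\<dots> = R / \<Lambda> ^ 2" by (simp add: R_def flip: power_add)
    also have "\<dots> \<le> (1 / \<kappa>) * R" using ps \<kappa>_ge L2 by (simp add: frac_le)
    finally have aat: "\<bar>q * a\<^sup>2 * t\<bar> \<le> (1 / \<kappa>) * R" .
    have "norm (y t (x a v) - x a (y t v)) = norm (c (a * t) (d (q * a\<^sup>2 * t) v) - v)"
      unfolding xy by (simp add: isom_flow_isom[OF isom_flow(1)] isom_flow_isom[OF isom_flow(2)] norm_minus_commute)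
    also have "\<dots> \<le> (1 / \<kappa>) * D + (1 / \<kappa>) * D"
      by (rule norm_chain3[OF nonexp_le[OF nonexp'(3) dv[OF aat]] cv[OF at]])
    finally show "norm (y t (x (A * s) v) - x (A * s) (y t v)) \<le> (1 / \<kappa>) * D + (1 / \<kappa>) * D"
      unfolding a_def .
  qed
  have 4: "norm (avg x A (y t v) - avg x A v) \<le> (1 / \<kappa>) * (5 * D)"
  proof (rule nonexp_le[OF nonexp'(5)])
    have a: "norm (w' - w) \<le> D" unfolding w'_def by (rule avg_d_w(1)[OF RM(2,1)])
    have b: "norm (u - w) \<le> D + D" unfolding u_def using near(3)[OF a, of e] ps em by simp
    have "norm (y B u - u) \<le> 2 * (D + D) + D"
      by (rule disp_dist[OF isom_flow(2) D(2) b]) (use AB M in auto)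
    moreover have "\<bar>t\<bar> \<le> (1 / \<kappa>) * B"
    proof -
      have "B / \<Lambda> ^ 6 \<le> B / \<kappa>" using L2 AB \<kappa>_ge by (intro frac_le) auto
      then show ?thesis using t by simp
    qed
    ultimately show "norm (y t v - v) \<le> (1 / \<kappa>) * (5 * D)"
      unfolding v_def by (intro avg_small_disp(1)[OF isom_flow(2) _ AB(2)]) auto
  qed
  have 5: "norm (avg x A v - avg x A (avg y B w)) \<le> \<epsilon>"
    using 1 by (simp only: norm_minus_commute)
  have "norm (y t (avg x A (avg y B w)) - avg x A (avg y B w))
      \<le> \<epsilon> + ((1 / \<kappa>) * D + (1 / \<kappa>) * D) + (1 / \<kappa>) * (5 * D) + \<epsilon>"
    by (rule norm_chain3[OF norm_chain3[OF norm_chain3[OF 2 3] 4] 5])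
  also have "\<dots> = 2 * \<epsilon> + 7 * ((1 / \<kappa>) * D)" by simp
  also have "\<dots> \<le> 2 * \<epsilon> + 7 * ?T" using mult_right_mono[OF nonneg(7,1)] by simp
  \<comment> \<open>Bookkeeping: 2 * 58 + 2 + 43 = 161 for the first kind of error, and 6 + 4 = 10
    for the second.\<close>
  also have "\<dots> \<le> 161 * (real P)\<^sup>2 * ?T + 10 * real P * \<eta>"
  proof -
    have T0: "0 \<le> ?T" using nonneg by simp
    have p1: "1 \<le> real P" using P by simp
    have p2: "real P \<le> (real P)\<^sup>2" "1 \<le> (real P)\<^sup>2" using p1 self_le_power[of "real P" 2] by auto
    have a: "real P * ?T \<le> (real P)\<^sup>2 * ?T" "1 * ?T \<le> (real P)\<^sup>2 * ?T"
      by (rule mult_right_mono[OF p2(1) T0], rule mult_right_mono[OF p2(2) T0])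
    have b: "1 * \<eta> \<le> real P * \<eta>" by (rule mult_right_mono[OF p1 nonneg(2)])
    have "\<epsilon> = 58 * ((real P)\<^sup>2 * ?T) + 3 * (real P * \<eta>) + 2 * \<eta> + real P * ?T + 18 * ?T"
      by (simp add: \<epsilon>_def power2_eq_square algebra_simps)
    moreover have "161 * (real P)\<^sup>2 * ?T + 10 * real P * \<eta> = 161 * ((real P)\<^sup>2 * ?T) + 10 * (real P * \<eta>)"
      by (simp only: mult.assoc)
    moreover have "2 * e' + 7 * T \<le> 161 * X + 10 * Y"
      if "e' = 58 * X + 3 * Y + 2 * E + Z + 18 * T" "Z \<le> X" "1 * T \<le> X" "1 * E \<le> Y" for e' T X Y Z E :: real
      using that by linarith
    ultimately show ?thesis using a b by presburger
  qed
  finally show ?thesis .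
qed

end

section \<open>Matrices in the symplectic group\<close>

definition E :: "4 \<Rightarrow> 4 \<Rightarrow> real^4^4" where
  "E p q = (\<chi> i j. if i = p \<and> j = q then 1 else 0)"

definition elem :: "real^4^4 \<Rightarrow> real \<Rightarrow> real^4^4" where
  "elem N t = mat 1 + t *\<^sub>R N"

definition diag4 :: "real \<Rightarrow> real \<Rightarrow> real^4^4" where
  "diag4 a b = (\<chi> i j. if i = j then (if i = 1 then a else if i = 2 then b else if i = 3 then 1 / a else 1 / b) else 0)"

text \<open>The root vectors of \<open>sp\<^sub>4\<close>, numbered by angle: \<open>N1, N3, N5, N7\<close> belong to the long roots
  \<open>2e\<^sub>1, 2e\<^sub>2, -2e\<^sub>1, -2e\<^sub>2\<close> and \<open>N2, N4, N6, N8\<close> to the short roots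
  \<open>e\<^sub>1+e\<^sub>2, e\<^sub>2-e\<^sub>1, -e\<^sub>1-e\<^sub>2, e\<^sub>1-e\<^sub>2\<close>.\<close>

definition "N1 = E 1 3"
definition "N2 = E 1 4 + E 2 3"
definition "N3 = E 2 4"
definition "N4 = E 2 1 - E 3 4"
definition "N5 = E 3 1"
definition "N6 = E 3 2 + E 4 1"
definition "N7 = E 4 2"
definition "N8 = E 1 2 - E 4 3"

lemmas N_defs = N1_def N2_def N3_def N4_def N5_def N6_def N7_def N8_def E_def

lemmas mat_simps = vec_eq_iff forall_4 matrix_matrix_mult_def sum_4 mat_def transpose_def symplJ_def elem_def diag4_def N_defs

text \<open>For a square-zero element of the Lie algebra the exponential series stops after the
  linear term, so \<open>elem N\<close> is a one-parameter subgroup of \<open>Sp4\<close>.\<close>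

definition sp_square_zero :: "real^4^4 \<Rightarrow> bool" where
  "sp_square_zero N \<longleftrightarrow> N ** N = 0 \<and> transpose N ** symplJ + symplJ ** N = 0"

lemma sp_square_zero_N: "sp_square_zero N1" "sp_square_zero N2" "sp_square_zero N3" "sp_square_zero N4" "sp_square_zero N5" "sp_square_zero N6" "sp_square_zero N7" "sp_square_zero N8"
  unfolding sp_square_zero_def by (simp_all add: mat_simps)

lemma mat_scaleR_mult: "(r *\<^sub>R A) ** B = r *\<^sub>R (A ** B)" "A ** (r *\<^sub>R B) = r *\<^sub>R (A ** B)" for A B :: "real^4^4"
  by (simp_all add: vec_eq_iff matrix_matrix_mult_def sum_distrib_left mult_ac)

lemma mat_add_mult: "(A + B) ** C = A ** C + B ** C" for A :: "real^4^4"
  by (simp add: vec_eq_iff matrix_matrix_mult_def distrib_right sum.distrib)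

lemma elem_add: assumes "sp_square_zero N" shows "elem N (s + t) = elem N s ** elem N t"
proof -
  have "N ** N = 0" using assms by (simp add: sp_square_zero_def)
  then show ?thesis
    by (simp add: elem_def matrix_add_ldistrib mat_add_mult mat_scaleR_mult scaleR_add_left)
qed

lemma elem_0 [simp]: "elem N 0 = mat 1"
  by (simp add: elem_def)

lemma Sp4I: "g' ** g = mat 1 \<Longrightarrow> transpose g ** symplJ ** g = symplJ \<Longrightarrow> g \<in> Sp4"
  using invertible_left_inverse by (auto simp: Sp4_def)

lemma transpose_scaleR: "transpose (r *\<^sub>R A) = r *\<^sub>R transpose A" for A :: "real^4^4"
  by (simp add: vec_eq_iff transpose_def)

lemma transpose_add: "transpose (A + B) = transpose A + transpose B" for A :: "real^4^4"
  by (simp add: vec_eq_iff transpose_def)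

lemma elem_Sp4: assumes "sp_square_zero N" shows "elem N t \<in> Sp4"
proof (rule Sp4I)
  show "elem N (- t) ** elem N t = mat 1" using elem_add[OF assms, of "-t" t] by simp
  have 1: "transpose N ** symplJ = - (symplJ ** N)" using assms by (simp add: sp_square_zero_def eq_neg_iff_add_eq_0)
  have "(symplJ ** N) ** N = 0"
    using assms by (simp add: sp_square_zero_def flip: matrix_mul_assoc)
  then have 2: "(transpose N ** symplJ) ** N = 0"
    unfolding 1 by (simp add: vec_eq_iff matrix_matrix_mult_def sum_negf)
  show "transpose (elem N t) ** symplJ ** elem N t = symplJ"
    by (simp add: elem_def matrix_add_ldistrib mat_add_mult mat_scaleR_mult transpose_scaleR transpose_add
        transpose_mat 2) (simp add: 1)
qed

lemma diag4_Sp4: "a \<noteq> 0 \<Longrightarrow> b \<noteq> 0 \<Longrightarrow> diag4 a b \<in> Sp4"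
  by (rule Sp4I[of "diag4 (1/a) (1/b)"]) (simp_all add: mat_simps)

lemma Sp4_mult: "g \<in> Sp4 \<Longrightarrow> h \<in> Sp4 \<Longrightarrow> g ** h \<in> Sp4"
  unfolding Sp4_def by (auto simp: invertible_mult matrix_transpose_mul) (metis matrix_mul_assoc)

lemma Sp4_1 [simp]: "mat 1 \<in> Sp4"
  using elem_Sp4[OF sp_square_zero_N(1), of 0] by simp

text \<open>An explicit inverse, from g^T J g = J and J^2 = -1. Its size is at most a constant times
  that of \<open>g\<close>, without any determinant.\<close>

definition sinv :: "real^4^4 \<Rightarrow> real^4^4" where
  "sinv g = - (symplJ ** (transpose g ** symplJ))"

lemma symplJ_sq: "symplJ ** symplJ = - mat 1"
  by (simp add: mat_simps)

lemma mat_neg_mult: "(- A) ** B = - (A ** B)" "A ** (- B) = - (A ** B)" for A :: "real^4^4"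
  by (simp_all add: vec_eq_iff matrix_matrix_mult_def sum_negf)

lemma sinv: assumes "g \<in> Sp4" shows "sinv g ** g = mat 1" "g ** sinv g = mat 1" "sinv g \<in> Sp4"
proof -
  have J: "transpose g ** symplJ ** g = symplJ" using assms by (simp add: Sp4_def)
  show 1: "sinv g ** g = mat 1"
  proof -
    have "transpose g ** (symplJ ** g) = symplJ" using J by (simp add: matrix_mul_assoc)
    then show ?thesis by (simp add: sinv_def mat_neg_mult symplJ_sq flip: matrix_mul_assoc)
  qed
  show 2: "g ** sinv g = mat 1"
    using 1 matrix_left_right_inverse by blast
  have t: "transpose (sinv g) ** transpose g = mat 1" 
    using 2 by (metis matrix_transpose_mul transpose_mat)
  have t': "transpose g ** transpose (sinv g) = mat 1"
    using t matrix_left_right_inverse by blast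
  have "transpose (sinv g) ** symplJ ** sinv g = transpose (sinv g) ** (transpose g ** symplJ ** g) ** sinv g"
    by (simp add: J)
  also have "\<dots> = (transpose (sinv g) ** transpose g) ** symplJ ** (g ** sinv g)"
    by (simp add: matrix_mul_assoc)
  also have "\<dots> = symplJ" by (simp add: t 2)
  finally show "sinv g \<in> Sp4" using 2 by (intro Sp4I)
qed

text \<open>The entrywise sum norm is submultiplicative and dominates every entry; the unit matrix
  has norm 4.\<close>

definition mnorm :: "real^4^4 \<Rightarrow> real" where
  "mnorm A = (\<Sum>i\<in>UNIV. \<Sum>j\<in>UNIV. \<bar>A $ i $ j\<bar>)"

lemma mnorm_nonneg [simp]: "0 \<le> mnorm A"
  by (simp add: mnorm_def sum_nonneg)

lemma mnorm_add: "mnorm (A + B) \<le> mnorm A + mnorm B"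
  unfolding mnorm_def sum.distrib[symmetric] by (intro sum_mono) (simp add: abs_triangle_ineq)

lemma mnorm_scaleR: "mnorm (r *\<^sub>R A) = \<bar>r\<bar> * mnorm A"
  by (simp add: mnorm_def abs_mult sum_distrib_left)

lemma mnorm_minus: "mnorm (- A) = mnorm A"
  by (simp add: mnorm_def)

lemma mnorm_diff: "mnorm (A - B) \<le> mnorm A + mnorm B"
  using mnorm_add[of A "- B"] by (simp add: mnorm_minus)

lemma mnorm_transpose: "mnorm (transpose A) = mnorm A"
  unfolding mnorm_def transpose_def by (subst sum.swap) simp

lemma mnorm_comp: "\<bar>A $ i $ j\<bar> \<le> mnorm A"
proof -
  have "\<bar>A $ i $ j\<bar> \<le> (\<Sum>j\<in>UNIV. \<bar>A $ i $ j\<bar>)" by (rule member_le_sum) auto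
  also have "\<dots> \<le> mnorm A" unfolding mnorm_def by (rule member_le_sum[where f = "\<lambda>i. \<Sum>j\<in>UNIV. \<bar>A $ i $ j\<bar>"]) (auto intro: sum_nonneg)
  finally show ?thesis .
qed

lemma mnorm_mult: "mnorm (A ** B) \<le> mnorm A * mnorm B"
proof -
  have "mnorm (A ** B) \<le> (\<Sum>i\<in>UNIV. \<Sum>j\<in>UNIV. \<Sum>k\<in>UNIV. \<bar>A $ i $ k\<bar> * \<bar>B $ k $ j\<bar>)"
    unfolding mnorm_def matrix_matrix_mult_def
    by (intro sum_mono) (auto simp: abs_mult[symmetric] intro: sum_abs)
  also have "\<dots> = (\<Sum>i\<in>UNIV. \<Sum>k\<in>UNIV. \<Sum>j\<in>UNIV. \<bar>A $ i $ k\<bar> * \<bar>B $ k $ j\<bar>)"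
    by (rule sum.cong[OF refl], rule sum.swap)
  also have "\<dots> = (\<Sum>i\<in>UNIV. \<Sum>k\<in>UNIV. \<bar>A $ i $ k\<bar> * (\<Sum>j\<in>UNIV. \<bar>B $ k $ j\<bar>))"
    by (simp add: sum_distrib_left)
  also have "\<dots> \<le> (\<Sum>i\<in>UNIV. \<Sum>k\<in>UNIV. \<bar>A $ i $ k\<bar> * mnorm B)"
  proof (intro sum_mono mult_left_mono)
    show "(\<Sum>j\<in>UNIV. \<bar>B $ k $ j\<bar>) \<le> mnorm B" for k
      unfolding mnorm_def by (rule member_le_sum[where f = "\<lambda>k. \<Sum>j\<in>UNIV. \<bar>B $ k $ j\<bar>"]) (auto intro: sum_nonneg)
  qed simp
  also have "\<dots> = mnorm A * mnorm B"
    by (simp add: mnorm_def[of A] sum_distrib_right)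
  finally show ?thesis .
qed

lemma mnorm_1: "mnorm (mat 1) = 4"
  by (simp add: mnorm_def mat_def sum_4)

lemma mnorm_0 [simp]: "mnorm 0 = 0"
  by (simp add: mnorm_def)

lemma mnorm_N: "mnorm N1 \<le> 2" "mnorm N2 \<le> 2" "mnorm N3 \<le> 2" "mnorm N4 \<le> 2" "mnorm N5 \<le> 2" "mnorm N6 \<le> 2"
    "mnorm N7 \<le> 2" "mnorm N8 \<le> 2"
  by (simp_all add: mnorm_def sum_4 N_defs)

lemma mnorm_le: "mnorm A \<le> 4 + mnorm (A - mat 1)"
  using mnorm_add[of "A - mat 1" "mat 1"] by (simp add: mnorm_1)

lemma mnorm_sinv: "mnorm (sinv g) \<le> 16 * mnorm g"
proof -
  have J: "mnorm symplJ = 4" by (simp add: mnorm_def sum_4 symplJ_def)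
  have "mnorm (sinv g) \<le> mnorm symplJ * (mnorm (transpose g) * mnorm symplJ)"
    unfolding sinv_def mnorm_minus
    by (intro order_trans[OF mnorm_mult] mult_left_mono mnorm_mult) auto
  then show ?thesis by (simp add: J mnorm_transpose)
qed

lemma norm_mnorm: "norm A \<le> mnorm A"
proof -
  have "norm A \<le> (\<Sum>i\<in>UNIV. norm (A $ i))"
    unfolding norm_vec_def by (rule L2_set_le_sum) auto
  also have "\<dots> \<le> mnorm A" unfolding mnorm_def
  proof (rule sum_mono)
    show "norm (A $ i) \<le> (\<Sum>j\<in>UNIV. \<bar>A $ i $ j\<bar>)" for i
      using norm_le_l1_cart[of "A $ i"] by simp
  qed
  finally show ?thesis .
qed

section \<open>Commutation relations of the root subgroups\<close>

lemma rel_47: "elem N4 a ** elem N7 b = elem N7 b ** elem N4 a ** elem N6 (- (a * b)) ** elem N5 (- (a\<^sup>2 * b))"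
  by (simp add: mat_simps power2_eq_square)
lemma rel_46: "elem N4 a ** elem N6 b = elem N6 b ** elem N4 a ** elem N5 (- (2 * a * b))"
  by (simp add: mat_simps)
lemma rel_27: "elem N2 a ** elem N7 b = elem N7 b ** elem N2 a ** elem N8 (a * b) ** elem N1 (a\<^sup>2 * b)"
  by (simp add: mat_simps power2_eq_square)
lemma rel_28: "elem N2 a ** elem N8 b = elem N8 b ** elem N2 a ** elem N1 (- (2 * a * b))"
  by (simp add: mat_simps)
lemma rel_24: "elem N2 a ** elem N4 b = elem N4 b ** elem N2 a ** elem N3 (- (2 * a * b))"
  by (simp add: mat_simps)

lemma elem_comm: "M ** N = N ** M \<Longrightarrow> elem M a ** elem N b = elem N b ** elem M a"
  by (simp add: elem_def matrix_add_ldistrib mat_add_mult mat_scaleR_mult algebra_simps)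

lemma N_comm: "N7 ** N6 = N6 ** N7" "N7 ** N5 = N5 ** N7" "N6 ** N5 = N5 ** N6" "N4 ** N5 = N5 ** N4"
   "N7 ** N8 = N8 ** N7" "N7 ** N1 = N1 ** N7" "N8 ** N1 = N1 ** N8" "N2 ** N1 = N1 ** N2"
   "N4 ** N3 = N3 ** N4" "N2 ** N3 = N3 ** N2"
  by (simp_all add: mat_simps)

section \<open>Isometries of a strictly convex space are affine\<close>

lemma strictly_convex_eq:
  assumes uc: "uniformly_convex TYPE('a::real_normed_vector)"
    and "norm (a::'a) \<le> n" "norm b \<le> n" "n \<le> norm ((1/2) *\<^sub>R (a + b))"
  shows "a = b"
proof -
  have "norm (a - b) \<le> e" if e: "e > 0" for e
  proof -
    have n0: "0 \<le> n" using assms(2) norm_ge_zero[of a] by linarith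
    then have pos: "e / (n + 1) > 0" using e by simp
    show ?thesis
    proof (rule uniformly_convex_ball[OF uc pos])
      fix r assume r1: "r < 1" and *: "\<And>(u::'a) v m. norm u \<le> m \<Longrightarrow> norm v \<le> m \<Longrightarrow>
          r * m \<le> norm ((1/2) *\<^sub>R (u + v)) \<Longrightarrow> norm (u - v) \<le> e / (n + 1) * m"
      have "r * n \<le> 1 * n" using r1 n0 by (intro mult_right_mono) auto
      also have "\<dots> \<le> norm ((1/2) *\<^sub>R (a + b))" using assms(4) by simp
      finally have "norm (a - b) \<le> e / (n + 1) * n" using assms(2,3) by (intro *)
      also have "\<dots> \<le> e" using n0 e by (simp add: divide_le_eq)
      finally show "norm (a - b) \<le> e" .
    qed
  qed
  then have "norm (a - b) \<le> 0" using field_le_epsilon[of "norm (a - b)" 0] by simp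
  then show ?thesis by simp
qed

text \<open>The defect of homogeneity along \<open>v\<close> is additive in the scalar and vanishes
  on the integers; so it is periodic and bounded, and a bounded additive function is zero.\<close>

lemma additive_lipschitz_linear:
  fixes L :: "'a::real_normed_vector \<Rightarrow> 'a"
  assumes add: "\<And>u v. L (u + v) = L u + L v" and lip: "\<And>v. norm (L v) \<le> norm v"
  shows "linear L"
proof (rule linearI[OF add])
  fix r v
  define \<phi> where "\<phi> s = L (s *\<^sub>R v) - s *\<^sub>R L v" for s
  have padd: "\<phi> (s + t) = \<phi> s + \<phi> t" for s t
    by (simp add: \<phi>_def scaleR_add_left add)
  have p0: "\<phi> 0 = 0" using padd[of 0 0] by simp
  have pn: "\<phi> (real n * s) = real n *\<^sub>R \<phi> s" for n s
    by (induction n) (simp_all add: p0 distrib_right padd scaleR_add_left)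
  have pm: "\<phi> (- s) = - \<phi> s" for s
    using padd[of s "-s"] p0 by (simp add: eq_neg_iff_add_eq_0 add.commute)
  have "\<phi> 1 = 0" by (simp add: \<phi>_def)
  then have "\<phi> (real n) = 0" for n using pn[of n 1] by simp
  then have pz: "\<phi> (of_int z) = 0" for z
    using pm by (cases z rule: int_cases2) auto
  have bound: "norm (\<phi> s) \<le> 2 * norm v" for s
  proof -
    have "\<phi> s = \<phi> (frac s)" using padd[of "of_int \<lfloor>s\<rfloor>" "frac s"] pz by (simp add: frac_def)
    also have "norm \<dots> \<le> norm (L (frac s *\<^sub>R v)) + norm (frac s *\<^sub>R L v)"
      unfolding \<phi>_def by (rule norm_triangle_ineq4)
    also have "\<dots> \<le> frac s * norm v + frac s * norm v"
      using lip[of "frac s *\<^sub>R v"] lip[of v] frac_ge_0[of s] by (intro add_mono) (auto intro: mult_left_mono)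
    also have "\<dots> \<le> 1 * norm v + 1 * norm v"
      using frac_lt_1[of s] by (intro add_mono mult_right_mono) auto
    finally show ?thesis by simp
  qed
  have "\<phi> r = 0"
  proof (rule ccontr)
    assume "\<phi> r \<noteq> 0"
    then have pos: "norm (\<phi> r) > 0" by simp
    then obtain n where "2 * norm v < real n * norm (\<phi> r)" using reals_Archimedean3 by blast
    moreover have "real n * norm (\<phi> r) \<le> 2 * norm v" using bound[of "real n * r"] by (simp add: pn)
    ultimately show False by simp
  qed
  then show "L (r *\<^sub>R v) = r *\<^sub>R L v" by (simp add: \<phi>_def)
qed

text \<open>In a strictly convex space the midpoint of two points is the only point at half their
  distance from both, so isometries preserve midpoints and hence are additive up to a
  translation.\<close>

lemma isometry_nonexp:
  fixes f :: "'a::real_normed_vector \<Rightarrow> 'a"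
  assumes uc: "uniformly_convex TYPE('a)" and iso: "\<And>u v. norm (f u - f v) = norm (u - v)"
  shows "nonexp f"
proof -
  have mid: "f ((1/2) *\<^sub>R (u + v)) = (1/2) *\<^sub>R (f u + f v)" for u v
  proof -
    let ?m = "(1/2) *\<^sub>R (u + v)"
    have "?m - u = (1/2) *\<^sub>R (v - u)" "v - ?m = (1/2) *\<^sub>R (v - u)"
      by (simp_all add: algebra_simps flip: scaleR_add_left)
    then have 1: "norm (f ?m - f u) \<le> norm (v - u) / 2" "norm (f v - f ?m) \<le> norm (v - u) / 2"
      by (simp_all add: iso)
    have "f ?m - f u = f v - f ?m"
      by (rule strictly_convex_eq[OF uc 1]) (simp add: iso)
    then have "f ?m + f ?m = f u + f v" by (simp add: algebra_simps)
    then have "(1/2) *\<^sub>R (f ?m + f ?m) = (1/2) *\<^sub>R (f u + f v)" by simp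
    then show ?thesis by (simp flip: scaleR_2)
  qed
  define L where "L v = f v - f 0" for v
  have Lm: "L ((1/2) *\<^sub>R (u + v)) = (1/2) *\<^sub>R (L u + L v)" for u v
    unfolding L_def mid by (simp add: algebra_simps flip: scaleR_add_left)
  have L0: "L 0 = 0" by (simp add: L_def)
  have L2: "L (2 *\<^sub>R u) = 2 *\<^sub>R L u" for u
    using Lm[of "2 *\<^sub>R u" 0] by (simp add: L0)
  have "L (u + v) = L u + L v" for u v
    using Lm[of "2 *\<^sub>R u" "2 *\<^sub>R v"] by (simp add: L2 flip: scaleR_add_right)
  moreover have "norm (L v) \<le> norm v" for v unfolding L_def by (simp add: iso)
  ultimately have "linear L" by (rule additive_lipschitz_linear)
  then show ?thesis unfolding nonexp_def L_def[abs_def] by (simp add: iso)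
qed

section \<open>Gaussian elimination and local coordinates\<close>

lemma Sp4_entry: assumes "h \<in> Sp4"
  shows "h$1$i * h$3$j + h$2$i * h$4$j - h$3$i * h$1$j - h$4$i * h$2$j = symplJ$i$j"
proof -
  have "(transpose h ** symplJ ** h) $ i $ j = symplJ$i$j" using assms by (simp add: Sp4_def)
  moreover have "(transpose h ** symplJ ** h) $ i $ j = h$1$i * h$3$j + h$2$i * h$4$j - h$3$i * h$1$j - h$4$i * h$2$j"
    by (simp add: matrix_matrix_mult_def sum_4 transpose_def symplJ_def)
  ultimately show ?thesis by simp
qed

text \<open>The symplectic relations force the remaining entries of the third row and column. What
  is left is a block of determinant 1 in the coordinates 2 and 4, which factors as lower triangular,
  diagonal, upper triangular because its pivot is nonzero.\<close>

lemma block_form: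
  assumes h: "h \<in> Sp4" and nz: "h$1$1 \<noteq> 0" "h$2$2 \<noteq> 0"
    and z: "h$1$2 = 0" "h$1$3 = 0" "h$1$4 = 0" "h$2$1 = 0" "h$3$1 = 0" "h$4$1 = 0"
  shows "h = diag4 (h$1$1) 1 ** (elem N7 (h$4$2 / h$2$2) ** (diag4 1 (h$2$2) ** elem N3 (h$2$4 / h$2$2)))"
proof -
  have J: "symplJ$1$2 = 0" "symplJ$1$3 = 1" "symplJ$1$4 = 0" "symplJ$2$3 = 0" "symplJ$4$3 = 0" "symplJ$2$4 = 1"
    by (simp_all add: symplJ_def)
  have e: "h$3$2 = 0" "h$1$1 * h$3$3 = 1" "h$3$4 = 0"
    using Sp4_entry[OF h, of 1 2] Sp4_entry[OF h, of 1 3] Sp4_entry[OF h, of 1 4] nz by (simp_all add: z J)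
  have f: "h$2$2 * h$4$3 - h$4$2 * h$2$3 = 0" "h$2$4 * h$4$3 - h$4$4 * h$2$3 = 0" "h$2$2 * h$4$4 - h$4$2 * h$2$4 = 1"
    using Sp4_entry[OF h, of 2 3] Sp4_entry[OF h, of 4 3] Sp4_entry[OF h, of 2 4] by (simp_all add: z J e)
  have "(h$2$2 * h$4$4 - h$4$2 * h$2$4) * h$4$3 = 0" "(h$2$2 * h$4$4 - h$4$2 * h$2$4) * h$2$3 = 0"
    using f(1,2) by algebra+
  then have f': "h$4$3 = 0" "h$2$3 = 0" using f(3) by auto
  have h44: "h$4$4 = 1 / h$2$2 + h$4$2 * h$2$4 / h$2$2" using f(3) nz by (simp add: field_simps)
  show ?thesis
    using nz e(2) by (simp add: mat_simps z e(1,3) f' h44 field_simps)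
qed

lemma elem_rows:
  "(elem N4 t ** g)$1$j = g$1$j" "(elem N4 t ** g)$2$j = g$2$j + t * g$1$j" "(elem N4 t ** g)$3$j = g$3$j - t * g$4$j" "(elem N4 t ** g)$4$j = g$4$j"
  "(elem N6 t ** g)$1$j = g$1$j" "(elem N6 t ** g)$2$j = g$2$j" "(elem N6 t ** g)$3$j = g$3$j + t * g$2$j" "(elem N6 t ** g)$4$j = g$4$j + t * g$1$j"
  "(elem N5 t ** g)$1$j = g$1$j" "(elem N5 t ** g)$2$j = g$2$j" "(elem N5 t ** g)$3$j = g$3$j + t * g$1$j" "(elem N5 t ** g)$4$j = g$4$j"
  by (simp_all add: matrix_matrix_mult_def sum_4 mat_def elem_def N_defs)

lemma elem_cols:
  "(g ** elem N8 t)$i$1 = g$i$1" "(g ** elem N8 t)$i$2 = g$i$2 + t * g$i$1" "(g ** elem N8 t)$i$3 = g$i$3 - t * g$i$4" "(g ** elem N8 t)$i$4 = g$i$4"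
  "(g ** elem N2 t)$i$1 = g$i$1" "(g ** elem N2 t)$i$2 = g$i$2" "(g ** elem N2 t)$i$3 = g$i$3 + t * g$i$2" "(g ** elem N2 t)$i$4 = g$i$4 + t * g$i$1"
  "(g ** elem N1 t)$i$1 = g$i$1" "(g ** elem N1 t)$i$2 = g$i$2" "(g ** elem N1 t)$i$3 = g$i$3 + t * g$i$1" "(g ** elem N1 t)$i$4 = g$i$4"
  by (simp_all add: matrix_matrix_mult_def sum_4 mat_def elem_def N_defs mult.commute)

text \<open>\<open>N4\<close>, \<open>N6\<close>, \<open>N5\<close> clear the first column. The
  summand \<open>l * g$4$1\<close> in \<open>r\<close> is there because clearing row 2 with
  \<open>N4\<close> also changes row 3.\<close>

lemma elim_left:
  assumes "g$1$1 \<noteq> 0"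
  defines "l \<equiv> g$2$1 / g$1$1" and "p \<equiv> g$4$1 / g$1$1"
  defines "r \<equiv> (g$3$1 + l * g$4$1) / g$1$1"
  defines "g' \<equiv> elem N5 (- r) ** (elem N6 (- p) ** (elem N4 (- l) ** g))"
  shows "g'$1$1 = g$1$1" "g'$2$1 = 0" "g'$3$1 = 0" "g'$4$1 = 0"
  using assms(1) unfolding g'_def r_def p_def l_def
  by (simp_all add: elem_rows field_simps)

lemma elim_right:
  assumes "g$1$1 \<noteq> 0" "g$2$1 = 0" "g$3$1 = 0" "g$4$1 = 0"
  defines "b \<equiv> g$1$2 / g$1$1" and "e \<equiv> g$1$4 / g$1$1"
  defines "f \<equiv> ((g ** elem N8 (- b)) ** elem N2 (- e))$1$3 / g$1$1"
  defines "h \<equiv> ((g ** elem N8 (- b)) ** elem N2 (- e)) ** elem N1 (- f)"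
  shows "h$1$1 = g$1$1" "h$2$1 = 0" "h$3$1 = 0" "h$4$1 = 0" "h$1$2 = 0" "h$1$3 = 0" "h$1$4 = 0"
  using assms(1-4) unfolding h_def f_def e_def b_def
  by (simp_all add: elem_cols field_simps)

lemma elem_cancel: "sp_square_zero N \<Longrightarrow> elem N t ** elem N (- t) = mat 1" "sp_square_zero N \<Longrightarrow> elem N (- t) ** elem N t = mat 1"
  using elem_add[of N t "-t"] elem_add[of N "-t" t] by simp_all

lemma elem_cancel_left: "sp_square_zero N \<Longrightarrow> elem N t ** (elem N (- t) ** g) = g"
  by (simp add: matrix_mul_assoc elem_cancel)

lemma elem_cancel_right: "sp_square_zero N \<Longrightarrow> (g ** elem N (- t)) ** elem N t = g"
  by (simp add: elem_cancel flip: matrix_mul_assoc)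

lemma close_mult:
  assumes "mnorm (g - mat 1) \<le> s" "s \<le> 1" "mnorm N \<le> 2" "\<bar>t\<bar> \<le> \<tau>"
  shows "mnorm (elem N t ** g - mat 1) \<le> s + 10 * \<tau>" "mnorm (g ** elem N t - mat 1) \<le> s + 10 * \<tau>"
proof -
  have g: "mnorm g \<le> 5" using mnorm_le[of g] assms by linarith
  have t0: "0 \<le> \<tau>" using assms(4) by linarith
  have "mnorm N * mnorm g \<le> 2 * 5" "mnorm g * mnorm N \<le> 5 * 2" 
    using mult_mono[of "mnorm N" 2 "mnorm g" 5] mult_mono[of "mnorm g" 5 "mnorm N" 2] g assms by auto
  then have b: "mnorm (N ** g) \<le> 10" "mnorm (g ** N) \<le> 10" using mnorm_mult[of N g] mnorm_mult[of g N] by auto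
  have c: "\<bar>t\<bar> * mnorm (N ** g) \<le> \<tau> * 10" "\<bar>t\<bar> * mnorm (g ** N) \<le> \<tau> * 10"
    using mult_mono[of "\<bar>t\<bar>" \<tau> "mnorm (N ** g)" 10] mult_mono[of "\<bar>t\<bar>" \<tau> "mnorm (g ** N)" 10] b assms t0 by auto
  have eq: "elem N t ** g - mat 1 = (g - mat 1) + t *\<^sub>R (N ** g)" "g ** elem N t - mat 1 = (g - mat 1) + t *\<^sub>R (g ** N)"
    by (simp_all add: elem_def mat_add_mult matrix_add_ldistrib mat_scaleR_mult)
  show "mnorm (elem N t ** g - mat 1) \<le> s + 10 * \<tau>"
    unfolding eq using mnorm_add[of "g - mat 1" "t *\<^sub>R (N ** g)"] c assms(1) by (simp add: mnorm_scaleR)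
  show "mnorm (g ** elem N t - mat 1) \<le> s + 10 * \<tau>"
    unfolding eq using mnorm_add[of "g - mat 1" "t *\<^sub>R (g ** N)"] c assms(1) by (simp add: mnorm_scaleR)
qed

lemma close_comp:
  assumes "mnorm (g - mat 1) \<le> s"
  shows "\<bar>g$i$i - 1\<bar> \<le> s" "i \<noteq> j \<Longrightarrow> \<bar>g$i$j\<bar> \<le> s"
  using mnorm_comp[of "g - mat 1" i i] mnorm_comp[of "g - mat 1" i j] assms by (auto simp: mat_def)

lemma abs_div_le: "\<bar>a\<bar> \<le> e \<Longrightarrow> 1/2 \<le> b \<Longrightarrow> \<bar>a / b\<bar> \<le> 2 * (e::real)"
proof -
  assume a: "\<bar>a\<bar> \<le> e" and b: "1/2 \<le> b"
  have "\<bar>a\<bar> / b \<le> e / (1/2)" using a b by (intro frac_le) auto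
  then show ?thesis using b by simp
qed

lemma abs_ln_le: "\<bar>a - 1\<bar> \<le> e \<Longrightarrow> 1/2 \<le> a \<Longrightarrow> \<bar>ln a\<bar> \<le> 2 * (e::real)"
proof -
  assume a: "\<bar>a - 1\<bar> \<le> e" and b: "1/2 \<le> a"
  have 1: "ln a \<le> a - 1" using b by (intro ln_le_minus_one) auto
  have "- ln a = ln (1 / a)" using b by (simp add: ln_div)
  also have "\<dots> \<le> 1 / a - 1" using b by (intro ln_le_minus_one) auto
  also have "\<dots> = (1 - a) / a" using b by (simp add: field_simps)
  also have "\<dots> \<le> \<bar>(1 - a) / a\<bar>" by (rule abs_ge_self)
  also have "\<dots> \<le> 2 * e" using a b by (intro abs_div_le) (simp_all add: abs_minus_commute)
  finally show ?thesis using 1 a by auto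
qed

fun word_prod :: "(real \<Rightarrow> real^4^4) list \<Rightarrow> real list \<Rightarrow> real^4^4" where
  "word_prod (l # ls) (c # cs) = l c ** word_prod ls cs"
| "word_prod _ _ = mat 1"

text \<open>The constant 4 covers both kinds of subgroups: the unipotents, where
  \<open>mnorm N \<le> 2\<close>, and the torus, where two entries each differ from 1 by at most
  \<open>2 * \<bar>t\<bar>\<close>.\<close>

definition letter :: "(real \<Rightarrow> real^4^4) \<Rightarrow> bool" where
  "letter l \<longleftrightarrow> (\<forall>t. l t \<in> Sp4) \<and> l 0 = mat 1 \<and> (\<forall>s t. l (s + t) = l s ** l t) \<and> continuous_on UNIV l
     \<and> (\<forall>t. \<bar>t\<bar> \<le> 1 \<longrightarrow> mnorm (l t - mat 1) \<le> 4 * \<bar>t\<bar>)"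

definition "h1 t = diag4 (exp t) 1"
definition "h2 t = diag4 1 (exp t)"

lemma letter_elem: assumes "sp_square_zero N" "mnorm N \<le> 2" shows "letter (elem N)"
  unfolding letter_def
proof (intro conjI allI impI)
  fix t :: real
  show "mnorm (elem N t - mat 1) \<le> 4 * \<bar>t\<bar>"
    using mult_left_mono[OF assms(2), of "\<bar>t\<bar>"] by (simp add: elem_def mnorm_scaleR)
  show "continuous_on UNIV (elem N)"
    unfolding elem_def[abs_def] by (intro continuous_intros)
qed (use assms elem_Sp4 elem_add in auto)

lemma abs_exp_minus_one: "\<bar>t\<bar> \<le> 1 \<Longrightarrow> \<bar>exp t - 1\<bar> \<le> 2 * \<bar>t::real\<bar>"
proof -
  assume t: "\<bar>t\<bar> \<le> 1"
  show ?thesis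
  proof (cases "t \<ge> 0")
    case True
    then have "exp t \<le> 1 + t + t\<^sup>2" using t by (intro exp_bound) auto
    moreover have "t\<^sup>2 \<le> t" using True t by (simp add: power2_eq_square mult_left_le)
    moreover have "1 \<le> exp t" using True by simp
    ultimately show ?thesis using True by auto
  next
    case False
    moreover have "1 + t \<le> exp t" by (rule exp_ge_add_one_self)
    moreover have "exp t \<le> 1" using False by simp
    ultimately show ?thesis by linarith
  qed
qed

lemma continuous_on_if_const:
  "continuous_on S f \<Longrightarrow> continuous_on S g \<Longrightarrow> continuous_on S (\<lambda>x. if P then f x else g x)"
  by (cases P) auto

lemma letter_h: "letter h1" "letter h2"
proof -
  have c: "continuous_on UNIV h1" "continuous_on UNIV h2"
    unfolding h1_def[abs_def] h2_def[abs_def] diag4_def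
    by (intro continuous_on_vec_lambda continuous_on_if_const continuous_intros; simp)+
  have m: "mnorm (h1 t - mat 1) = \<bar>exp t - 1\<bar> + \<bar>exp (- t) - 1\<bar>" "mnorm (h2 t - mat 1) = \<bar>exp t - 1\<bar> + \<bar>exp (- t) - 1\<bar>" for t
    by (simp_all add: mnorm_def sum_4 h1_def h2_def diag4_def mat_def exp_minus divide_inverse)
  have b: "\<bar>exp t - 1\<bar> + \<bar>exp (- t) - 1\<bar> \<le> 4 * \<bar>t\<bar>" if "\<bar>t\<bar> \<le> 1" for t :: real
    using abs_exp_minus_one[of t] abs_exp_minus_one[of "-t"] that by simp
  have a: "h1 (s + t) = h1 s ** h1 t" "h2 (s + t) = h2 s ** h2 t" for s t
    by (simp_all add: h1_def h2_def mat_simps exp_add)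
  have o: "h1 0 = mat 1" "h2 0 = mat 1" by (simp_all add: h1_def h2_def mat_simps)
  show "letter h1" "letter h2"
    unfolding letter_def using c b a o by (auto simp: m) (auto simp: h1_def h2_def diag4_Sp4)
qed

text \<open>The order is that of the factors in \<open>elimination\<close>, with those of
  \<open>block_form\<close> in the middle; their number is the dimension of the group.\<close>

definition "letters = [elem N4, elem N6, elem N5, h1, elem N7, h2, elem N3, elem N1, elem N2, elem N8]"

lemma letters: "\<forall>l\<in>set letters. letter l"
  unfolding letters_def using letter_h letter_elem sp_square_zero_N mnorm_N by auto

lemma elimination:
  assumes g: "g \<in> Sp4" and nz: "g$1$1 \<noteq> 0"
  obtains l p r b e f h where
    "l = g$2$1 / g$1$1" "p = g$4$1 / g$1$1" "r = (g$3$1 + l * g$4$1) / g$1$1"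
    "b = (elem N5 (- r) ** (elem N6 (- p) ** (elem N4 (- l) ** g)))$1$2 / g$1$1"
    "e = (elem N5 (- r) ** (elem N6 (- p) ** (elem N4 (- l) ** g)))$1$4 / g$1$1"
    "f = (((elem N5 (- r) ** (elem N6 (- p) ** (elem N4 (- l) ** g))) ** elem N8 (- b)) ** elem N2 (- e))$1$3 / g$1$1"
    "h = (((elem N5 (- r) ** (elem N6 (- p) ** (elem N4 (- l) ** g))) ** elem N8 (- b)) ** elem N2 (- e)) ** elem N1 (- f)"
    "h \<in> Sp4" "h$1$1 = g$1$1" "h$1$2 = 0" "h$1$3 = 0" "h$1$4 = 0" "h$2$1 = 0" "h$3$1 = 0" "h$4$1 = 0"
    "g = elem N4 l ** (elem N6 p ** (elem N5 r ** (((h ** elem N1 f) ** elem N2 e) ** elem N8 b)))"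
proof -
  define l p where "l = g$2$1 / g$1$1" and "p = g$4$1 / g$1$1"
  define r where "r = (g$3$1 + l * g$4$1) / g$1$1"
  define g' where "g' = elem N5 (- r) ** (elem N6 (- p) ** (elem N4 (- l) ** g))"
  define b e where "b = g'$1$2 / g$1$1" and "e = g'$1$4 / g$1$1"
  define f where "f = ((g' ** elem N8 (- b)) ** elem N2 (- e))$1$3 / g$1$1"
  define h where "h = ((g' ** elem N8 (- b)) ** elem N2 (- e)) ** elem N1 (- f)"
  have g': "g'$1$1 = g$1$1" "g'$2$1 = 0" "g'$3$1 = 0" "g'$4$1 = 0"
    using elim_left[OF nz] by (simp_all add: g'_def r_def p_def l_def)
  have h: "h$1$1 = g'$1$1" "h$2$1 = 0" "h$3$1 = 0" "h$4$1 = 0" "h$1$2 = 0" "h$1$3 = 0" "h$1$4 = 0"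
    using elim_right[of g'] nz g' by (simp_all add: h_def f_def e_def b_def)
  have hS: "h \<in> Sp4" unfolding h_def g'_def by (intro Sp4_mult elem_Sp4 sp_square_zero_N g)
  have "((h ** elem N1 f) ** elem N2 e) ** elem N8 b = g'"
    unfolding h_def by (simp add: elem_cancel_right sp_square_zero_N)
  then have geq: "g = elem N4 l ** (elem N6 p ** (elem N5 r ** (((h ** elem N1 f) ** elem N2 e) ** elem N8 b)))"
    by (simp add: g'_def elem_cancel_left sp_square_zero_N)
  have h11: "h$1$1 = g$1$1" using h(1) g'(1) by (rule trans)
  show thesis
    by (rule that[OF l_def p_def r_def b_def[unfolded g'_def] e_def[unfolded g'_def] f_def[unfolded g'_def]
          h_def[unfolded g'_def] hS h11 h(5-7) h(2-4) geq])
qed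

text \<open>Elimination with error tracking. A multiplication adds 10 times its parameter to the
  distance from 1, and dividing by a pivot of at least 1/2 at most doubles an entry. The distance
  grows through 81s, 3321s and 69741s, and twice the last is below 200000s; the bound on
  \<open>s\<close> keeps the pivots above 1/2.\<close>

lemma local_coordinates:
  assumes g: "g \<in> Sp4" and s: "mnorm (g - mat 1) \<le> s" "s \<le> 1 / 1000000"
  shows "\<exists>cs. length cs = length letters \<and> (\<forall>c\<in>set cs. \<bar>c\<bar> \<le> 200000 * s) \<and> g = word_prod letters cs"
proof -
  have s0: "0 \<le> s" using s(1) mnorm_nonneg[of "g - mat 1"] by linarith
  have g11: "1/2 \<le> g$1$1" using close_comp(1)[OF s(1), of 1] s(2) by linarith
  then have nz: "g$1$1 \<noteq> 0" by auto
  obtain l p r b e f h where lp: "l = g$2$1 / g$1$1" "p = g$4$1 / g$1$1" and r: "r = (g$3$1 + l * g$4$1) / g$1$1" and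
    b: "b = (elem N5 (- r) ** (elem N6 (- p) ** (elem N4 (- l) ** g)))$1$2 / g$1$1" and
    e: "e = (elem N5 (- r) ** (elem N6 (- p) ** (elem N4 (- l) ** g)))$1$4 / g$1$1" and
    f: "f = (((elem N5 (- r) ** (elem N6 (- p) ** (elem N4 (- l) ** g))) ** elem N8 (- b)) ** elem N2 (- e))$1$3 / g$1$1" and
    h: "h = (((elem N5 (- r) ** (elem N6 (- p) ** (elem N4 (- l) ** g))) ** elem N8 (- b)) ** elem N2 (- e)) ** elem N1 (- f)" and
    hS: "h \<in> Sp4" and h1: "h$1$1 = g$1$1" and hz: "h$1$2 = 0" "h$1$3 = 0" "h$1$4 = 0" "h$2$1 = 0" "h$3$1 = 0" "h$4$1 = 0" and
    geq: "g = elem N4 l ** (elem N6 p ** (elem N5 r ** (((h ** elem N1 f) ** elem N2 e) ** elem N8 b)))"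
    by (rule elimination[OF g nz])
  have l': "\<bar>l\<bar> \<le> 2 * s" "\<bar>p\<bar> \<le> 2 * s"
    unfolding lp by (rule abs_div_le[OF close_comp(2)[OF s(1)] g11]; simp)+
  have "\<bar>l * g$4$1\<bar> \<le> 1 * s"
    unfolding abs_mult using l' s close_comp(2)[OF s(1), of 4 1] by (intro mult_mono) auto
  then have r': "\<bar>r\<bar> \<le> 2 * (2 * s)"
    unfolding r using close_comp(2)[OF s(1), of 3 1] g11 by (intro abs_div_le) auto
  define g' where "g' = elem N5 (- r) ** (elem N6 (- p) ** (elem N4 (- l) ** g))"
  have 1: "mnorm (elem N4 (- l) ** g - mat 1) \<le> s + 10 * (2 * s)"
    using l' s mnorm_N by (intro close_mult) auto
  have 2: "mnorm (elem N6 (- p) ** (elem N4 (- l) ** g) - mat 1) \<le> (s + 10 * (2 * s)) + 10 * (2 * s)"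
    using l' s mnorm_N by (intro close_mult(1)[OF 1]) auto
  have 3: "mnorm (g' - mat 1) \<le> ((s + 10 * (2 * s)) + 10 * (2 * s)) + 10 * (2 * (2 * s))"
    unfolding g'_def using r' s mnorm_N by (intro close_mult(1)[OF 2]) auto
  then have 3: "mnorm (g' - mat 1) \<le> 81 * s" by simp
  have b': "\<bar>b\<bar> \<le> 2 * (81 * s)" "\<bar>e\<bar> \<le> 2 * (81 * s)"
    unfolding b e g'_def[symmetric] by (rule abs_div_le[OF close_comp(2)[OF 3] g11]; simp)+
  have 4: "mnorm (g' ** elem N8 (- b) - mat 1) \<le> 81 * s + 10 * (2 * (81 * s))"
    using b' s mnorm_N by (intro close_mult(2)[OF 3]) auto
  have "mnorm ((g' ** elem N8 (- b)) ** elem N2 (- e) - mat 1) \<le> (81 * s + 10 * (2 * (81 * s))) + 10 * (2 * (81 * s))"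
    using b' s mnorm_N by (intro close_mult(2)[OF 4]) auto
  then have 5: "mnorm ((g' ** elem N8 (- b)) ** elem N2 (- e) - mat 1) \<le> 3321 * s" by simp
  have f': "\<bar>f\<bar> \<le> 2 * (3321 * s)"
    unfolding f g'_def[symmetric] by (rule abs_div_le[OF close_comp(2)[OF 5] g11]; simp)
  have "mnorm (h - mat 1) \<le> 3321 * s + 10 * (2 * (3321 * s))"
    unfolding h g'_def[symmetric] using f' s mnorm_N by (intro close_mult(2)[OF 5]) auto
  then have 6: "mnorm (h - mat 1) \<le> 69741 * s" by simp
  have h22: "1/2 \<le> h$2$2" using close_comp(1)[OF 6, of 2] s(2) by linarith
  have yz: "\<bar>h$4$2 / h$2$2\<bar> \<le> 2 * (69741 * s)" "\<bar>h$2$4 / h$2$2\<bar> \<le> 2 * (69741 * s)"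
    by (rule abs_div_le[OF close_comp(2)[OF 6] h22]; simp)+
  have ln: "\<bar>ln (h$1$1)\<bar> \<le> 2 * (69741 * s)" "\<bar>ln (h$2$2)\<bar> \<le> 2 * (69741 * s)"
    by (rule abs_ln_le[OF close_comp(1)[OF 6]], use h22 g11 h1 in simp)+
  let ?cs = "[l, p, r, ln (h$1$1), h$4$2 / h$2$2, ln (h$2$2), h$2$4 / h$2$2, f, e, b]"
  have heq: "h = h1 (ln (h$1$1)) ** (elem N7 (h$4$2 / h$2$2) ** (h2 (ln (h$2$2)) ** elem N3 (h$2$4 / h$2$2)))"
    using block_form[OF hS _ _ hz] h22 g11 h1 by (simp add: h1_def h2_def)
  then have "((h ** elem N1 f) ** elem N2 e) ** elem N8 b = h1 (ln (h$1$1)) ** (elem N7 (h$4$2 / h$2$2) ** (h2 (ln (h$2$2)) **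
      (elem N3 (h$2$4 / h$2$2) ** (elem N1 f ** (elem N2 e ** elem N8 b)))))"
    using arg_cong[where f = "\<lambda>m. ((m ** elem N1 f) ** elem N2 e) ** elem N8 b", OF heq] by (simp only: matrix_mul_assoc)
  then have "g = word_prod letters ?cs"
    by (subst geq) (simp add: letters_def)
  moreover have "\<forall>c\<in>set ?cs. \<bar>c\<bar> \<le> 200000 * s"
    unfolding list.set ball_simps using s0
    by (intro conjI TrueI order_trans[OF l'(1)] order_trans[OF l'(2)] order_trans[OF r'] order_trans[OF b'(1)]
        order_trans[OF b'(2)] order_trans[OF f'] order_trans[OF yz(1)] order_trans[OF yz(2)] order_trans[OF ln(1)] order_trans[OF ln(2)]) simp_all
  ultimately show ?thesis by (intro exI[of _ ?cs]) (simp add: letters_def)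
qed

lemma word_prod_close:
  assumes "\<forall>l\<in>set ls. letter l"
  shows "\<exists>K\<ge>0. \<forall>cs \<rho>. length cs = length ls \<longrightarrow> (\<forall>c\<in>set cs. \<bar>c\<bar> \<le> \<rho>) \<longrightarrow> 0 \<le> \<rho> \<longrightarrow> \<rho> \<le> 1 \<longrightarrow> mnorm (word_prod ls cs - mat 1) \<le> K * \<rho>"
  using assms
proof (induction ls)
  case Nil then show ?case by auto
next
  case (Cons l ls)
  then obtain K where K: "K \<ge> 0" "\<And>cs \<rho>. length cs = length ls \<Longrightarrow> (\<forall>c\<in>set cs. \<bar>c\<bar> \<le> \<rho>) \<Longrightarrow> 0 \<le> \<rho> \<Longrightarrow> \<rho> \<le> 1 \<Longrightarrow> mnorm (word_prod ls cs - mat 1) \<le> K * \<rho>"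
    by auto
  show ?case
  proof (intro exI[of _ "4 * (4 + K) + K"] conjI allI impI)
    fix cs and \<rho> :: real
    assume len: "length cs = length (l # ls)" and c: "\<forall>c\<in>set cs. \<bar>c\<bar> \<le> \<rho>" and \<rho>: "0 \<le> \<rho>" "\<rho> \<le> 1"
    then obtain c0 cs' where cs: "cs = c0 # cs'" by (cases cs) auto
    let ?P = "word_prod ls cs'"
    have P: "mnorm (?P - mat 1) \<le> K * \<rho>" using K(2) len c \<rho> cs by auto
    have "K * \<rho> \<le> K" using K \<rho> by (simp add: mult_left_le)
    then have P4: "mnorm ?P \<le> 4 + K" using P mnorm_le[of ?P] by linarith
    have "mnorm (l c0 - mat 1) \<le> 4 * \<bar>c0\<bar>" using Cons.prems c \<rho> cs by (auto simp: letter_def)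
    also have "\<dots> \<le> 4 * \<rho>" using c cs by simp
    finally have "mnorm (l c0 - mat 1) * mnorm ?P \<le> (4 * \<rho>) * (4 + K)" using P4 \<rho> by (intro mult_mono) auto
    moreover have "l c0 ** ?P - mat 1 = (l c0 - mat 1) ** ?P + (?P - mat 1)"
      using mat_add_mult[of "l c0 - mat 1" "mat 1" ?P] by simp
    ultimately show "mnorm (word_prod (l # ls) cs - mat 1) \<le> (4 * (4 + K) + K) * \<rho>"
      using mnorm_add[of "(l c0 - mat 1) ** ?P" "?P - mat 1"] mnorm_mult[of "l c0 - mat 1" ?P] P
      by (simp add: cs algebra_simps)
  qed (use K in auto)
qed

text \<open>Merging two words letter by letter requires only commutators, and the commutator of two
  matrices is unchanged when 1 is subtracted from each; so the error is bilinear in the distances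
  from 1.\<close>

lemma word_prod_quasi_additive:
  assumes "\<forall>l\<in>set ls. letter l"
  shows "\<exists>K\<ge>0. \<forall>cs ts s \<rho>. length cs = length ls \<longrightarrow> length ts = length ls \<longrightarrow> (\<forall>c\<in>set cs. \<bar>c\<bar> \<le> s) \<longrightarrow> (\<forall>t\<in>set ts. \<bar>t\<bar> \<le> \<rho>) \<longrightarrow>
    0 \<le> s \<longrightarrow> s \<le> 1 \<longrightarrow> 0 \<le> \<rho> \<longrightarrow> \<rho> \<le> 1 \<longrightarrow> mnorm (word_prod ls cs ** word_prod ls ts - word_prod ls (map2 (+) cs ts)) \<le> K * (s * \<rho>)"
  using assms
proof (induction ls)
  case Nil then show ?case by auto
next
  case (Cons l ls)
  then obtain K where K: "K \<ge> 0" "\<And>cs ts s \<rho>. length cs = length ls \<Longrightarrow> length ts = length ls \<Longrightarrow> (\<forall>c\<in>set cs. \<bar>c\<bar> \<le> s) \<Longrightarrow> (\<forall>t\<in>set ts. \<bar>t\<bar> \<le> \<rho>) \<Longrightarrow>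
    0 \<le> s \<Longrightarrow> s \<le> 1 \<Longrightarrow> 0 \<le> \<rho> \<Longrightarrow> \<rho> \<le> 1 \<Longrightarrow> mnorm (word_prod ls cs ** word_prod ls ts - word_prod ls (map2 (+) cs ts)) \<le> K * (s * \<rho>)"
    by auto
  obtain K' where K': "K' \<ge> 0" "\<And>cs \<rho>. length cs = length ls \<Longrightarrow> (\<forall>c\<in>set cs. \<bar>c\<bar> \<le> \<rho>) \<Longrightarrow> 0 \<le> \<rho> \<Longrightarrow> \<rho> \<le> 1 \<Longrightarrow> mnorm (word_prod ls cs - mat 1) \<le> K' * \<rho>"
    using word_prod_close[of ls] Cons.prems by auto
  show ?case
  proof (intro exI[of _ "8 * (8 * K') * (4 + K') + 64 * K"] conjI allI impI)
    fix cs ts and s \<rho> :: real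
    assume len: "length cs = length (l # ls)" "length ts = length (l # ls)"
      and c: "\<forall>c\<in>set cs. \<bar>c\<bar> \<le> s" "\<forall>t\<in>set ts. \<bar>t\<bar> \<le> \<rho>" and s: "0 \<le> s" "s \<le> 1" and \<rho>: "0 \<le> \<rho>" "\<rho> \<le> 1"
    obtain c0 cs' where cs: "cs = c0 # cs'" using len by (cases cs) auto
    obtain t0 ts' where ts: "ts = t0 # ts'" using len by (cases ts) auto
    let ?P = "word_prod ls cs'" and ?Q = "word_prod ls ts'" and ?R = "word_prod ls (map2 (+) cs' ts')"
    have l: "letter l" using Cons.prems by simp
    have lc: "mnorm (l c0 - mat 1) \<le> 4" "mnorm (l t0 - mat 1) \<le> 4 * \<rho>"
    proof -
      have "\<bar>c0\<bar> \<le> s" "\<bar>t0\<bar> \<le> \<rho>" using c cs ts by auto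
      moreover have "\<bar>t\<bar> \<le> 1 \<Longrightarrow> mnorm (l t - mat 1) \<le> 4 * \<bar>t\<bar>" for t using l by (simp add: letter_def)
      ultimately have "mnorm (l c0 - mat 1) \<le> 4 * \<bar>c0\<bar>" "mnorm (l t0 - mat 1) \<le> 4 * \<bar>t0\<bar>" "\<bar>c0\<bar> \<le> 1" "\<bar>t0\<bar> \<le> \<rho>"
        using s \<rho> by auto
      then show "mnorm (l c0 - mat 1) \<le> 4" "mnorm (l t0 - mat 1) \<le> 4 * \<rho>"
        by linarith+
    qed
    have l8: "mnorm (l c0) \<le> 8" "mnorm (l t0) \<le> 8"
      using lc \<rho> mnorm_le[of "l c0"] mnorm_le[of "l t0"] by auto
    have P: "mnorm (?P - mat 1) \<le> K' * s" "mnorm (?Q - mat 1) \<le> K' * \<rho>" using K'(2) len c s \<rho> cs ts by auto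
    have "K' * \<rho> \<le> K'" using K' \<rho> by (simp add: mult_left_le)
    then have Q4: "mnorm ?Q \<le> 4 + K'" using P mnorm_le[of ?Q] by linarith
    have com: "mnorm (?P ** l t0 - l t0 ** ?P) \<le> 8 * K' * (s * \<rho>)"
    proof -
      have "?P ** l t0 - l t0 ** ?P = (?P - mat 1) ** (l t0 - mat 1) - (l t0 - mat 1) ** (?P - mat 1)"
        by (simp add: vec_eq_iff matrix_matrix_mult_def sum_4 mat_def forall_4 algebra_simps)
      then have "mnorm (?P ** l t0 - l t0 ** ?P) \<le> mnorm (?P - mat 1) * mnorm (l t0 - mat 1) + mnorm (l t0 - mat 1) * mnorm (?P - mat 1)"
        using mnorm_diff[of "(?P - mat 1) ** (l t0 - mat 1)"] mnorm_mult[of "?P - mat 1" "l t0 - mat 1"]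
          mnorm_mult[of "l t0 - mat 1" "?P - mat 1"] by (smt (verit))
      also have "\<dots> \<le> (K' * s) * (4 * \<rho>) + (4 * \<rho>) * (K' * s)"
        using P lc K' s \<rho> by (intro add_mono mult_mono) auto
      finally show ?thesis by (simp add: algebra_simps)
    qed
    have eq: "(l c0 ** ?P) ** (l t0 ** ?Q) - l (c0 + t0) ** ?R
      = l c0 ** ((?P ** l t0 - l t0 ** ?P) ** ?Q) + (l c0 ** l t0) ** (?P ** ?Q - ?R)"
    proof -
      have ll: "l (c0 + t0) = l c0 ** l t0" using l by (simp add: letter_def)
      have sub: "A ** (B - C) = A ** B - A ** C" "(B - C) ** A = B ** A - C ** A" for A B C :: "real^4^4"
        using matrix_add_ldistrib[of A B "- C"] mat_add_mult[of B "- C" A] by (simp_all add: mat_neg_mult)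
      show ?thesis unfolding ll sub by (simp add: matrix_mul_assoc)
    qed
    have "mnorm (l c0 ** ((?P ** l t0 - l t0 ** ?P) ** ?Q)) \<le> 8 * ((8 * K' * (s * \<rho>)) * (4 + K'))"
      using l8 com Q4 K' s \<rho> by (intro order_trans[OF mnorm_mult] mult_mono order_trans[OF mnorm_mult[of _ ?Q]]) auto
    moreover have "mnorm ((l c0 ** l t0) ** (?P ** ?Q - ?R)) \<le> (8 * 8) * (K * (s * \<rho>))"
      using l8 K s \<rho> len c cs ts by (intro order_trans[OF mnorm_mult] mult_mono order_trans[OF mnorm_mult[of "l c0"]] K(2)) auto
    ultimately show "mnorm (word_prod (l # ls) cs ** word_prod (l # ls) ts - word_prod (l # ls) (map2 (+) cs ts)) \<le> (8 * (8 * K') * (4 + K') + 64 * K) * (s * \<rho>)"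
      using mnorm_add[of "l c0 ** ((?P ** l t0 - l t0 ** ?P) ** ?Q)" "(l c0 ** l t0) ** (?P ** ?Q - ?R)"]
      by (simp add: cs ts eq algebra_simps)
  qed (use K K' in auto)
qed

lemma word_prod_Sp4: "\<forall>l\<in>set ls. letter l \<Longrightarrow> word_prod ls cs \<in> Sp4"
proof (induction ls cs rule: word_prod.induct)
  case (1 l ls c cs)
  have "l c \<in> Sp4" using 1(2) by (simp add: letter_def)
  moreover have "word_prod ls cs \<in> Sp4" using 1 by simp
  ultimately show ?case by (simp add: Sp4_mult)
qed auto

lemma le_double: "p \<le> x \<Longrightarrow> y = x + x \<Longrightarrow> p + e + x \<le> y + (e::real)"
  by simp

section \<open>Smoothing of almost fixed points\<close>

locale sp4_action =
  fixes \<alpha> :: "real^4^4 \<Rightarrow> 'a::banach \<Rightarrow> 'a"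
  assumes uc: "uniformly_convex TYPE('a)"
    and act: "continuous_isometric_action_Sp4 \<alpha>"
begin

lemma act_1 [simp]: "\<alpha> (mat 1) v = v"
  using act by (simp add: continuous_isometric_action_Sp4_def)

lemma act_mult: "g \<in> Sp4 \<Longrightarrow> h \<in> Sp4 \<Longrightarrow> \<alpha> (g ** h) v = \<alpha> g (\<alpha> h v)"
  using act by (simp add: continuous_isometric_action_Sp4_def)

lemma act_iso: "g \<in> Sp4 \<Longrightarrow> norm (\<alpha> g u - \<alpha> g v) = norm (u - v)"
  using act by (simp add: continuous_isometric_action_Sp4_def dist_norm)

lemma act_cont: "continuous_on (Sp4 \<times> UNIV) (\<lambda>(g, x). \<alpha> g x)"
  using act by (simp add: continuous_isometric_action_Sp4_def)

lemma act_nonexp: "g \<in> Sp4 \<Longrightarrow> nonexp (\<alpha> g)"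
  by (rule isometry_nonexp[OF uc act_iso])

lemma letter_isom_flow:
  assumes "letter l" shows "isom_flow (\<lambda>t. \<alpha> (l t))"
  unfolding isom_flow_def
proof (intro conjI allI)
  note l = assms[unfolded letter_def]
  show "nonexp (\<alpha> (l t))" for t using l act_nonexp by auto
  show "\<alpha> (l 0) v = v" for v using l by simp
  show "\<alpha> (l (s + t)) v = \<alpha> (l s) (\<alpha> (l t) v)" for s t v using l act_mult by auto
  fix v :: 'a
  have "continuous_on UNIV (\<lambda>t. (l t, v))" using l by (intro continuous_intros) auto
  from continuous_on_compose2[OF act_cont this] l
  show "continuous_on UNIV (\<lambda>t. \<alpha> (l t) v)" by auto
qed

lemma displacement_mult:
  assumes "g \<in> Sp4" "h \<in> Sp4" "norm (\<alpha> g v - v) \<le> a" "norm (\<alpha> h v - v) \<le> b"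
  shows "norm (\<alpha> (g ** h) v - v) \<le> a + b"
  using norm_chain3[of "\<alpha> g (\<alpha> h v)" "\<alpha> g v" b v a] assms by (simp add: act_mult act_iso add.commute)

fun box_avg :: "(real \<Rightarrow> real^4^4) list \<Rightarrow> real \<Rightarrow> 'a \<Rightarrow> 'a" where
  "box_avg [] \<rho> v = v"
| "box_avg (l # ls) \<rho> v = avg (\<lambda>t. \<alpha> (l t)) \<rho> (box_avg ls \<rho> v)"

text \<open>The average over a translated box: the parameter of each letter runs from
  \<open>c\<close> to \<open>c + \<rho>\<close>.\<close>

fun shifted_box_avg :: "(real \<Rightarrow> real^4^4) list \<Rightarrow> real list \<Rightarrow> real \<Rightarrow> 'a \<Rightarrow> 'a" where
  "shifted_box_avg (l # ls) (c # cs) \<rho> v = \<alpha> (l c) (avg (\<lambda>t. \<alpha> (l t)) \<rho> (shifted_box_avg ls cs \<rho> v))"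
| "shifted_box_avg _ _ \<rho> v = v"

text \<open>Both averages are compared at the same point \<open>ts\<close> of the box. The outer
  maps \<open>H\<close> and \<open>K\<close> are general so that the induction can push the letters
  already treated into them.\<close>

lemma box_avg_shifted_box_avg_near:
  assumes "\<forall>l\<in>set ls. letter l" "length cs = length ls" "0 \<le> \<rho>" "nonexp H" "nonexp K"
    and "\<And>ts. length ts = length ls \<Longrightarrow> (\<forall>t\<in>set ts. \<bar>t\<bar> \<le> \<rho>) \<Longrightarrow> norm (H (\<alpha> (word_prod ls ts) v) - K (\<alpha> (word_prod ls (map2 (+) cs ts)) v)) \<le> e"
  shows "norm (H (box_avg ls \<rho> v) - K (shifted_box_avg ls cs \<rho> v)) \<le> e"
  using assms
proof (induction ls arbitrary: cs H K)
  case Nil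
  then show ?case using Nil(6)[of "[]"] by simp
next
  case (Cons l ls)
  obtain c cs' where cs: "cs = c # cs'" using Cons.prems(2) by (cases cs) auto
  have l: "letter l" and ls: "\<forall>l\<in>set ls. letter l" using Cons.prems by auto
  then have lS: "l t \<in> Sp4" for t by (auto simp: letter_def)
  have ladd: "l (c + t) = l c ** l t" for t using l by (simp add: letter_def)
  have nK: "nonexp (\<lambda>v. K (\<alpha> (l c) v))" by (rule nonexp_compose[OF Cons.prems(5) act_nonexp[OF lS]])
  have "norm (H (avg (\<lambda>t. \<alpha> (l t)) \<rho> (box_avg ls \<rho> v)) - K (\<alpha> (l c) (avg (\<lambda>t. \<alpha> (l t)) \<rho> (shifted_box_avg ls cs' \<rho> v)))) \<le> e"
  proof (rule avg_near2[where g = "\<lambda>v. K (\<alpha> (l c) v)", OF letter_isom_flow[OF l] Cons.prems(4) nK])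
    fix t :: real assume t: "0 \<le> t" "t \<le> 1"
    define t' where "t' = \<rho> * t"
    have t': "\<bar>t'\<bar> \<le> \<rho>" using t Cons.prems(3) by (simp add: t'_def abs_mult mult_left_le)
    have "norm ((\<lambda>v. H (\<alpha> (l t') v)) (box_avg ls \<rho> v) - (\<lambda>v. K (\<alpha> (l c) (\<alpha> (l t') v))) (shifted_box_avg ls cs' \<rho> v)) \<le> e"
    proof (rule Cons.IH[OF ls _ Cons.prems(3)])
      show "length cs' = length ls" using Cons.prems(2) cs by simp
      show "nonexp (\<lambda>v. H (\<alpha> (l t') v))" by (rule nonexp_compose[OF Cons.prems(4) act_nonexp[OF lS]])
      show "nonexp (\<lambda>v. K (\<alpha> (l c) (\<alpha> (l t') v)))" by (rule nonexp_compose[OF nK act_nonexp[OF lS]])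
      fix ts assume ts: "length ts = length ls" "\<forall>t\<in>set ts. \<bar>t\<bar> \<le> \<rho>"
      have "norm (H (\<alpha> (word_prod (l # ls) (t' # ts)) v) - K (\<alpha> (word_prod (l # ls) (map2 (+) cs (t' # ts))) v)) \<le> e"
        by (rule Cons.prems(6)) (use ts t' in auto)
      then show "norm (H (\<alpha> (l t') (\<alpha> (word_prod ls ts) v)) - K (\<alpha> (l c) (\<alpha> (l t') (\<alpha> (word_prod ls (map2 (+) cs' ts)) v)))) \<le> e"
        by (simp add: cs ladd act_mult lS Sp4_mult word_prod_Sp4 ls)
    qed
    then show "norm (H (\<alpha> (l (\<rho> * t)) (box_avg ls \<rho> v)) - K (\<alpha> (l c) (\<alpha> (l (\<rho> * t)) (shifted_box_avg ls cs' \<rho> v)))) \<le> e"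
      by (simp add: t'_def)
  qed
  then show ?case by (simp add: cs)
qed

text \<open>Quantifying over all \<open>g\<close> in a ball around 1 makes closeness to
  \<open>x\<close> pass to averages over small boxes, at the price of a smaller ball, see
  \<open>near_avg\<close>.\<close>

definition near :: "'a \<Rightarrow> real \<Rightarrow> real \<Rightarrow> 'a \<Rightarrow> bool" where
  "near x \<delta> \<tau> v \<longleftrightarrow> (\<forall>g\<in>Sp4. mnorm (g - mat 1) \<le> \<tau> \<longrightarrow> norm (\<alpha> g v - x) \<le> \<delta>)"

lemma near_mono: "near x \<delta> \<tau> v \<Longrightarrow> \<tau>' \<le> \<tau> \<Longrightarrow> near x \<delta> \<tau>' v"
  unfolding near_def by force

lemma near_disp:
  assumes "near x \<delta> \<tau> v" "g \<in> Sp4" "mnorm (g - mat 1) \<le> \<tau>" "0 \<le> \<tau>"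
  shows "norm (\<alpha> g v - v) \<le> 2 * \<delta>"
proof -
  have "norm (\<alpha> g v - x) \<le> \<delta>" "norm (\<alpha> (mat 1) v - x) \<le> \<delta>"
    using assms unfolding near_def by (auto simp del: act_1)
  then show ?thesis using norm_chain3[of "\<alpha> g v" x \<delta> v \<delta>] by (simp add: norm_minus_commute)
qed

lemma near_avg:
  assumes n: "near x \<delta> \<tau> v" and l: "letter l" and \<rho>: "0 \<le> \<rho>" "\<rho> \<le> 1" and \<tau>: "\<tau> \<le> 1"
  shows "near x \<delta> (\<tau> - 8 * \<rho>) (avg (\<lambda>t. \<alpha> (l t)) \<rho> v)"
  unfolding near_def
proof (intro ballI impI)
  fix g assume g: "g \<in> Sp4" "mnorm (g - mat 1) \<le> \<tau> - 8 * \<rho>"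
  show "norm (\<alpha> g (avg (\<lambda>t. \<alpha> (l t)) \<rho> v) - x) \<le> \<delta>"
  proof (rule avg_near1[where f = "\<alpha> g", OF letter_isom_flow[OF l] act_nonexp[OF g(1)]])
    fix t :: real assume t: "0 \<le> t" "t \<le> 1"
    let ?h = "l (\<rho> * t)"
    have h: "?h \<in> Sp4" using l by (simp add: letter_def)
    have rt: "\<bar>\<rho> * t\<bar> \<le> \<rho>" using t \<rho> by (simp add: abs_mult mult_left_le)
    then have "mnorm (?h - mat 1) \<le> 4 * \<bar>\<rho> * t\<bar>" using l \<rho> by (simp add: letter_def)
    then have hh: "mnorm (?h - mat 1) \<le> 4 * \<rho>" using rt by linarith
    have "mnorm (g - mat 1) * mnorm (?h - mat 1) \<le> 1 * (4 * \<rho>)"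
      using g \<tau> \<rho> hh by (intro mult_mono) auto
    moreover have eq: "g ** ?h - mat 1 = (g - mat 1) + (g - mat 1) ** (?h - mat 1) + (?h - mat 1)"
      by (simp add: vec_eq_iff matrix_matrix_mult_def sum_4 mat_def forall_4 algebra_simps)
    ultimately have "mnorm (g ** ?h - mat 1) \<le> \<tau>"
      unfolding eq using mnorm_add[of "(g - mat 1) + (g - mat 1) ** (?h - mat 1)" "?h - mat 1"]
        mnorm_add[of "g - mat 1" "(g - mat 1) ** (?h - mat 1)"] mnorm_mult[of "g - mat 1" "?h - mat 1"] hh g(2) by simp
    then show "norm (\<alpha> g (\<alpha> ?h v) - x) \<le> \<delta>"
      using n g h by (simp add: near_def act_mult[symmetric] Sp4_mult)
  qed
qed

lemma near_box_avg:
  assumes "\<forall>l\<in>set ls. letter l" "near x \<delta> \<tau> v" "0 \<le> \<rho>" "\<rho> \<le> 1" "\<tau> \<le> 1"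
  shows "near x \<delta> (\<tau> - 8 * \<rho> * real (length ls)) (box_avg ls \<rho> v)"
  using assms
proof (induction ls)
  case (Cons l ls)
  have "near x \<delta> ((\<tau> - 8 * \<rho> * real (length ls)) - 8 * \<rho>) (avg (\<lambda>t. \<alpha> (l t)) \<rho> (box_avg ls \<rho> v))"
    using Cons by (intro near_avg) (auto intro: order_trans[of _ \<tau>])
  then show ?case by (simp add: algebra_simps)
qed simp

text \<open>One coordinate at a time: translating a segment of length \<rho> by at most
  \<open>s\<close> costs \<open>s / \<rho>\<close> times a displacement, which \<open>near\<close>
  bounds by \<open>2 * \<delta>\<close>.\<close>

lemma shifted_box_avg_near:
  assumes "\<forall>l\<in>set ls. letter l" "near x \<delta> \<tau> v" "0 < \<rho>" "\<rho> \<le> 1" "\<tau> \<le> 1" "0 \<le> \<delta>"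
    "length cs = length ls" "\<forall>c\<in>set cs. \<bar>c\<bar> \<le> s" "8 * \<rho> * (real (length ls) + 1) \<le> \<tau>"
  shows "norm (shifted_box_avg ls cs \<rho> v - box_avg ls \<rho> v) \<le> real (length ls) * (s / \<rho> * (2 * \<delta>))"
  using assms
proof (induction ls arbitrary: cs)
  case (Cons l ls)
  obtain c cs' where cs: "cs = c # cs'" using Cons.prems by (cases cs) auto
  have l: "letter l" using Cons.prems by simp
  let ?h = "\<lambda>t. \<alpha> (l t)" and ?q = "box_avg ls \<rho> v"
  note o = letter_isom_flow[OF l]
  have "8 * \<rho> * (real (length ls) + 1) \<le> 8 * \<rho> * (real (length (l # ls)) + 1)"
    using Cons.prems by (intro mult_left_mono) auto
  also have "\<dots> \<le> \<tau>" by (rule Cons.prems(9))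
  finally have rl: "8 * \<rho> * (real (length ls) + 1) \<le> \<tau>" .
  have "norm (shifted_box_avg ls cs' \<rho> v - ?q) \<le> real (length ls) * (s / \<rho> * (2 * \<delta>))"
    using Cons.prems cs rl by (intro Cons.IH) auto
  then have 1: "norm (?h c (avg ?h \<rho> (shifted_box_avg ls cs' \<rho> v)) - ?h c (avg ?h \<rho> ?q)) \<le> real (length ls) * (s / \<rho> * (2 * \<delta>))"
    by (intro nonexp_le[OF isom_flowD(1)[OF o]] nonexp_le[OF nonexp_avg[OF o]])
  have "near x \<delta> (\<tau> - 8 * \<rho> * real (length ls)) ?q"
    using Cons.prems by (intro near_box_avg) auto
  then have nq: "near x \<delta> (4 * \<rho>) ?q"
    by (rule near_mono) (use Cons.prems in \<open>auto simp: algebra_simps\<close>)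
  have "mnorm (l \<rho> - mat 1) \<le> 4 * \<rho>" "l \<rho> \<in> Sp4"
    using l[unfolded letter_def] Cons.prems(3,4) abs_of_pos[of \<rho>] by metis+
  then have dq: "norm (?h \<rho> ?q - ?q) \<le> 2 * \<delta>"
    using Cons.prems(3) by (intro near_disp[OF nq]) auto
  have "\<bar>c\<bar> / \<bar>\<rho>\<bar> * norm (?h \<rho> ?q - ?q) \<le> s / \<rho> * (2 * \<delta>)"
  proof (rule mult_mono)
    have c: "\<bar>c\<bar> \<le> s" using Cons.prems cs by simp
    then show "\<bar>c\<bar> / \<bar>\<rho>\<bar> \<le> s / \<rho>" using Cons.prems(3) by (simp add: divide_right_mono)
    show "0 \<le> s / \<rho>" using order_trans[OF abs_ge_zero c] Cons.prems(3) by simp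
  qed (use dq in auto)
  moreover have "norm (?h c (avg ?h \<rho> ?q) - avg ?h \<rho> ?q) \<le> \<bar>c\<bar> / \<bar>\<rho>\<bar> * norm (?h \<rho> ?q - ?q)"
    using Cons.prems by (intro avg_shift_left o) auto
  ultimately have 2: "norm (?h c (avg ?h \<rho> ?q) - avg ?h \<rho> ?q) \<le> s / \<rho> * (2 * \<delta>)" by linarith
  from norm_chain3[OF 1 2] show ?case
    by (simp only: cs shifted_box_avg.simps box_avg.simps list.size of_nat_add of_nat_1 distrib_right mult_1 add.commute One_nat_def of_nat_Suc)
qed simp

definition smooth_at :: "real \<Rightarrow> real \<Rightarrow> 'a \<Rightarrow> bool" where
  "smooth_at s e v \<longleftrightarrow> (\<forall>g\<in>Sp4. mnorm (g - mat 1) \<le> s \<longrightarrow> norm (\<alpha> g v - v) \<le> e)"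

text \<open>Acting by \<open>g\<close> translates the box by the coordinates of \<open>g\<close>, up
  to group elements at distance \<open>C * (s * \<rho>)\<close> from 1 that act on \<open>v\<close>.
  So smoothness of \<open>v\<close> at this much smaller scale gives smoothness of the average at
  scale \<open>s\<close>, with an additional error for translating the box.\<close>

lemma smoothing_step:
  "\<exists>C\<ge>1. \<forall>x \<delta> \<tau> v \<rho> s e. near x \<delta> \<tau> v \<longrightarrow> 0 \<le> \<delta> \<longrightarrow> \<tau> \<le> 1 \<longrightarrow> 0 < \<rho> \<longrightarrow> \<rho> \<le> 1 / 4 \<longrightarrow> 88 * \<rho> \<le> \<tau> \<longrightarrow> 0 \<le> s \<longrightarrow> s \<le> 1 / 1000000 \<longrightarrow>
     smooth_at (C * (s * \<rho>)) e v \<longrightarrow> smooth_at s (e + C * (s / \<rho>) * \<delta>) (box_avg letters \<rho> v)"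
proof -
  obtain K where K: "K \<ge> 0" "\<And>cs \<rho>. length cs = length letters \<Longrightarrow> (\<forall>c\<in>set cs. \<bar>c\<bar> \<le> \<rho>) \<Longrightarrow> 0 \<le> \<rho> \<Longrightarrow> \<rho> \<le> 1 \<Longrightarrow> mnorm (word_prod letters cs - mat 1) \<le> K * \<rho>"
    using word_prod_close[OF letters] by metis
  obtain K' where K': "K' \<ge> 0" "\<And>cs ts s \<rho>. length cs = length letters \<Longrightarrow> length ts = length letters \<Longrightarrow> (\<forall>c\<in>set cs. \<bar>c\<bar> \<le> s) \<Longrightarrow> (\<forall>t\<in>set ts. \<bar>t\<bar> \<le> \<rho>) \<Longrightarrow>
    0 \<le> s \<Longrightarrow> s \<le> 1 \<Longrightarrow> 0 \<le> \<rho> \<Longrightarrow> \<rho> \<le> 1 \<Longrightarrow> mnorm (word_prod letters cs ** word_prod letters ts - word_prod letters (map2 (+) cs ts)) \<le> K' * (s * \<rho>)"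
    using word_prod_quasi_additive[OF letters] by metis
  \<comment> \<open>4000000 is 2 * 10 * 200000, from translating ten coordinates; the other summand
    combines the bound \<open>16 * (4 + K)\<close> for an inverse with the quasi-additivity constant
    \<open>K'\<close>.\<close>
  define C where "C = 4000000 + 16 * (4 + K) * K' * 200000"
  have C: "C \<ge> 4000000" "16 * (4 + K) * K' * 200000 \<le> C" using K K' by (auto simp: C_def)
  show ?thesis
  proof (intro exI[of _ C] conjI allI impI)
    show "1 \<le> C" using C by simp
    fix x v and \<delta> \<tau> \<rho> s e :: real
    assume n: "near x \<delta> \<tau> v" and \<delta>: "0 \<le> \<delta>" and \<tau>: "\<tau> \<le> 1" and \<rho>: "0 < \<rho>" "\<rho> \<le> 1 / 4" "88 * \<rho> \<le> \<tau>" and s: "0 \<le> s" "s \<le> 1 / 1000000"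
      and sm: "smooth_at (C * (s * \<rho>)) e v"
    show "smooth_at s (e + C * (s / \<rho>) * \<delta>) (box_avg letters \<rho> v)"
      unfolding smooth_at_def
    proof (intro ballI impI)
      fix g assume g: "g \<in> Sp4" "mnorm (g - mat 1) \<le> s"
      obtain cs where cs: "length cs = length letters" "\<forall>c\<in>set cs. \<bar>c\<bar> \<le> 200000 * s" "g = word_prod letters cs"
        using local_coordinates[OF g s(2)] by auto
      have s': "0 \<le> 200000 * s" "200000 * s \<le> 1 / 4" using s by auto
      have 1: "norm (\<alpha> g (box_avg letters \<rho> v) - shifted_box_avg letters cs \<rho> v) \<le> e"
      proof (rule box_avg_shifted_box_avg_near[where H = "\<alpha> g" and K = "\<lambda>v. v", OF letters cs(1) less_imp_le[OF \<rho>(1)] act_nonexp[OF g(1)] nonexp_id])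
        fix ts assume ts: "length ts = length letters" "\<forall>t\<in>set ts. \<bar>t\<bar> \<le> \<rho>"
        let ?P = "word_prod letters ts" and ?Q = "word_prod letters (map2 (+) cs ts)"
        have PS: "?P \<in> Sp4" "?Q \<in> Sp4" using word_prod_Sp4[OF letters] by auto
        have lt: "length (map2 (+) cs ts) = length letters" using cs ts by simp
        have "\<forall>c\<in>set (map2 (+) cs ts). \<bar>c\<bar> \<le> 1"
        proof
          fix z assume "z \<in> set (map2 (+) cs ts)"
          then obtain a b where "a \<in> set cs" "b \<in> set ts" "z = a + b"
            by (auto dest: set_zip_leftD set_zip_rightD)
          then show "\<bar>z\<bar> \<le> 1" using cs(2) ts(2) s' \<rho> by fastforce
        qed
        then have "mnorm (?Q - mat 1) \<le> K * 1" by (intro K(2) lt) auto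
        then have Q: "mnorm ?Q \<le> 4 + K" using mnorm_le[of ?Q] by linarith
        let ?g = "sinv ?Q ** (g ** ?P)"
        have gS: "?g \<in> Sp4" using PS g by (intro Sp4_mult sinv) auto
        have "?g - mat 1 = sinv ?Q ** (g ** ?P - ?Q)"
          using matrix_add_ldistrib[of "sinv ?Q" "g ** ?P" "- ?Q"] by (simp add: mat_neg_mult sinv PS)
        then have "mnorm (?g - mat 1) \<le> mnorm (sinv ?Q) * mnorm (g ** ?P - ?Q)"
          by (simp add: mnorm_mult)
        also have "\<dots> \<le> (16 * (4 + K)) * (K' * ((200000 * s) * \<rho>))"
        proof (rule mult_mono)
          show "mnorm (sinv ?Q) \<le> 16 * (4 + K)" by (rule order_trans[OF mnorm_sinv]) (use Q in simp)
          show "mnorm (g ** ?P - ?Q) \<le> K' * ((200000 * s) * \<rho>)"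
            unfolding cs(3) using cs ts s' \<rho> by (intro K'(2)) auto
        qed (use K in auto)
        also have "\<dots> = (16 * (4 + K) * K' * 200000) * (s * \<rho>)" by simp
        also have "\<dots> \<le> C * (s * \<rho>)" using C s \<rho> by (intro mult_right_mono) auto
        finally have "norm (\<alpha> ?g v - v) \<le> e" using sm gS by (simp add: smooth_at_def)
        then have "norm (\<alpha> ?Q (\<alpha> ?g v) - \<alpha> ?Q v) \<le> e" by (simp add: act_iso PS)
        also have "\<alpha> ?Q (\<alpha> ?g v) = \<alpha> (?Q ** ?g) v" by (simp add: act_mult PS gS)
        also have "?Q ** ?g = g ** ?P" by (simp add: matrix_mul_assoc sinv PS)
        finally show "norm (\<alpha> g (\<alpha> ?P v) - \<alpha> ?Q v) \<le> e" by (simp add: act_mult PS g)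
      qed
      have "norm (shifted_box_avg letters cs \<rho> v - box_avg letters \<rho> v) \<le> real (length letters) * ((200000 * s) / \<rho> * (2 * \<delta>))"
        using n \<delta> \<tau> \<rho> cs by (intro shifted_box_avg_near[OF letters n]) (auto simp: letters_def)
      also have "\<dots> = 4000000 * ((s / \<rho>) * \<delta>)" by (simp add: letters_def)
      also have "\<dots> \<le> C * ((s / \<rho>) * \<delta>)" using C s \<rho> \<delta> by (intro mult_right_mono) auto
      finally have 2: "norm (shifted_box_avg letters cs \<rho> v - box_avg letters \<rho> v) \<le> C * (s / \<rho>) * \<delta>" by simp
      show "norm (\<alpha> g (box_avg letters \<rho> v) - box_avg letters \<rho> v) \<le> e + C * (s / \<rho>) * \<delta>"
        by (rule norm_chain3[OF 1 2])
    qed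
  qed
qed

lemma smooth_at_small:
  assumes "e > 0" shows "\<exists>s>0. smooth_at s e v"
proof -
  have "continuous_on Sp4 (\<lambda>g. \<alpha> g v)"
  proof -
    have "continuous_on Sp4 (\<lambda>g. (g, v))" by (intro continuous_intros)
    from continuous_on_compose2[OF act_cont this] show ?thesis by auto
  qed
  then obtain s where s: "s > 0" "\<And>g. g \<in> Sp4 \<Longrightarrow> dist g (mat 1) < s \<Longrightarrow> dist (\<alpha> g v) (\<alpha> (mat 1) v) < e"
    unfolding continuous_on_iff using assms Sp4_1 by blast
  have "smooth_at (s / 2) e v"
    unfolding smooth_at_def
  proof (intro ballI impI)
    fix g assume g: "g \<in> Sp4" "mnorm (g - mat 1) \<le> s / 2"
    then have "dist g (mat 1) < s" using norm_mnorm[of "g - mat 1"] s(1) by (simp add: dist_norm)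
    then show "norm (\<alpha> g v - v) \<le> e" using s(2)[OF g(1)] by (simp add: dist_norm)
  qed
  then show ?thesis using s(1) by (intro exI[of _ "s / 2"]) auto
qed

text \<open>Averaging over boxes of sizes \<open>\<rho>, \<rho>/2, \<rho>/4, \<dots>\<close> in local coordinates: the failure of the
  coordinates to be additive is quadratic, so the scale at which smoothness of the inner vector is
  needed decreases superexponentially.\<close>

lemma smoothing:
  "\<exists>C>0. \<exists>s1>0. \<forall>x \<delta> s. near x \<delta> (1 / 1000000) x \<longrightarrow> 0 < \<delta> \<longrightarrow> 0 < s \<longrightarrow> s \<le> s1 \<longrightarrow> (\<exists>v. norm (v - x) \<le> \<delta> \<and> smooth_at s (C * s * \<delta>) v)"
proof -
  obtain C where C: "C \<ge> 1" and step: "\<And>x \<delta> \<tau> v \<rho> s e. near x \<delta> \<tau> v \<Longrightarrow> 0 \<le> \<delta> \<Longrightarrow> \<tau> \<le> 1 \<Longrightarrow> 0 < \<rho> \<Longrightarrow> \<rho> \<le> 1 / 4 \<Longrightarrow> 88 * \<rho> \<le> \<tau> \<Longrightarrow> 0 \<le> s \<Longrightarrow> s \<le> 1 / 1000000 \<Longrightarrow>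
     smooth_at (C * (s * \<rho>)) e v \<Longrightarrow> smooth_at s (e + C * (s / \<rho>) * \<delta>) (box_avg letters \<rho> v)"
    using smoothing_step by metis
  \<comment> \<open>So small that the scale at least halves from one box to the next, and that the
    total loss of radius \<open>160 * \<rho>0\<close> stays well below
    \<open>1 / 1000000\<close>.\<close>
  define \<rho>0 where "\<rho>0 = 1 / (1000000000 * C)"
  have \<rho>0: "0 < \<rho>0" "1000000000 * C * \<rho>0 = 1" "\<rho>0 \<le> 1 / 1000000000" using C by (auto simp: \<rho>0_def field_simps)
  \<comment> \<open>\<open>n\<close> counts the nested boxes. The boxes of sizes \<rho>, \<rho>/2,
    and so on, use up radii 80\<rho>, 40\<rho>, and so on, in total at most 160\<rho>. The factor 2
    in the error leaves room for the inner error, which is at most half of the total because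
    \<open>4 * C * \<rho> \<le> 1\<close>.\<close>
  have main: "\<exists>v. near x \<delta> (1 / 1000000 - 160 * \<rho>) v \<and> smooth_at s (2 * C * (s / \<rho>) * \<delta> + e) v"
    if "near x \<delta> (1 / 1000000) x" "0 < \<delta>" "0 < \<rho>" "\<rho> \<le> \<rho>0" "0 < s" "s \<le> 1 / 1000000" "smooth_at (s / 2 ^ n) e x" for x \<delta> \<rho> s e n
    using that
  proof (induction n arbitrary: \<rho> s)
    case 0
    have "smooth_at s (2 * C * (s / \<rho>) * \<delta> + e) x"
      unfolding smooth_at_def
    proof (intro ballI impI)
      fix g assume "g \<in> Sp4" "mnorm (g - mat 1) \<le> s"
      then have "norm (\<alpha> g x - x) \<le> e" using 0 by (simp add: smooth_at_def)
      moreover have "0 \<le> 2 * C * (s / \<rho>) * \<delta>" using 0 C by simp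
      ultimately show "norm (\<alpha> g x - x) \<le> 2 * C * (s / \<rho>) * \<delta> + e" by linarith
    qed
    then show ?case using near_mono[OF 0(1), of "1 / 1000000 - 160 * \<rho>"] 0 by auto
  next
    case (Suc n)
    let ?s = "C * (s * \<rho>)"
    have Cr: "1000000000 * C * \<rho> \<le> 1" using \<rho>0 Suc.prems(4) C mult_left_mono[of \<rho> \<rho>0 "1000000000 * C"] by simp
    have "s * (C * \<rho>) \<le> s * (1 / 2)" using Cr Suc.prems by (intro mult_left_mono) auto
    then have s2: "?s \<le> s / 2" by (simp add: mult_ac)
    have "smooth_at (?s / 2 ^ n) e x"
    proof -
      have "?s / 2 ^ n \<le> s / 2 ^ Suc n" using s2 by (simp add: divide_right_mono field_simps)
      then show ?thesis using Suc.prems(7) unfolding smooth_at_def by force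
    qed
    then obtain v where v: "near x \<delta> (1 / 1000000 - 160 * (\<rho> / 2)) v" "smooth_at ?s (2 * C * (?s / (\<rho> / 2)) * \<delta> + e) v"
      using Suc.IH[of "\<rho> / 2" ?s] Suc.prems s2 C by fastforce
    have r: "\<rho> \<le> 1 / 1000000000" using Suc.prems \<rho>0 by linarith
    have "smooth_at s ((2 * C * (?s / (\<rho> / 2)) * \<delta> + e) + C * (s / \<rho>) * \<delta>) (box_avg letters \<rho> v)"
      using Suc.prems r by (intro step[OF v(1)] v(2)) auto
    moreover have "(2 * C * (?s / (\<rho> / 2)) * \<delta> + e) + C * (s / \<rho>) * \<delta> \<le> 2 * C * (s / \<rho>) * \<delta> + e"
    proof -
      have "2 * C * (?s / (\<rho> / 2)) * \<delta> = (4 * C * \<rho>) * (C * (s / \<rho>) * \<delta>)"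
        using Suc.prems by (simp add: field_simps)
      also have "\<dots> \<le> 1 * (C * (s / \<rho>) * \<delta>)"
        using Cr C Suc.prems by (intro mult_right_mono) auto
      finally have "2 * C * (?s / (\<rho> / 2)) * \<delta> \<le> C * (s / \<rho>) * \<delta>" by (simp only: mult_1)
      moreover have "2 * C * (s / \<rho>) * \<delta> = C * (s / \<rho>) * \<delta> + C * (s / \<rho>) * \<delta>" by simp
      ultimately show ?thesis by (rule le_double)
    qed
    ultimately have "smooth_at s (2 * C * (s / \<rho>) * \<delta> + e) (box_avg letters \<rho> v)"
      unfolding smooth_at_def using order_trans by blast
    moreover have "near x \<delta> (1 / 1000000 - 160 * (\<rho> / 2) - 8 * \<rho> * real (length letters)) (box_avg letters \<rho> v)"
      using Suc.prems r by (intro near_box_avg letters v) auto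
    then have "near x \<delta> (1 / 1000000 - 160 * \<rho>) (box_avg letters \<rho> v)" by (simp add: letters_def)
    ultimately show ?case by blast
  qed
  have pos: "0 < 2 * C / \<rho>0 + 1" using C \<rho>0 by (intro add_pos_pos divide_pos_pos) auto
  have A: "\<forall>x \<delta> s. near x \<delta> (1 / 1000000) x \<longrightarrow> 0 < \<delta> \<longrightarrow> 0 < s \<longrightarrow> s \<le> 1 / 1000000 \<longrightarrow>
      (\<exists>v. norm (v - x) \<le> \<delta> \<and> smooth_at s ((2 * C / \<rho>0 + 1) * s * \<delta>) v)"
  proof (intro allI impI)
    fix x and \<delta> s :: real assume x: "near x \<delta> (1 / 1000000) x" "0 < \<delta>" "0 < s" "s \<le> 1 / 1000000"
    \<comment> \<open>Plain continuity at \<open>x\<close> starts the induction at an uncontrolled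
      scale \<open>t\<close>; only the number of nested boxes depends on it, not the final
      bound.\<close>
    obtain t where t: "t > 0" "smooth_at t (s * \<delta>) x" using smooth_at_small[of "s * \<delta>" x] x by auto
    obtain n where n: "s / t < 2 ^ n" using real_arch_pow[of 2 "s / t"] by auto
    then have "s / 2 ^ n \<le> t" using t by (simp add: field_simps)
    then have "smooth_at (s / 2 ^ n) (s * \<delta>) x" using t(2) unfolding smooth_at_def by force
    then obtain v where v: "near x \<delta> (1 / 1000000 - 160 * \<rho>0) v" "smooth_at s (2 * C * (s / \<rho>0) * \<delta> + s * \<delta>) v"
      using main[OF x(1,2) \<rho>0(1) order_refl x(3,4)] by blast
    have "norm (\<alpha> (mat 1) v - x) \<le> \<delta>"
      using v(1) \<rho>0 unfolding near_def by (auto simp del: act_1)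
    moreover have "2 * C * (s / \<rho>0) * \<delta> + s * \<delta> = (2 * C / \<rho>0 + 1) * s * \<delta>"
      by (simp add: algebra_simps)
    ultimately show "\<exists>v. norm (v - x) \<le> \<delta> \<and> smooth_at s ((2 * C / \<rho>0 + 1) * s * \<delta>) v"
      using v(2) by auto
  qed
  show ?thesis
    by (rule exI[of _ "2 * C / \<rho>0 + 1"], rule conjI[OF pos], rule exI[of _ "1 / 1000000"], rule conjI[OF _ A]) simp
qed

end

section \<open>Logarithmic growth of displacements\<close>

text \<open>The torus acts on each root subgroup by a character; with \<open>a\<close> and
  \<open>b\<close> equal to 2 or 1/2, every root subgroup can be expanded by 4.\<close>

lemma diag4_conj:
  assumes "a \<noteq> 0" "b \<noteq> 0"
  shows "elem N1 (a\<^sup>2 * t) = diag4 a b ** (elem N1 t ** diag4 (1 / a) (1 / b))"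
    "elem N2 (a * b * t) = diag4 a b ** (elem N2 t ** diag4 (1 / a) (1 / b))"
    "elem N3 (b\<^sup>2 * t) = diag4 a b ** (elem N3 t ** diag4 (1 / a) (1 / b))"
    "elem N4 (b / a * t) = diag4 a b ** (elem N4 t ** diag4 (1 / a) (1 / b))"
    "elem N5 (t / a\<^sup>2) = diag4 a b ** (elem N5 t ** diag4 (1 / a) (1 / b))"
    "elem N6 (t / (a * b)) = diag4 a b ** (elem N6 t ** diag4 (1 / a) (1 / b))"
    "elem N7 (t / b\<^sup>2) = diag4 a b ** (elem N7 t ** diag4 (1 / a) (1 / b))"
    "elem N8 (a / b * t) = diag4 a b ** (elem N8 t ** diag4 (1 / a) (1 / b))"
  using assms by (simp_all add: mat_simps power2_eq_square)

text \<open>The classical factorisation of a diagonal element of SL2 into two Weyl elements w(a)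
  w(-1), taken in the two SL2 subgroups of the long roots.\<close>

lemma diag4_sl2:
  assumes "a \<noteq> 0"
  shows "diag4 a 1 = elem N1 a ** (elem N5 (- 1 / a) ** (elem N1 a ** (elem N1 (- 1) ** (elem N5 1 ** elem N1 (- 1)))))"
    "diag4 1 a = elem N3 a ** (elem N7 (- 1 / a) ** (elem N3 a ** (elem N3 (- 1) ** (elem N7 1 ** elem N3 (- 1)))))"
  using assms by (simp_all add: mat_simps)

lemma diag4_split: "diag4 a b = diag4 a 1 ** diag4 1 b"
  by (simp add: mat_simps)

text \<open>Commutators of the three subgroups occurring in \<open>Disp\<close>, from which the
  remaining root subgroups are obtained.\<close>

lemma commutator_formulas:
  "elem N3 s = elem N2 (- (- s / 2)) ** (elem N4 (- 1) ** (elem N2 (- s / 2) ** elem N4 1))"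
  "elem N8 (a * b) ** elem N1 (a\<^sup>2 * b) = elem N2 (- a) ** (elem N7 (- b) ** (elem N2 a ** elem N7 b))"
  "elem N6 (- (a * b)) ** elem N5 (- (a\<^sup>2 * b)) = elem N4 (- a) ** (elem N7 (- b) ** (elem N4 a ** elem N7 b))"
  by (simp_all add: mat_simps power2_eq_square)

text \<open>For a = 1 and a = -1 the short root parts, linear in a, cancel, while the long root
  parts, quadratic in a, add up. This separates the two factors of a commutator.\<close>

lemma commutator_formulas2:
  "elem N1 s = (elem N8 (1 * (s / 2)) ** elem N1 (1\<^sup>2 * (s / 2))) ** (elem N8 ((- 1) * (s / 2)) ** elem N1 ((- 1)\<^sup>2 * (s / 2)))"
  "elem N8 s = (elem N8 (1 * s) ** elem N1 (1\<^sup>2 * s)) ** elem N1 (- s)"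
  "elem N5 s = (elem N6 (- (1 * (- s / 2))) ** elem N5 (- (1\<^sup>2 * (- s / 2)))) ** (elem N6 (- ((- 1) * (- s / 2))) ** elem N5 (- ((- 1)\<^sup>2 * (- s / 2))))"
  "elem N6 s = (elem N6 (- (1 * (- s))) ** elem N5 (- (1\<^sup>2 * (- s)))) ** elem N5 (- s)"
  by (simp_all add: mat_simps)

context sp4_action
begin

definition Disp :: "real \<Rightarrow> 'a \<Rightarrow> bool" where
  "Disp e x \<longleftrightarrow> (\<forall>N\<in>{N2, N4, N7}. \<forall>t. \<bar>t\<bar> \<le> 1 \<longrightarrow> norm (\<alpha> (elem N t) x - x) \<le> e)"

text \<open>A word length with respect to the generators in \<open>Disp\<close>: the bound holds for
  all \<open>x\<close> and \<open>e\<close> at once, so it adds up along products.\<close>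

definition disp_bounded :: "nat \<Rightarrow> real^4^4 \<Rightarrow> bool" where
  "disp_bounded n g \<longleftrightarrow> g \<in> Sp4 \<and> (\<forall>x e. Disp e x \<longrightarrow> norm (\<alpha> g x - x) \<le> real n * e)"

lemma Disp_nonneg: "Disp e x \<Longrightarrow> 0 \<le> e"
  unfolding Disp_def by (metis abs_0 insertI1 norm_ge_zero order_trans zero_le_one)

lemma disp_bounded_mult: "disp_bounded m g \<Longrightarrow> disp_bounded n h \<Longrightarrow> disp_bounded (m + n) (g ** h)"
  unfolding disp_bounded_def using displacement_mult Sp4_mult by (auto simp: distrib_right)

lemma disp_bounded_mono: "disp_bounded m g \<Longrightarrow> m \<le> n \<Longrightarrow> disp_bounded n g"
  unfolding disp_bounded_def
proof safe
  fix x e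
  assume mn: "m \<le> n" and b: "\<forall>x e. Disp e x \<longrightarrow> norm (\<alpha> g x - x) \<le> real m * e" and d: "Disp e x"
  have "norm (\<alpha> g x - x) \<le> real m * e" using b d by simp
  also have "\<dots> \<le> real n * e" using mn Disp_nonneg[OF d] by (intro mult_right_mono) auto
  finally show "norm (\<alpha> g x - x) \<le> real n * e" .
qed

lemma disp_bounded_gen: "\<bar>t\<bar> \<le> 1 \<Longrightarrow> disp_bounded 1 (elem N2 t)" "\<bar>t\<bar> \<le> 1 \<Longrightarrow> disp_bounded 1 (elem N4 t)" "\<bar>t\<bar> \<le> 1 \<Longrightarrow> disp_bounded 1 (elem N7 t)"
  unfolding disp_bounded_def Disp_def using elem_Sp4 sp_square_zero_N by auto

lemma disp_bounded_multiple:
  assumes "letter l" "\<And>t. \<bar>t\<bar> \<le> 1 \<Longrightarrow> disp_bounded a (l t)"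
  shows "\<bar>t\<bar> \<le> real n \<Longrightarrow> disp_bounded (n * a) (l t)"
proof (induction n arbitrary: t)
  case 0
  then have "l t = mat 1" using assms(1) by (simp add: letter_def)
  then show ?case by (simp add: disp_bounded_def)
next
  case (Suc n)
  have "l t = l (t / real (Suc n)) ** l (t * real n / real (Suc n))"
  proof -
    have "t = t / real (Suc n) + t * real n / real (Suc n)"
      by (simp only: add_divide_distrib[symmetric]) (simp add: field_simps)
    then show ?thesis using assms(1) unfolding letter_def by metis
  qed
  moreover have "\<bar>t\<bar> / real (Suc n) \<le> 1" using Suc.prems by simp
  then have "disp_bounded a (l (t / real (Suc n)))" by (intro assms(2)) simp
  moreover have "\<bar>t\<bar> / real (Suc n) * real n \<le> 1 * real n" using \<open>\<bar>t\<bar> / real (Suc n) \<le> 1\<close> by (intro mult_right_mono) auto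
  then have "disp_bounded (n * a) (l (t * real n / real (Suc n)))" by (intro Suc.IH) (simp add: abs_mult)
  ultimately show ?case using disp_bounded_mult by fastforce
qed

text \<open>Counting generators: a commutator costs 4, the long roots \<open>N1\<close> and
  \<open>N5\<close> two commutators, and \<open>N8\<close> and \<open>N6\<close> a commutator and a
  long root element, hence 12.\<close>

lemma disp_bounded_elems:
  assumes s: "\<bar>s\<bar> \<le> 1"
  shows "disp_bounded 12 (elem N1 s)" "disp_bounded 12 (elem N2 s)" "disp_bounded 12 (elem N3 s)" "disp_bounded 12 (elem N4 s)" "disp_bounded 12 (elem N5 s)"
    "disp_bounded 12 (elem N6 s)" "disp_bounded 12 (elem N7 s)" "disp_bounded 12 (elem N8 s)"
proof -
  have c8: "disp_bounded 4 (elem N8 (a * b) ** elem N1 (a\<^sup>2 * b))" if "\<bar>a\<bar> \<le> 1" "\<bar>b\<bar> \<le> 1" for a b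
    unfolding commutator_formulas(2)
    using disp_bounded_mult[OF disp_bounded_gen(1)[of "-a"] disp_bounded_mult[OF disp_bounded_gen(3)[of "-b"] disp_bounded_mult[OF disp_bounded_gen(1)[of a] disp_bounded_gen(3)[of b]]]] that by (simp add: numeral_eq_Suc)
  have c6: "disp_bounded 4 (elem N6 (- (a * b)) ** elem N5 (- (a\<^sup>2 * b)))" if "\<bar>a\<bar> \<le> 1" "\<bar>b\<bar> \<le> 1" for a b
    unfolding commutator_formulas(3)
    using disp_bounded_mult[OF disp_bounded_gen(2)[of "-a"] disp_bounded_mult[OF disp_bounded_gen(3)[of "-b"] disp_bounded_mult[OF disp_bounded_gen(2)[of a] disp_bounded_gen(3)[of b]]]] that by (simp add: numeral_eq_Suc)
  have b1: "disp_bounded 8 (elem N1 s)" if "\<bar>s\<bar> \<le> 1" for s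
    by (subst commutator_formulas2(1)) (use disp_bounded_mult[OF c8[of 1 "s/2"] c8[of "-1" "s/2"]] that in simp)
  have b5: "disp_bounded 8 (elem N5 s)" if "\<bar>s\<bar> \<le> 1" for s
    by (subst commutator_formulas2(3)) (use disp_bounded_mult[OF c6[of 1 "-s/2"] c6[of "-1" "-s/2"]] that in simp)
  show "disp_bounded 12 (elem N1 s)" "disp_bounded 12 (elem N5 s)" using b1[OF s] b5[OF s] disp_bounded_mono by auto
  show "disp_bounded 12 (elem N8 s)"
    by (subst commutator_formulas2(2)) (use disp_bounded_mult[OF c8[of 1 s] b1[of "-s"]] s in simp)
  show "disp_bounded 12 (elem N6 s)"
    by (subst commutator_formulas2(4)) (use disp_bounded_mult[OF c6[of 1 "-s"] b5[of "-s"]] s in simp)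
  show "disp_bounded 12 (elem N2 s)" "disp_bounded 12 (elem N4 s)" "disp_bounded 12 (elem N7 s)"
    by (rule disp_bounded_mono[OF disp_bounded_gen(1)[OF s]], simp, rule disp_bounded_mono[OF disp_bounded_gen(2)[OF s]], simp, rule disp_bounded_mono[OF disp_bounded_gen(3)[OF s]], simp)
  have "disp_bounded 4 (elem N3 s)"
    by (subst commutator_formulas(1))
      (use disp_bounded_mult[OF disp_bounded_gen(1)[of "-(-s/2)"] disp_bounded_mult[OF disp_bounded_gen(2)[of "-1"] disp_bounded_mult[OF disp_bounded_gen(1)[of "-s/2"] disp_bounded_gen(2)[of 1]]]] s in \<open>simp add: numeral_eq_Suc\<close>)
  then show "disp_bounded 12 (elem N3 s)" using disp_bounded_mono by simp
qed

lemma disp_bounded_diag4: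
  assumes "a \<noteq> 0" "\<bar>a\<bar> \<le> real n" "\<bar>1 / a\<bar> \<le> real n" "1 \<le> n"
  shows "disp_bounded (72 * n) (diag4 a 1)" "disp_bounded (72 * n) (diag4 1 a)"
proof -
  have n: "\<bar>t\<bar> \<le> real n \<Longrightarrow> disp_bounded (12 * n) (elem N1 t)" "\<bar>t\<bar> \<le> real n \<Longrightarrow> disp_bounded (12 * n) (elem N5 t)"
     "\<bar>t\<bar> \<le> real n \<Longrightarrow> disp_bounded (12 * n) (elem N3 t)" "\<bar>t\<bar> \<le> real n \<Longrightarrow> disp_bounded (12 * n) (elem N7 t)" for t
    using disp_bounded_multiple[OF letter_elem[OF sp_square_zero_N(1) mnorm_N(1)] disp_bounded_elems(1)] disp_bounded_multiple[OF letter_elem[OF sp_square_zero_N(5) mnorm_N(5)] disp_bounded_elems(5)]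
       disp_bounded_multiple[OF letter_elem[OF sp_square_zero_N(3) mnorm_N(3)] disp_bounded_elems(3)] disp_bounded_multiple[OF letter_elem[OF sp_square_zero_N(7) mnorm_N(7)] disp_bounded_elems(7)]
    by (simp_all add: mult.commute)
  have m: "\<bar>- 1 / a\<bar> \<le> real n" "\<bar>- 1\<bar> \<le> real n" "\<bar>1\<bar> \<le> real n" using assms by auto
  have "disp_bounded (12 * n + (12 * n + (12 * n + (12 * n + (12 * n + 12 * n))))) (diag4 a 1)"
    unfolding diag4_sl2(1)[OF assms(1)] by (intro disp_bounded_mult n m assms)
  then show "disp_bounded (72 * n) (diag4 a 1)" by simp
  have "disp_bounded (12 * n + (12 * n + (12 * n + (12 * n + (12 * n + 12 * n))))) (diag4 1 a)"
    unfolding diag4_sl2(2)[OF assms(1)] by (intro disp_bounded_mult n m assms)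
  then show "disp_bounded (72 * n) (diag4 1 a)" by simp
qed

lemma disp_bounded_letters:
  assumes "l \<in> set letters" "\<bar>s\<bar> \<le> 1"
  shows "disp_bounded 216 (l s)"
proof -
  have e: "exp t \<le> 3" if "\<bar>t\<bar> \<le> 1" for t :: real
    using abs_exp_minus_one[OF that] that by linarith
  have "disp_bounded (72 * 3) (h1 s)" "disp_bounded (72 * 3) (h2 s)"
    unfolding h1_def h2_def using e[of s] e[of "-s"] assms(2)
    by (auto intro!: disp_bounded_diag4[of _ 3, simplified] simp: exp_minus divide_inverse)
  then show ?thesis
    using assms disp_bounded_elems[OF assms(2)] disp_bounded_mono[of 12 _ 216] by (auto simp: letters_def)
qed

lemma disp_bounded_word_prod: "\<forall>l\<in>set ls. \<forall>c\<in>set cs. disp_bounded n (l c) \<Longrightarrow> disp_bounded (length ls * n) (word_prod ls cs)"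
proof (induction ls cs rule: word_prod.induct)
  case (1 l ls c cs)
  then have "disp_bounded (n + length ls * n) (l c ** word_prod ls cs)" by (intro disp_bounded_mult) auto
  then show ?case by simp
qed (auto simp: disp_bounded_def dest!: Disp_nonneg)

text \<open>2160 = 10 * 216 for ten letters; a letter costs at most 216 = 72 * 3, since
  \<open>exp\<close> is at most 3 on the parameters that occur.\<close>

lemma Disp_near: assumes "Disp e x" shows "near x (2160 * e) (1 / 1000000) x"
  unfolding near_def
proof (intro ballI impI)
  fix g assume g: "g \<in> Sp4" "mnorm (g - mat 1) \<le> 1 / 1000000"
  obtain cs where cs: "length cs = length letters" "\<forall>c\<in>set cs. \<bar>c\<bar> \<le> 200000 * (1 / 1000000)" "g = word_prod letters cs"
    using local_coordinates[OF g] by auto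
  then have "disp_bounded (length letters * 216) g"
    unfolding cs(3) using disp_bounded_letters by (intro disp_bounded_word_prod ballI) force
  then show "norm (\<alpha> g x - x) \<le> 2160 * e"
    using assms by (simp add: disp_bounded_def letters_def)
qed

text \<open>Conjugation by fixed torus elements multiplies the parameter by \<open>m\<close> at the
  fixed price 288 + 288 = 576, so displacements grow with the logarithm of the parameter.\<close>

lemma disp_bounded_scaling:
  assumes l: "letter l" "\<And>t. \<bar>t\<bar> \<le> 1 \<Longrightarrow> disp_bounded 12 (l t)" and T: "disp_bounded 288 T" "disp_bounded 288 T'" and m: "m \<ge> 2"
    and conj: "\<And>t. l (m * t) = T ** (l t ** T')"
  shows "\<bar>t\<bar> \<le> 2 ^ n \<Longrightarrow> disp_bounded (12 + 576 * n) (l t)"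
proof (induction n arbitrary: t)
  case 0 then show ?case using l by simp
next
  case (Suc n)
  have "\<bar>t / m\<bar> = \<bar>t\<bar> / m" using m by simp
  also have "\<dots> \<le> \<bar>t\<bar> / 2" by (rule frac_le) (use m in auto)
  also have "\<bar>t\<bar> / 2 \<le> 2 ^ n" using Suc.prems by simp
  finally have "\<bar>t / m\<bar> \<le> 2 ^ n" .
  then have "disp_bounded (288 + ((12 + 576 * n) + 288)) (T ** (l (t / m) ** T'))" by (intro disp_bounded_mult T Suc.IH)
  moreover have "l t = T ** (l (t / m) ** T')" using conj[of "t / m"] m by simp
  ultimately show ?case by (simp add: algebra_simps)
qed

lemma disp_bounded_log:
  assumes "N \<in> {N1, N2, N3, N4, N5, N6, N7, N8}" "\<bar>t\<bar> \<le> 2 ^ n"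
  shows "disp_bounded (12 + 576 * n) (elem N t)"
proof -
  have d: "disp_bounded 144 (diag4 2 1)" "disp_bounded 144 (diag4 1 2)" "disp_bounded 144 (diag4 (1 / 2) 1)" "disp_bounded 144 (diag4 1 (1 / 2))"
    using disp_bounded_diag4[of 2 2] disp_bounded_diag4[of "1 / 2" 2] by auto
  have D: "disp_bounded 288 (diag4 2 2)" "disp_bounded 288 (diag4 (1/2) (1/2))" "disp_bounded 288 (diag4 (1/2) 2)" "disp_bounded 288 (diag4 2 (1/2))"
    using disp_bounded_mult[OF d(1,2)] disp_bounded_mult[OF d(3,4)] disp_bounded_mult[OF d(3,2)] disp_bounded_mult[OF d(1,4)] 
    by (simp_all add: diag4_split[of 2 2] diag4_split[of "1/2" "1/2"] diag4_split[of "1/2" 2] diag4_split[of 2 "1/2"])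
  note L = letter_elem[OF sp_square_zero_N(1) mnorm_N(1)] letter_elem[OF sp_square_zero_N(2) mnorm_N(2)] letter_elem[OF sp_square_zero_N(3) mnorm_N(3)]
    letter_elem[OF sp_square_zero_N(4) mnorm_N(4)] letter_elem[OF sp_square_zero_N(5) mnorm_N(5)] letter_elem[OF sp_square_zero_N(6) mnorm_N(6)]
    letter_elem[OF sp_square_zero_N(7) mnorm_N(7)] letter_elem[OF sp_square_zero_N(8) mnorm_N(8)]
  have "disp_bounded (12 + 576 * n) (elem N1 t)"
    by (rule disp_bounded_scaling[OF L(1) disp_bounded_elems(1) D(1,2), where m = 4])
      (use diag4_conj(1)[of 2 2] assms(2) in \<open>auto simp: power2_eq_square mult.commute\<close>)
  moreover have "disp_bounded (12 + 576 * n) (elem N2 t)"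
    by (rule disp_bounded_scaling[OF L(2) disp_bounded_elems(2) D(1,2), where m = 4])
      (use diag4_conj(2)[of 2 2] assms(2) in \<open>auto simp: power2_eq_square mult.commute\<close>)
  moreover have "disp_bounded (12 + 576 * n) (elem N3 t)"
    by (rule disp_bounded_scaling[OF L(3) disp_bounded_elems(3) D(1,2), where m = 4])
      (use diag4_conj(3)[of 2 2] assms(2) in \<open>auto simp: power2_eq_square mult.commute\<close>)
  moreover have "disp_bounded (12 + 576 * n) (elem N4 t)"
    by (rule disp_bounded_scaling[OF L(4) disp_bounded_elems(4) D(3,4), where m = 4])
      (use diag4_conj(4)[of "1/2" 2] assms(2) in \<open>auto simp: power2_eq_square mult.commute\<close>)
  moreover have "disp_bounded (12 + 576 * n) (elem N5 t)"
    by (rule disp_bounded_scaling[OF L(5) disp_bounded_elems(5) D(2,1), where m = 4])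
      (use diag4_conj(5)[of "1/2" "1/2"] assms(2) in \<open>auto simp: power2_eq_square mult.commute\<close>)
  moreover have "disp_bounded (12 + 576 * n) (elem N6 t)"
    by (rule disp_bounded_scaling[OF L(6) disp_bounded_elems(6) D(2,1), where m = 4])
      (use diag4_conj(6)[of "1/2" "1/2"] assms(2) in \<open>auto simp: power2_eq_square mult.commute\<close>)
  moreover have "disp_bounded (12 + 576 * n) (elem N7 t)"
    by (rule disp_bounded_scaling[OF L(7) disp_bounded_elems(7) D(2,1), where m = 4])
      (use diag4_conj(7)[of "1/2" "1/2"] assms(2) in \<open>auto simp: power2_eq_square mult.commute\<close>)
  moreover have "disp_bounded (12 + 576 * n) (elem N8 t)"
    by (rule disp_bounded_scaling[OF L(8) disp_bounded_elems(8) D(4,3), where m = 4])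
      (use diag4_conj(8)[of 2 "1/2"] assms(2) in \<open>auto simp: power2_eq_square mult.commute\<close>)
  ultimately show ?thesis using assms(1) by auto
qed

text \<open>Moving \<open>g\<close> past \<open>elem N a\<close> conjugates it, and for
  \<open>\<bar>a\<bar> \<le> A\<close> this enlarges its distance from 1 by at most the factor
  \<open>(6 * A)\<^sup>2\<close>.\<close>

lemma smooth_avg_elem:
  assumes N: "sp_square_zero N" "mnorm N \<le> 2" and A: "1 \<le> A" and s: "smooth_at (36 * A\<^sup>2 * s) e v"
  shows "smooth_at s e (avg (\<lambda>t. \<alpha> (elem N t)) A v)"
  unfolding smooth_at_def
proof (intro ballI impI)
  fix g assume g: "g \<in> Sp4" "mnorm (g - mat 1) \<le> s"
  note o = letter_isom_flow[OF letter_elem[OF N]]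
  show "norm (\<alpha> g (avg (\<lambda>t. \<alpha> (elem N t)) A v) - avg (\<lambda>t. \<alpha> (elem N t)) A v) \<le> e"
  proof (rule avg_near2[where g = "\<lambda>v. v", OF o act_nonexp[OF g(1)] nonexp_id])
    fix t :: real assume t: "0 \<le> t" "t \<le> 1"
    define a where "a = A * t"
    have a: "\<bar>a\<bar> \<le> A" using t A by (simp add: a_def abs_mult mult_left_le)
    let ?u = "elem N a" and ?w = "elem N (- a)"
    have uS: "?u \<in> Sp4" "?w \<in> Sp4" using elem_Sp4[OF N(1)] by auto
    have m: "mnorm (elem N b) \<le> 6 * A" if "\<bar>b\<bar> \<le> A" for b
    proof -
      have "mnorm (elem N b) \<le> 4 + \<bar>b\<bar> * mnorm N"
        unfolding elem_def using mnorm_add[of "mat 1" "b *\<^sub>R N"] by (simp add: mnorm_scaleR mnorm_1)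
      also have "\<dots> \<le> 4 * A + A * 2" using that N A by (intro add_mono mult_mono) auto
      finally show ?thesis by simp
    qed
    let ?g = "?w ** (g ** ?u)"
    have gS: "?g \<in> Sp4" by (intro Sp4_mult uS g)
    have "?g - mat 1 = ?w ** ((g - mat 1) ** ?u)"
    proof -
      have "?w ** ?u = mat 1" using elem_cancel N by simp
      moreover have "(g - mat 1) ** ?u = g ** ?u - ?u" using mat_add_mult[of g "- mat 1" ?u] by (simp add: mat_neg_mult)
      moreover have "?w ** (g ** ?u - ?u) = ?w ** (g ** ?u) - ?w ** ?u"
        using matrix_add_ldistrib[of ?w "g ** ?u" "- ?u"] by (simp add: mat_neg_mult)
      ultimately show ?thesis by simp
    qed
    then have "mnorm (?g - mat 1) \<le> mnorm ?w * (mnorm (g - mat 1) * mnorm ?u)"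
      by (simp, intro order_trans[OF mnorm_mult] mult_left_mono mnorm_mult mnorm_nonneg)
    also have "\<dots> \<le> (6 * A) * (s * (6 * A))"
      using g(2) m a A order_trans[OF mnorm_nonneg g(2)] by (intro mult_mono) auto
    finally have "norm (\<alpha> ?g v - v) \<le> e" using s gS by (simp add: smooth_at_def power2_eq_square mult_ac)
    then have "norm (\<alpha> ?u (\<alpha> ?g v) - \<alpha> ?u v) \<le> e" by (simp add: act_iso uS)
    also have "\<alpha> ?u (\<alpha> ?g v) = \<alpha> (?u ** ?g) v" by (simp add: act_mult uS gS)
    also have "?u ** ?g = g ** ?u" by (simp add: matrix_mul_assoc elem_cancel N)
    finally show "norm (\<alpha> g (\<alpha> (elem N (A * t)) v) - \<alpha> (elem N (A * t)) v) \<le> e"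
      by (simp add: act_mult uS g flip: a_def)
  qed
qed

lemma smooth_at_elem:
  assumes "smooth_at s e v" "sp_square_zero N" "mnorm N \<le> 2" "2 * \<bar>t\<bar> \<le> s"
  shows "norm (\<alpha> (elem N t) v - v) \<le> e"
proof -
  have "\<bar>t\<bar> * mnorm N \<le> \<bar>t\<bar> * 2" using assms(3) by (rule mult_left_mono) simp
  then have "mnorm (elem N t - mat 1) \<le> s" using assms(4) by (simp add: elem_def mnorm_scaleR)
  then show ?thesis using assms(1) elem_Sp4[OF assms(2)] by (simp add: smooth_at_def)
qed

lemma isom_flow_elem: "sp_square_zero N \<Longrightarrow> mnorm N \<le> 2 \<Longrightarrow> isom_flow (\<lambda>t. \<alpha> (elem N (q * t)))"
  using isom_flow_scale[OF letter_isom_flow[OF letter_elem]] by simp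

lemma elem_commuting:
  assumes "sp_square_zero M" "sp_square_zero N" "M ** N = N ** M"
  shows "commuting (\<lambda>t. \<alpha> (elem M (p * t))) (\<lambda>t. \<alpha> (elem N (q * t)))"
  unfolding commuting_def using elem_comm[OF assms(3)] elem_Sp4 assms(1,2) by (simp flip: act_mult)

text \<open>The flows along \<open>N6\<close> and \<open>N5\<close> are rescaled so that the
  relations acquire the normal form of \<open>heis\<close>; what remains of the structure constants
  is \<open>q = - 1 / 2\<close>.\<close>

lemma heis_47: "heis (\<lambda>t. \<alpha> (elem N4 (1 * t))) (\<lambda>t. \<alpha> (elem N7 (1 * t))) (\<lambda>t. \<alpha> (elem N6 (- 1 * t))) (\<lambda>t. \<alpha> (elem N5 (2 * t))) (- 1 / 2)"
proof (unfold_locales)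
  fix a b e v
  note S = elem_Sp4 sp_square_zero_N Sp4_mult
  show "\<alpha> (elem N4 (1 * a)) (\<alpha> (elem N7 (1 * b)) v) = \<alpha> (elem N7 (1 * b)) (\<alpha> (elem N4 (1 * a)) (\<alpha> (elem N6 (- 1 * (a * b))) (\<alpha> (elem N5 (2 * (- 1 / 2 * a\<^sup>2 * b))) v)))"
    using rel_47[of a b] by (simp add: S flip: act_mult) (simp add: matrix_mul_assoc)
  show "\<alpha> (elem N4 (1 * a)) (\<alpha> (elem N6 (- 1 * e)) v) = \<alpha> (elem N6 (- 1 * e)) (\<alpha> (elem N4 (1 * a)) (\<alpha> (elem N5 (2 * (a * e))) v))"
    using rel_46[of a "- e"] by (simp add: S mult.assoc flip: act_mult) (simp add: matrix_mul_assoc)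
qed (intro isom_flow_elem elem_commuting sp_square_zero_N mnorm_N N_comm | simp)+

lemma heis_27: "heis (\<lambda>t. \<alpha> (elem N2 (1 * t))) (\<lambda>t. \<alpha> (elem N7 (1 * t))) (\<lambda>t. \<alpha> (elem N8 (1 * t))) (\<lambda>t. \<alpha> (elem N1 (- 2 * t))) (- 1 / 2)"
proof (unfold_locales)
  fix a b e v
  note S = elem_Sp4 sp_square_zero_N Sp4_mult
  show "\<alpha> (elem N2 (1 * a)) (\<alpha> (elem N7 (1 * b)) v) = \<alpha> (elem N7 (1 * b)) (\<alpha> (elem N2 (1 * a)) (\<alpha> (elem N8 (1 * (a * b))) (\<alpha> (elem N1 (- 2 * (- 1 / 2 * a\<^sup>2 * b))) v)))"
    using rel_27[of a b] by (simp add: S flip: act_mult) (simp add: matrix_mul_assoc)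
  show "\<alpha> (elem N2 (1 * a)) (\<alpha> (elem N8 (1 * e)) v) = \<alpha> (elem N8 (1 * e)) (\<alpha> (elem N2 (1 * a)) (\<alpha> (elem N1 (- 2 * (a * e))) v))"
    using rel_28[of a e] by (simp add: S mult.assoc flip: act_mult) (simp add: matrix_mul_assoc)
qed (intro isom_flow_elem elem_commuting sp_square_zero_N mnorm_N N_comm | simp)+

text \<open>Here two short roots add up to the long root \<open>N3\<close>, and nothing beyond it
  occurs: a genuine Heisenberg group, so the fourth flow is trivial.\<close>

lemma heis_24: "heis (\<lambda>t. \<alpha> (elem N2 (1 * t))) (\<lambda>t. \<alpha> (elem N4 (1 * t))) (\<lambda>t. \<alpha> (elem N3 (- 2 * t))) (\<lambda>t v. v) 0"
proof (unfold_locales)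
  fix a b e v
  note S = elem_Sp4 sp_square_zero_N Sp4_mult
  show "\<alpha> (elem N2 (1 * a)) (\<alpha> (elem N4 (1 * b)) v) = \<alpha> (elem N4 (1 * b)) (\<alpha> (elem N2 (1 * a)) (\<alpha> (elem N3 (- 2 * (a * b))) v))"
    using rel_24[of a b] by (simp add: S mult.assoc flip: act_mult) (simp add: matrix_mul_assoc)
  show "\<alpha> (elem N2 (1 * a)) (\<alpha> (elem N3 (- 2 * e)) v) = \<alpha> (elem N3 (- 2 * e)) (\<alpha> (elem N2 (1 * a)) v)"
    using elem_comm[OF N_comm(10)] by (simp add: S flip: act_mult)
qed (intro isom_flow_elem isom_flow_id elem_commuting sp_square_zero_N mnorm_N N_comm | simp add: commuting_def)+

end

section \<open>The contraction\<close>

lemma power_times_geometric_tendsto_0: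
  fixes z :: real
  assumes "0 \<le> z" "z < 1"
  shows "(\<lambda>k. real k ^ n * z ^ k) \<longlonglongrightarrow> 0"
  using assms
proof (induction n arbitrary: z)
  case 0 then show ?case using LIMSEQ_power_zero[of z] by simp
next
  case (Suc n)
  have s: "0 \<le> sqrt z" "sqrt z < 1" using Suc.prems by auto
  have "(\<lambda>k. (real k * sqrt z ^ k) * (real k ^ n * sqrt z ^ k)) \<longlonglongrightarrow> 0 * 0"
    using s by (intro tendsto_mult Suc.IH powser_times_n_limit_0) auto
  moreover have "(real k * sqrt z ^ k) * (real k ^ n * sqrt z ^ k) = real k ^ Suc n * z ^ k" for k
  proof -
    have "sqrt z ^ k * sqrt z ^ k = z ^ k" using Suc.prems by (simp flip: power_mult_distrib)
    then show ?thesis by (simp add: mult_ac)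
  qed
  ultimately show ?case by simp
qed

lemma \<theta>_tendsto_0:
  assumes "0 \<le> r" "r < 1" shows "(\<lambda>k. real k ^ n * \<theta> k r) \<longlonglongrightarrow> 0"
proof -
  have "(\<lambda>k. 2 * (real k ^ (n + 1) * r ^ k) + 42 * (real k ^ (n + 3) * (1 / 2) ^ k)) \<longlonglongrightarrow> 2 * 0 + 42 * 0"
    using assms by (intro tendsto_intros power_times_geometric_tendsto_0) auto
  moreover have "2 * (real k ^ (n + 1) * r ^ k) + 42 * (real k ^ (n + 3) * (1 / 2) ^ k) = real k ^ n * \<theta> k r" for k
    by (simp add: \<theta>_def power_add power_divide field_simps eval_nat_numeral)
  ultimately show ?thesis by simp
qed

context sp4_action
begin

lemma smooth_at_mono: "smooth_at s e v \<Longrightarrow> s' \<le> s \<Longrightarrow> smooth_at s' e v"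
  unfolding smooth_at_def by force

text \<open>The bound of \<open>y_invariant\<close> for the number \<open>P = 384 * k\<close> of
  scales that the lengths in \<open>word_estimate\<close> require.\<close>

definition \<epsilon> :: "nat \<Rightarrow> real \<Rightarrow> real \<Rightarrow> real \<Rightarrow> real" where
  "\<epsilon> k r D \<eta> = 161 * (real (384 * k))\<^sup>2 * (\<theta> k r * D) + 10 * real (384 * k) * \<eta>"

text \<open>The roots \<open>e\<^sub>1+e\<^sub>2\<close>, \<open>e\<^sub>2-e\<^sub>1\<close>, \<open>-2e\<^sub>2\<close> positively span the plane and no two of them are opposite:
  any two of the three averages in the word can be interchanged approximately, so the result is almost
  invariant under each of the three root subgroups.\<close>

lemma word_estimate:
  assumes g: "gain_const TYPE('a) r" and k: "k \<ge> 7"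
    and e: "Disp e x" and \<eta>: "smooth_at (1 / (2 ^ (6 * k * k)) ^ 3) \<eta> x"
    and D: "D = real (12 + 576 * (144 * k * k + 1)) * e"
  shows "\<exists>y. norm (y - x) \<le> 3 * D \<and> Disp (3 * \<epsilon> k r (5 * D) \<eta> + 5 * (\<theta> k r * D)) y"
proof -
  define \<kappa> :: real where "\<kappa> = 2 ^ k"
  define \<Lambda> :: real where "\<Lambda> = \<kappa> ^ (6 * k)"
  \<comment> \<open>The largest commutator parameter is \<open>\<Lambda> ^ 24\<close> and the finest
    scale is \<open>1 / \<Lambda> ^ 40\<close>. Bridging them requires
    \<open>\<kappa> ^ P = \<Lambda> ^ 64\<close>, that is \<open>P = 64 * 6 * k\<close>.\<close>
  define P where "P = 384 * k"
  define \<tau> where "\<tau> = 1 / \<Lambda> ^ 40"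
  have \<Lambda>2: "\<Lambda> = 2 ^ (6 * k * k)" by (simp add: \<Lambda>_def \<kappa>_def mult_ac flip: power_mult)
  have "(2::real) ^ (6 * 7 * 7) \<le> \<Lambda>"
    unfolding \<Lambda>2 using k by (intro power_increasing mult_le_mono) auto
  moreover have "(5184::real) \<le> 2 ^ (6 * 7 * 7)" by simp
  ultimately have L: "5184 \<le> \<Lambda>" by linarith
  have L0: "0 < \<Lambda>" "1 \<le> \<Lambda>" using L by auto
  have \<kappa>P: "\<kappa> ^ P = \<Lambda> ^ 64" by (simp add: P_def \<Lambda>_def mult_ac flip: power_mult)
  have M2: "2 * \<Lambda> ^ 24 = 2 ^ (144 * k * k + 1)" by (simp add: \<Lambda>2 mult_ac flip: power_mult)
  have e0: "0 \<le> e" using Disp_nonneg[OF e] .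
  have D0: "0 \<le> D" using e0 by (simp add: D)
  have r0: "0 \<le> r" using g by (simp add: gain_const_def)
  have th: "1 / \<kappa> \<le> \<theta> k r" unfolding \<kappa>_def using k by (intro \<theta>_ge r0) auto
  have k1: "\<kappa> \<le> \<Lambda>" "0 < \<kappa>" unfolding \<Lambda>_def \<kappa>_def using k by (auto intro!: self_le_power one_le_power)
  have th0: "0 \<le> \<theta> k r" using th k1(2) order_trans[of 0 "1 / \<kappa>"] by simp
  have \<eta>0: "0 \<le> \<eta>" using \<eta> Sp4_1 order_trans[OF norm_ge_zero] unfolding smooth_at_def by fastforce
  let ?u = "\<lambda>N t. \<alpha> (elem N t)"
  have dx: "norm (?u N t x - x) \<le> D" if "N \<in> {N1, N2, N3, N4, N5, N6, N7, N8}" "\<bar>t\<bar> \<le> 2 * \<Lambda> ^ 24" for N t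
  proof -
    have "disp_bounded (12 + 576 * (144 * k * k + 1)) (elem N t)"
      using that M2 by (intro disp_bounded_log) auto
    then show ?thesis using e unfolding disp_bounded_def D by blast
  qed
  have o: "isom_flow (?u N2)" "isom_flow (?u N4)" "isom_flow (?u N7)"
    using isom_flow_elem[of N2 1] isom_flow_elem[of N4 1] isom_flow_elem[of N7 1] sp_square_zero_N mnorm_N by simp_all
  \<comment> \<open>The exponents 12, 6, 1 reflect that each use of \<open>y_invariant\<close> loses
    \<open>\<Lambda> ^ 6\<close>: invariance under \<open>N7\<close> must survive two further
    averages and invariance under \<open>N4\<close> one, both down to parameters of size 1. The
    largest parameter is then \<open>(\<Lambda> ^ 6)\<^sup>2 * \<Lambda> ^ 12\<close>.\<close>
  define w1 where "w1 = avg (?u N7) (\<Lambda> ^ 12) x"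
  define y0 where "y0 = avg (?u N4) (\<Lambda> ^ 6) w1"
  define y where "y = avg (?u N2) \<Lambda> y0"
  have Lp: "\<Lambda> ^ a \<le> 2 * \<Lambda> ^ 24" "0 \<le> \<Lambda> ^ a" if "a \<le> 24" for a
    proof -
    have "\<Lambda> ^ a \<le> \<Lambda> ^ 24" using that L0(2) by (rule power_increasing)
    moreover have "0 \<le> \<Lambda> ^ 24" "0 \<le> \<Lambda> ^ a" using L0(1) by simp_all
    ultimately show "\<Lambda> ^ a \<le> 2 * \<Lambda> ^ 24" "0 \<le> \<Lambda> ^ a" by linarith+
  qed
  have n1: "norm (w1 - x) \<le> D"
    unfolding w1_def using avg_dist[OF o(3) dx, of "2 * \<Lambda> ^ 24" "\<Lambda> ^ 12" x 0] Lp[of 12] by simp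
  have n0: "norm (y0 - x) \<le> 2 * D"
    unfolding y0_def using avg_dist[OF o(2) dx _ n1, of "2 * \<Lambda> ^ 24" "\<Lambda> ^ 6"] Lp[of 6] by simp
  have ny: "norm (y - x) \<le> 3 * D"
    unfolding y_def using avg_dist[OF o(1) dx _ n0, of "2 * \<Lambda> ^ 24" \<Lambda>] Lp[of 1] by simp
  have disp: "norm (?u N t w - w) \<le> 2 * n + D"
    if "norm (w - x) \<le> n" "N \<in> {N1, N2, N3, N4, N5, N6, N7, N8}" "\<bar>t\<bar> \<le> 2 * \<Lambda> ^ 24" for N t w n
    proof -
    have "isom_flow (?u N)" using isom_flow_elem[of N 1] sp_square_zero_N mnorm_N that(2) by auto
    then show ?thesis by (rule disp_dist[where h = "?u N", OF _ dx[OF that(2,3)] that(1)])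
  qed
  have sm: "smooth_at (4 * \<tau>) \<eta> x" "smooth_at (4 * \<tau>) \<eta> w1" "smooth_at (4 * \<tau>) \<eta> y0"
  proof -
    \<comment> \<open>The smoothness of \<open>x\<close> must pass through the averages of lengths
      \<open>\<Lambda> ^ 12\<close> and \<open>\<Lambda> ^ 6\<close>. The 4 accounts for flows
      rescaled by up to 2 and for \<open>mnorm N \<le> 2\<close>; the product 36 * 36 * 4 = 5184 is
      absorbed by one factor \<Lambda>.\<close>
    have "36 * (\<Lambda> ^ 12)\<^sup>2 * (36 * (\<Lambda> ^ 6)\<^sup>2 * (4 * \<tau>)) = 5184 / \<Lambda> ^ 4"
      using L0 by (simp add: \<tau>_def field_simps flip: power_mult power_add)
    also have "\<dots> \<le> \<Lambda> / \<Lambda> ^ 4" using L L0 by (intro divide_right_mono) auto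
    also have "\<dots> = 1 / \<Lambda> ^ 3" using L0 by (simp add: eval_nat_numeral)
    finally have s0: "smooth_at (36 * (\<Lambda> ^ 12)\<^sup>2 * (36 * (\<Lambda> ^ 6)\<^sup>2 * (4 * \<tau>))) \<eta> x"
      using \<eta> unfolding \<Lambda>2[symmetric] by (rule smooth_at_mono[rotated])
    have \<tau>0: "0 \<le> 4 * \<tau>" using L0 by (simp add: \<tau>_def)
    have p1: "1 \<le> 36 * (\<Lambda> ^ a)\<^sup>2" for a
      using one_le_power[of "\<Lambda> ^ a" 2] one_le_power[OF L0(2), of a] by linarith
    have le: "s \<le> 36 * (\<Lambda> ^ a)\<^sup>2 * s" if "0 \<le> s" for a s
      using mult_right_mono[OF p1[of a] that] by simp
    have \<tau>1: "0 \<le> 36 * (\<Lambda> ^ 6)\<^sup>2 * (4 * \<tau>)" using \<tau>0 by simp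
    have s1: "smooth_at (36 * (\<Lambda> ^ 6)\<^sup>2 * (4 * \<tau>)) \<eta> w1"
      unfolding w1_def by (rule smooth_avg_elem[OF sp_square_zero_N(7) mnorm_N(7) one_le_power[OF L0(2)] s0])
    show "smooth_at (4 * \<tau>) \<eta> y0"
      unfolding y0_def by (rule smooth_avg_elem[OF sp_square_zero_N(4) mnorm_N(4) one_le_power[OF L0(2)] s1])
    show "smooth_at (4 * \<tau>) \<eta> w1" by (rule smooth_at_mono[OF s1 le[OF \<tau>0]])
    show "smooth_at (4 * \<tau>) \<eta> x" by (rule smooth_at_mono[OF s0 order_trans[OF le[OF \<tau>0] le[OF \<tau>1]]])
  qed
  have tail: "norm (?u N (p * t) w - w) \<le> \<eta>"
    if "smooth_at (4 * \<tau>) \<eta> w" "sp_square_zero N" "mnorm N \<le> 2" "\<bar>p\<bar> \<le> 2" "\<bar>t\<bar> \<le> \<tau>" for w N p t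
  proof (rule smooth_at_elem[OF that(1-3)])
    have "\<bar>p\<bar> * \<bar>t\<bar> \<le> 2 * \<tau>" using that by (intro mult_mono) auto
    then show "2 * \<bar>p * t\<bar> \<le> 4 * \<tau>" by (simp add: abs_mult)
  qed
  have scale: "heis_scale x' y' c d q r k P \<kappa> \<Lambda> (\<Lambda> ^ a) (\<Lambda> ^ b) w D' \<eta> (\<Lambda> ^ 24) \<tau>"
    if h: "heis x' y' c d q" and ab: "2 * a + b \<le> 24"
      and d: "\<And>t. \<bar>t\<bar> \<le> \<Lambda> ^ 24 \<Longrightarrow> norm (x' t w - w) \<le> D' \<and> norm (y' t w - w) \<le> D' \<and> norm (c t w - w) \<le> D' \<and> norm (d t w - w) \<le> D'"
      and t: "\<And>t. \<bar>t\<bar> \<le> \<tau> \<Longrightarrow> norm (c t w - w) \<le> \<eta> \<and> norm (d t w - w) \<le> \<eta>"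
    for x' y' c d :: "real \<Rightarrow> 'a \<Rightarrow> 'a" and q a b w D'
  proof (rule heis_scale.intro[OF h], rule heis_scale_axioms.intro)
    have 24: "\<tau> * \<kappa> ^ P = \<Lambda> ^ 24"
      using L0 unfolding \<kappa>P \<tau>_def by (simp add: field_simps flip: power_add)
    have p: "\<Lambda> ^ n \<le> \<Lambda> ^ 24" if "n \<le> 24" for n using that L0(2) by (rule power_increasing)
    show "\<Lambda> ^ a \<le> \<Lambda> ^ 24" "\<Lambda> ^ b \<le> \<Lambda> ^ 24" using ab by (auto intro!: p)
    show *: "\<Lambda> ^ a * \<Lambda> ^ b \<le> \<Lambda> ^ 24" "(\<Lambda> ^ a)\<^sup>2 * \<Lambda> ^ b \<le> \<Lambda> ^ 24"
      using p[of "a + b"] p[of "2 * a + b"] ab by (simp_all add: power_add power_mult mult.commute[of 2])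
    show "\<Lambda> ^ a * \<Lambda> ^ b \<le> \<tau> * \<kappa> ^ P" "(\<Lambda> ^ a)\<^sup>2 * \<Lambda> ^ b \<le> \<tau> * \<kappa> ^ P"
      unfolding 24 by (rule *)+
    show "1 \<le> P" using k by (simp add: P_def)
  qed (use g k L0 d t in \<open>auto simp: \<kappa>_def \<Lambda>_def\<close>)
  have twice: "\<bar>p * t\<bar> \<le> 2 * \<Lambda> ^ 24" if "\<bar>t\<bar> \<le> \<Lambda> ^ 24" "\<bar>p\<bar> \<le> 2" for p t
    using mult_mono[of "\<bar>p\<bar>" 2 "\<bar>t\<bar>" "\<Lambda> ^ 24"] that by (simp add: abs_mult)
  have emono: "\<epsilon> k r D' \<eta> \<le> \<epsilon> k r (5 * D) \<eta>" if "D' \<le> 5 * D" for D'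
    unfolding \<epsilon>_def using that th0 by (intro add_mono mult_left_mono) auto
  have H1: "heis_scale (?u N4) (?u N7) (\<lambda>t. ?u N6 (- 1 * t)) (\<lambda>t. ?u N5 (2 * t)) (- 1 / 2) r k P \<kappa> \<Lambda> (\<Lambda> ^ 6) (\<Lambda> ^ 12) x D \<eta> (\<Lambda> ^ 24) \<tau>"
  proof (rule scale[OF heis_47[unfolded mult_1]])
    fix t assume "\<bar>t\<bar> \<le> \<Lambda> ^ 24"
    then show "norm (?u N4 t x - x) \<le> D \<and> norm (?u N7 t x - x) \<le> D \<and> norm (?u N6 (- 1 * t) x - x) \<le> D \<and> norm (?u N5 (2 * t) x - x) \<le> D"
      using twice[of t 1] twice[of t "-1"] twice[of t 2] by (intro conjI dx) auto
  next
    fix t assume "\<bar>t\<bar> \<le> \<tau>"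
    then show "norm (?u N6 (- 1 * t) x - x) \<le> \<eta> \<and> norm (?u N5 (2 * t) x - x) \<le> \<eta>"
      by (intro conjI tail sm sp_square_zero_N mnorm_N) auto
  qed simp
  have E1: "norm (?u N7 t y0 - y0) \<le> \<epsilon> k r (5 * D) \<eta>" if "\<bar>t\<bar> \<le> \<Lambda> ^ 6" for t
  proof -
    have "\<Lambda> ^ 12 / \<Lambda> ^ 6 = \<Lambda> ^ 6" using L0 by (simp add: field_simps flip: power_add)
    then have "norm (?u N7 t y0 - y0) \<le> \<epsilon> k r D \<eta>"
      using heis_scale.y_invariant[OF H1, of t] that by (simp add: y0_def w1_def \<epsilon>_def P_def)
    also have "\<dots> \<le> \<epsilon> k r (5 * D) \<eta>" using D0 by (intro emono) auto
    finally show ?thesis .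
  qed
  \<comment> \<open>\<open>y0\<close> is almost fixed by \<open>N7\<close> up to
    \<open>\<Lambda> ^ 6\<close>, so a second average over \<open>N7\<close> can be inserted. It
    makes \<open>N7\<close> adjacent to \<open>N2\<close>, as \<open>heis_27\<close>
    requires.\<close>
  define y' where "y' = avg (?u N2) \<Lambda> (avg (?u N7) (\<Lambda> ^ 6) y0)"
  have H2: "heis_scale (?u N2) (?u N7) (?u N8) (\<lambda>t. ?u N1 (- 2 * t)) (- 1 / 2) r k P \<kappa> \<Lambda> (\<Lambda> ^ 1) (\<Lambda> ^ 6) y0 (2 * (2 * D) + D) \<eta> (\<Lambda> ^ 24) \<tau>"
  proof (rule scale[OF heis_27[unfolded mult_1]])
    fix t assume "\<bar>t\<bar> \<le> \<Lambda> ^ 24"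
    then show "norm (?u N2 t y0 - y0) \<le> 2 * (2 * D) + D \<and> norm (?u N7 t y0 - y0) \<le> 2 * (2 * D) + D \<and>
        norm (?u N8 t y0 - y0) \<le> 2 * (2 * D) + D \<and> norm (?u N1 (- 2 * t) y0 - y0) \<le> 2 * (2 * D) + D"
      using twice[of t 1] twice[of t "-2"] by (intro conjI disp n0) auto
  next
    fix t assume "\<bar>t\<bar> \<le> \<tau>"
    then show "norm (?u N8 t y0 - y0) \<le> \<eta> \<and> norm (?u N1 (- 2 * t) y0 - y0) \<le> \<eta>"
      using tail[of y0 N8 1 t] tail[of y0 N1 "-2" t] sm sp_square_zero_N mnorm_N by simp
  qed simp
  have E2: "norm (?u N7 t y' - y') \<le> \<epsilon> k r (5 * D) \<eta>" if "\<bar>t\<bar> \<le> 1" for t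
    using heis_scale.y_invariant[OF H2, of t] that L0 by (simp add: y'_def \<epsilon>_def P_def)
  have H3: "heis_scale (?u N2) (?u N4) (\<lambda>t. ?u N3 (- 2 * t)) (\<lambda>t v. v) 0 r k P \<kappa> \<Lambda> (\<Lambda> ^ 1) (\<Lambda> ^ 6) w1 (2 * D + D) \<eta> (\<Lambda> ^ 24) \<tau>"
  proof (rule scale[OF heis_24[unfolded mult_1]])
    fix t assume "\<bar>t\<bar> \<le> \<Lambda> ^ 24"
    then show "norm (?u N2 t w1 - w1) \<le> 2 * D + D \<and> norm (?u N4 t w1 - w1) \<le> 2 * D + D \<and>
        norm (?u N3 (- 2 * t) w1 - w1) \<le> 2 * D + D \<and> norm (w1 - w1) \<le> 2 * D + D"
      using twice[of t 1] twice[of t "-2"] D0 by (intro conjI disp n1) auto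
  next
    fix t assume "\<bar>t\<bar> \<le> \<tau>"
    then show "norm (?u N3 (- 2 * t) w1 - w1) \<le> \<eta> \<and> norm (w1 - w1) \<le> \<eta>"
      using tail[of w1 N3 "-2" t] sm sp_square_zero_N mnorm_N \<eta>0 by simp
  qed simp
  have E3: "norm (?u N4 t y - y) \<le> \<epsilon> k r (5 * D) \<eta>" if "\<bar>t\<bar> \<le> 1" for t
  proof -
    have "norm (?u N4 t y - y) \<le> \<epsilon> k r (2 * D + D) \<eta>"
      using heis_scale.y_invariant[OF H3, of t] that L0 by (simp add: y_def y0_def \<epsilon>_def P_def)
    also have "\<dots> \<le> \<epsilon> k r (5 * D) \<eta>" using D0 by (intro emono) auto
    finally show ?thesis .
  qed
  have E4: "norm (?u N2 t y - y) \<le> 5 * (\<theta> k r * D)" if "\<bar>t\<bar> \<le> 1" for t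
  proof -
    have "norm (?u N2 t y - y) \<le> \<bar>t\<bar> / \<bar>\<Lambda>\<bar> * norm (?u N2 \<Lambda> y0 - y0)"
      unfolding y_def using L0 by (intro avg_shift_left o) auto
    also have "\<dots> \<le> \<theta> k r * (2 * (2 * D) + D)"
    proof (rule mult_mono)
      have "\<bar>t\<bar> / \<bar>\<Lambda>\<bar> \<le> 1 / \<kappa>" using that k1 L0 by (intro frac_le) auto
      then show "\<bar>t\<bar> / \<bar>\<Lambda>\<bar> \<le> \<theta> k r" using th by linarith
      show "norm (?u N2 \<Lambda> y0 - y0) \<le> 2 * (2 * D) + D"
        using Lp[of 1] L0 by (intro disp n0) auto
    qed (use th0 in auto)
    finally show ?thesis by (simp add: mult_ac)
  qed
  have yy: "norm (y' - y) \<le> \<epsilon> k r (5 * D) \<eta>"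
    unfolding y'_def y_def
  proof (rule nonexp_le[OF nonexp_avg[OF o(1)]], rule avg_near[OF o(3)])
    fix t :: real assume "0 \<le> t" "t \<le> 1"
    then show "norm (?u N7 (\<Lambda> ^ 6 * t) y0 - y0) \<le> \<epsilon> k r (5 * D) \<eta>"
      using L0 by (intro E1) (simp add: abs_mult mult_left_le)
  qed
  have E5: "norm (?u N7 t y - y) \<le> 3 * \<epsilon> k r (5 * D) \<eta>" if "\<bar>t\<bar> \<le> 1" for t
  proof -
    have "norm (y - y') \<le> \<epsilon> k r (5 * D) \<eta>" using yy by (simp only: norm_minus_commute)
    then have "norm (?u N7 t y - ?u N7 t y') \<le> \<epsilon> k r (5 * D) \<eta>" by (rule nonexp_le[OF isom_flowD(1)[OF o(3)]])
    from norm_chain3[OF norm_chain3[OF this E2[OF that]] yy] show ?thesis by simp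
  qed
  have p: "0 \<le> \<epsilon> k r (5 * D) \<eta>" "0 \<le> 5 * (\<theta> k r * D)"
    using order_trans[OF norm_ge_zero yy] th0 D0 by auto
  have "Disp (3 * \<epsilon> k r (5 * D) \<eta> + 5 * (\<theta> k r * D)) y"
    unfolding Disp_def
  proof (intro ballI allI impI)
    fix N and t :: real assume N: "N \<in> {N2, N4, N7}" and t: "\<bar>t\<bar> \<le> 1"
    have le: "a \<le> 3 * b + c" if "a \<le> b \<or> a \<le> c \<or> a \<le> 3 * b" "0 \<le> b" "0 \<le> c" for a b c :: real
      using that by linarith
    have "norm (?u N t y - y) \<le> \<epsilon> k r (5 * D) \<eta> \<or> norm (?u N t y - y) \<le> 5 * (\<theta> k r * D)
        \<or> norm (?u N t y - y) \<le> 3 * \<epsilon> k r (5 * D) \<eta>"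
      using N E3[OF t] E4[OF t] E5[OF t] by blast
    then show "norm (?u N t y - y) \<le> 3 * \<epsilon> k r (5 * D) \<eta> + 5 * (\<theta> k r * D)" using p by (rule le)
  qed
  with ny show ?thesis by blast
qed

text \<open>The constants \<open>r\<close>, \<open>C0\<close> and \<open>s1\<close> do not depend on
  \<open>x\<close> or \<open>e\<close>, and all bounds are homogeneous in \<open>e\<close>; hence
  one choice of \<open>k\<close> serves for every \<open>x\<close> and \<open>e\<close>.\<close>

lemma contraction:
  "\<exists>C>0. \<forall>x e. 0 < e \<longrightarrow> Disp e x \<longrightarrow> (\<exists>y. norm (y - x) \<le> C * e \<and> Disp (e / 2) y)"
proof -
  obtain r where g: "gain_const TYPE('a) r" using gain_const_exists[OF uc] by blast
  then have r: "0 \<le> r" "r < 1" by (auto simp: gain_const_def)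
  obtain C0 s1 where C0: "C0 > 0" and s1: "s1 > 0" and smooth: "\<And>x \<delta> s. near x \<delta> (1 / 1000000) x \<Longrightarrow> 0 < \<delta> \<Longrightarrow> 0 < s \<Longrightarrow> s \<le> s1 \<Longrightarrow>
      \<exists>v. norm (v - x) \<le> \<delta> \<and> smooth_at s (C0 * s * \<delta>) v"
    using smoothing by blast
  \<comment> \<open>4321 = 2 * 2160 + 1: smoothing moves the vector by at most
    \<open>2160 * e\<close>, after which its displacement is at most \<open>4321 * e\<close>. The
    other factor is the logarithmic growth.\<close>
  define D where "D k = real (12 + 576 * (144 * k * k + 1)) * 4321" for k
  define \<Lambda> :: "nat \<Rightarrow> real" where "\<Lambda> k = 2 ^ (6 * k * k)" for k
  define F where "F k = 3 * \<epsilon> k r (5 * D k) (C0 * (1 / \<Lambda> k ^ 3) * 2160) + 5 * (\<theta> k r * D k)" for k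
  have Lk: "2 ^ k \<le> \<Lambda> k" for k
    unfolding \<Lambda>_def by (intro power_increasing) (cases k; simp)+
  have L3: "0 \<le> 1 / \<Lambda> k ^ 3" "1 / \<Lambda> k ^ 3 \<le> (1 / 2) ^ k" for k
  proof -
    have "\<Lambda> k \<le> \<Lambda> k ^ 3" by (rule self_le_power) (simp_all add: \<Lambda>_def)
    then have "2 ^ k \<le> \<Lambda> k ^ 3" using Lk[of k] by linarith
    then have "1 / \<Lambda> k ^ 3 \<le> 1 / 2 ^ k" by (intro frac_le) auto
    then show "1 / \<Lambda> k ^ 3 \<le> (1 / 2) ^ k" by (simp add: power_divide)
  qed (simp add: \<Lambda>_def)
  have lim1: "(\<lambda>k. 1 / \<Lambda> k ^ 3) \<longlonglongrightarrow> 0"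
    by (rule tendsto_sandwich[of "\<lambda>_. 0" _ _ "\<lambda>k. (1 / 2) ^ k"]) (use L3 in \<open>auto intro!: LIMSEQ_power_zero\<close>)
  have lim2: "(\<lambda>k. real k * (1 / \<Lambda> k ^ 3)) \<longlonglongrightarrow> 0"
  proof (rule tendsto_sandwich[of "\<lambda>_. 0" _ _ "\<lambda>k. real k ^ 1 * (1 / 2) ^ k"])
    show "(\<lambda>k. real k ^ 1 * (1 / 2) ^ k) \<longlonglongrightarrow> 0" by (intro power_times_geometric_tendsto_0) auto
    show "\<forall>\<^sub>F k in sequentially. 0 \<le> real k * (1 / \<Lambda> k ^ 3)" using L3 by simp
    show "\<forall>\<^sub>F k in sequentially. real k * (1 / \<Lambda> k ^ 3) \<le> real k ^ 1 * (1 / 2) ^ k"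
      using L3(2) by (intro always_eventually allI) (auto intro!: mult_left_mono simp del: times_divide_eq_right)
  qed simp
  have limF: "F \<longlonglongrightarrow> 0"
  proof -
    let ?c = "4321 * 588 :: real" and ?d = "4321 * 82944 :: real"
    have D': "D k = ?c + ?d * real k ^ 2" for k by (simp add: D_def power2_eq_square)
    have F': "F k = 3 * (161 * 384\<^sup>2 * 5 * (?c * (real k ^ 2 * \<theta> k r) + ?d * (real k ^ 4 * \<theta> k r))
        + 10 * 384 * C0 * 2160 * (real k * (1 / \<Lambda> k ^ 3))) + 5 * (?c * (real k ^ 0 * \<theta> k r) + ?d * (real k ^ 2 * \<theta> k r))" for k
      unfolding F_def \<epsilon>_def D' by (simp add: algebra_simps power2_eq_square eval_nat_numeral)
    have "(\<lambda>k. 3 * (161 * 384\<^sup>2 * 5 * (?c * (real k ^ 2 * \<theta> k r) + ?d * (real k ^ 4 * \<theta> k r))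
        + 10 * 384 * C0 * 2160 * (real k * (1 / \<Lambda> k ^ 3))) + 5 * (?c * (real k ^ 0 * \<theta> k r) + ?d * (real k ^ 2 * \<theta> k r)))
      \<longlonglongrightarrow> 3 * (161 * 384\<^sup>2 * 5 * (?c * 0 + ?d * 0) + 10 * 384 * C0 * 2160 * 0) + 5 * (?c * 0 + ?d * 0)"
      by (intro tendsto_intros \<theta>_tendsto_0 r lim2)
    then show ?thesis unfolding F'[symmetric] by simp
  qed
  have "\<forall>\<^sub>F k in sequentially. F k < 1 / 2 \<and> 1 / \<Lambda> k ^ 3 < s1 \<and> 7 \<le> k"
    using order_tendstoD(2)[OF limF, of "1 / 2"] order_tendstoD(2)[OF lim1 s1] eventually_ge_at_top[of 7]
    by (intro eventually_conj) simp_all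
  then obtain k where k: "F k < 1 / 2" "1 / \<Lambda> k ^ 3 < s1" "7 \<le> k"
    using eventually_happens'[OF sequentially_bot] by blast
  have "\<exists>y. norm (y - x) \<le> (2160 + 3 * D k) * e \<and> Disp (e / 2) y" if e: "0 < e" and x: "Disp e x" for x e
  proof -
    obtain v where v: "norm (v - x) \<le> 2160 * e" "smooth_at (1 / \<Lambda> k ^ 3) (C0 * (1 / \<Lambda> k ^ 3) * (2160 * e)) v"
      using smooth[OF Disp_near[OF x], of "1 / \<Lambda> k ^ 3"] e k(2) by (auto simp: \<Lambda>_def)
    have dv: "Disp (4321 * e) v"
      unfolding Disp_def
    proof (intro ballI allI impI)
      fix N and t :: real assume N: "N \<in> {N2, N4, N7}" and t: "\<bar>t\<bar> \<le> 1"
      have "norm (\<alpha> (elem N t) x - x) \<le> e" using x N t unfolding Disp_def by blast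
      moreover have "isom_flow (\<lambda>t. \<alpha> (elem N t))" using isom_flow_elem[of N 1] sp_square_zero_N mnorm_N N by auto
      ultimately have "norm (\<alpha> (elem N t) v - v) \<le> 2 * (2160 * e) + e" by (intro disp_dist[OF _ _ v(1)])
      then show "norm (\<alpha> (elem N t) v - v) \<le> 4321 * e" by simp
    qed
    obtain y where y: "norm (y - v) \<le> 3 * (D k * e)"
      "Disp (3 * \<epsilon> k r (5 * (D k * e)) (C0 * (1 / \<Lambda> k ^ 3) * (2160 * e)) + 5 * (\<theta> k r * (D k * e))) y"
      using word_estimate[OF g k(3) dv v(2)[unfolded \<Lambda>_def], of "D k * e"] by (auto simp: D_def \<Lambda>_def)
    have "3 * \<epsilon> k r (5 * (D k * e)) (C0 * (1 / \<Lambda> k ^ 3) * (2160 * e)) + 5 * (\<theta> k r * (D k * e)) = F k * e"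
      by (simp add: F_def \<epsilon>_def algebra_simps)
    also have "\<dots> \<le> 1 / 2 * e" using k(1) e by (intro mult_right_mono) auto
    finally have "Disp (e / 2) y" using y(2) unfolding Disp_def by force
    moreover have "norm (y - x) \<le> 3 * (D k * e) + 2160 * e" by (rule norm_chain3[OF y(1) v(1)])
    then have "norm (y - x) \<le> (2160 + 3 * D k) * e" by (simp add: algebra_simps)
    ultimately show ?thesis by blast
  qed
  moreover have "0 < 2160 + 3 * D k" by (simp add: D_def add_pos_nonneg)
  ultimately show ?thesis by blast
qed

section \<open>From the contraction to a fixed point\<close>

lemma initial: "\<exists>e>0. Disp e 0"
proof -
  have "\<exists>b. \<forall>t. \<bar>t\<bar> \<le> 1 \<longrightarrow> norm (\<alpha> (elem N t) 0 - 0) \<le> b" if "N \<in> {N2, N4, N7}" for N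
  proof -
    have "isom_flow (\<lambda>t. \<alpha> (elem N t))" using isom_flow_elem[of N 1] sp_square_zero_N mnorm_N that by auto
    then have "continuous_on {-1..1} (\<lambda>t. \<alpha> (elem N t) 0)" by (rule isom_flowD(4))
    then have "compact ((\<lambda>t. \<alpha> (elem N t) 0) ` {-1..1})" by (intro compact_continuous_image) auto
    then obtain b where "\<forall>v\<in>(\<lambda>t. \<alpha> (elem N t) 0) ` {-1..1}. norm v \<le> b"
      using compact_imp_bounded bounded_iff by metis
    then show ?thesis by (intro exI[of _ b]) (auto simp: abs_le_iff)
  qed
  then obtain b where b: "\<And>N t. N \<in> {N2, N4, N7} \<Longrightarrow> \<bar>t\<bar> \<le> 1 \<Longrightarrow> norm (\<alpha> (elem N t) 0 - 0) \<le> b N"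
    by metis
  have "Disp (\<bar>b N2\<bar> + \<bar>b N4\<bar> + \<bar>b N7\<bar> + 1) 0"
    unfolding Disp_def
  proof (intro ballI allI impI)
    fix N and t :: real assume N: "N \<in> {N2, N4, N7}" and t: "\<bar>t\<bar> \<le> 1"
    have "norm (\<alpha> (elem N t) 0 - 0) \<le> b N" by (rule b[OF N t])
    also have "\<dots> \<le> \<bar>b N2\<bar> + \<bar>b N4\<bar> + \<bar>b N7\<bar> + 1" using N by auto
    finally show "norm (\<alpha> (elem N t) 0 - 0) \<le> \<bar>b N2\<bar> + \<bar>b N4\<bar> + \<bar>b N7\<bar> + 1" .
  qed
  then show ?thesis by (intro exI[of _ "\<bar>b N2\<bar> + \<bar>b N4\<bar> + \<bar>b N7\<bar> + 1"]) auto
qed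

lemma Disp_0_exists: "\<exists>z. Disp 0 z"
proof -
  obtain C where C: "C > 0" and *: "\<And>x e. 0 < e \<Longrightarrow> Disp e x \<Longrightarrow> \<exists>y. norm (y - x) \<le> C * e \<and> Disp (e / 2) y"
    using contraction by blast
  obtain e where e: "e > 0" "Disp e 0" using initial by blast
  obtain X where X: "\<And>n. Disp (e / 2 ^ n) (X n)" "\<And>n. norm (X (Suc n) - X n) \<le> C * (e / 2 ^ n)"
  proof -
    have "\<exists>X. \<forall>n. Disp (e / 2 ^ n) (X n) \<and> norm (X (Suc n) - X n) \<le> C * (e / 2 ^ n)"
    proof (rule dependent_nat_choice)
      show "\<exists>x. Disp (e / 2 ^ 0) x" using e by auto
      show "\<exists>y. Disp (e / 2 ^ Suc n) y \<and> norm (y - x) \<le> C * (e / 2 ^ n)" if "Disp (e / 2 ^ n) x" for x n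
        using *[OF _ that] e(1) by (auto simp: field_simps)
    qed
    then show thesis using that by blast
  qed
  have "summable (\<lambda>n. C * (e * (1 / 2) ^ n))"
    by (intro summable_mult summable_geometric) simp
  then have "summable (\<lambda>n. X (Suc n) - X n)"
    by (rule summable_comparison_test'[where N = 0]) (use X(2) in \<open>simp add: power_divide\<close>)
  then have "(\<lambda>n. \<Sum>i<n. X (Suc i) - X i) \<longlonglongrightarrow> (\<Sum>n. X (Suc n) - X n)"
    by (rule summable_LIMSEQ)
  then have "(\<lambda>n. X n - X 0) \<longlonglongrightarrow> (\<Sum>n. X (Suc n) - X n)"
    by (simp add: sum_lessThan_telescope)
  from tendsto_add[OF this tendsto_const[of "X 0"]]
  obtain z where z: "X \<longlonglongrightarrow> z" by auto
  have "Disp 0 z"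
    unfolding Disp_def
  proof (intro ballI allI impI)
    fix N and t :: real assume N: "N \<in> {N2, N4, N7}" and t: "\<bar>t\<bar> \<le> 1"
    have S: "elem N t \<in> Sp4" using N elem_Sp4 sp_square_zero_N by auto
    have "(\<lambda>n. \<alpha> (elem N t) (X n)) \<longlonglongrightarrow> \<alpha> (elem N t) z"
      by (rule continuous_on_tendsto_compose[where s = UNIV, OF nonexp_cont[OF act_nonexp[OF S]] z]) auto
    then have 1: "(\<lambda>n. norm (\<alpha> (elem N t) (X n) - X n)) \<longlonglongrightarrow> norm (\<alpha> (elem N t) z - z)"
      by (intro tendsto_intros z)
    have "(\<lambda>n. e * (1 / 2) ^ n) \<longlonglongrightarrow> e * 0" by (intro tendsto_intros LIMSEQ_power_zero) simp
    then have 2: "(\<lambda>n. e / 2 ^ n) \<longlonglongrightarrow> 0" by (simp add: power_divide)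
    have "norm (\<alpha> (elem N t) (X n) - X n) \<le> e / 2 ^ n" for n
      using X(1)[of n] N t unfolding Disp_def by blast
    then show "norm (\<alpha> (elem N t) z - z) \<le> 0"
      by (intro LIMSEQ_le[OF 1 2]) auto
  qed
  then show ?thesis ..
qed

text \<open>For \<open>e = 0\<close> each displacement bound becomes an equality, so the stabiliser
  contains all root elements and the torus. Elimination writes \<open>g\<close> as a product of
  these, after a root element has made each vanishing pivot nonzero.\<close>

lemma Disp_0_fixed:
  assumes z: "Disp 0 z" and g: "g \<in> Sp4"
  shows "\<alpha> g z = z"
proof -
  define St where "St = {g \<in> Sp4. \<alpha> g z = z}"
  have disp_bounded: "g \<in> St" if "disp_bounded n g" for n g
  proof -
    have "g \<in> Sp4" "norm (\<alpha> g z - z) \<le> real n * 0" using that z unfolding disp_bounded_def by blast+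
    then show ?thesis by (simp add: St_def)
  qed
  have mult: "g ** h \<in> St" if "g \<in> St" "h \<in> St" for g h
    using that by (simp add: St_def Sp4_mult act_mult)
  have el: "elem N t \<in> St" if N: "N \<in> {N1, N2, N3, N4, N5, N6, N7, N8}" for N t
  proof -
    obtain n where "\<bar>t\<bar> < 2 ^ n" using real_arch_pow[of 2 "\<bar>t\<bar>"] by auto
    then have "\<bar>t\<bar> \<le> 2 ^ n" by simp
    then show ?thesis by (rule disp_bounded[OF disp_bounded_log[OF N]])
  qed
  have dg: "diag4 a 1 \<in> St" "diag4 1 a \<in> St" if a: "a \<noteq> 0" for a
  proof -
    obtain n where n: "\<bar>a\<bar> + \<bar>1 / a\<bar> + 1 < real n" using reals_Archimedean2 by blast
    moreover have "0 \<le> \<bar>a\<bar>" "0 \<le> \<bar>1 / a\<bar>" by (rule abs_ge_zero)+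
    ultimately have "\<bar>a\<bar> \<le> real n" "\<bar>1 / a\<bar> \<le> real n" "1 \<le> real n" by linarith+
    then show "diag4 a 1 \<in> St" "diag4 1 a \<in> St" using disp_bounded[OF disp_bounded_diag4(1)[OF a]] disp_bounded[OF disp_bounded_diag4(2)[OF a]] by auto
  qed
  have main: "g \<in> St" if g: "g \<in> Sp4" and nz: "g$1$1 \<noteq> 0" for g
  proof -
    obtain l p r b e f h where hS: "h \<in> Sp4" and h1: "h$1$1 = g$1$1" and
      hz: "h$1$2 = 0" "h$1$3 = 0" "h$1$4 = 0" "h$2$1 = 0" "h$3$1 = 0" "h$4$1 = 0" and
      geq: "g = elem N4 l ** (elem N6 p ** (elem N5 r ** (((h ** elem N1 f) ** elem N2 e) ** elem N8 b)))"
      by (rule elimination[OF g nz])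
    have blk: "h \<in> St" if "h \<in> Sp4" "h$1$1 \<noteq> 0" "h$2$2 \<noteq> 0" "h$1$2 = 0" "h$1$3 = 0" "h$1$4 = 0" "h$2$1 = 0" "h$3$1 = 0" "h$4$1 = 0" for h
      by (subst block_form[OF that]) (intro mult dg el that; simp)
    have "h \<in> St"
    proof (cases "h$2$2 = 0")
      case False then show ?thesis using blk[OF hS _ _ hz] h1 nz by simp
    next
      case True
      \<comment> \<open>If the second pivot vanishes, the symplectic relations make
        \<open>h$4$2\<close> nonzero, and \<open>N3\<close> adds row 4 to row 2.\<close>
      have ent: "(elem N3 t ** h)$1$j = h$1$j" "(elem N3 t ** h)$2$j = h$2$j + t * h$4$j" "(elem N3 t ** h)$3$j = h$3$j" "(elem N3 t ** h)$4$j = h$4$j" for t j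
        by (simp_all add: matrix_matrix_mult_def sum_4 mat_def elem_def N_defs)
      have "h$3$2 = 0" using Sp4_entry[OF hS, of 1 2] h1 nz hz by (simp add: symplJ_def)
      then have "h$4$2 \<noteq> 0" using Sp4_entry[OF hS, of 2 4] True hz by (auto simp: symplJ_def)
      then have "elem N3 1 ** h \<in> St"
        using h1 nz hz True by (intro blk Sp4_mult elem_Sp4 sp_square_zero_N hS) (simp_all add: ent)
      from mult[OF el this] have "elem N3 (- 1) ** (elem N3 1 ** h) \<in> St" by simp
      then show ?thesis using elem_cancel_left[OF sp_square_zero_N(3), of "-1" h] by simp
    qed
    then show ?thesis by (subst geq) (intro mult el; simp)
  qed
  have "g \<in> St"
  proof (cases "g$1$1 = 0")
    case False then show ?thesis using main[OF g] by simp
  next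
    case True
    \<comment> \<open>The first column cannot vanish; \<open>N8\<close>, \<open>N1\<close> and
      \<open>N2\<close> add row 2, 3 and 4, respectively, to the first row, and one of them makes
      the pivot nonzero.\<close>
    have "g$2$1 \<noteq> 0 \<or> g$3$1 \<noteq> 0 \<or> g$4$1 \<noteq> 0"
      using Sp4_entry[OF g, of 1 3] True by (auto simp: symplJ_def)
    then consider "g$2$1 \<noteq> 0" | "g$3$1 \<noteq> 0" | "g$4$1 \<noteq> 0" by blast
    then obtain N where N: "N \<in> {N1, N2, N8}" "(elem N 1 ** g)$1$1 \<noteq> 0"
    proof cases
      case 1 then show thesis using True by (intro that[of N8]) (simp_all add: matrix_matrix_mult_def sum_4 mat_def elem_def N_defs)
    next
      case 2 then show thesis using True by (intro that[of N1]) (simp_all add: matrix_matrix_mult_def sum_4 mat_def elem_def N_defs)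
    next
      case 3 then show thesis using True by (intro that[of N2]) (simp_all add: matrix_matrix_mult_def sum_4 mat_def elem_def N_defs)
    qed
    have nN: "sp_square_zero N" using N sp_square_zero_N by auto
    have "elem N 1 ** g \<in> St" by (intro main N Sp4_mult elem_Sp4 nN g)
    from mult[OF el this] have "elem N (- 1) ** (elem N 1 ** g) \<in> St" using N(1) by auto
    then show ?thesis using elem_cancel_left[OF nN, of "-1" g] by simp
  qed
  then show ?thesis by (simp add: St_def)
qed

end

theorem theorem5p11:
  fixes \<alpha> :: "real^4^4 \<Rightarrow> 'a::banach \<Rightarrow> 'a"
  assumes "uniformly_convex TYPE('a)"
    and "continuous_isometric_action_Sp4 \<alpha>"
  shows "\<exists>x. \<forall>g\<in>Sp4. \<alpha> g x = x"
proof -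
  interpret sp4_action \<alpha> using assms by unfold_locales
  show ?thesis using Disp_0_exists Disp_0_fixed by blast
qed

end
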